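(* Let $p(x,z,\lambda,\eta)=\lambda^2+q(x,z,\eta)$, $\phi_i$ and $\underline\eta$ be as in the context (so that $\partial_x\phi_i(0,z)=z_1$ and the base point is a glancing point of exact order two of diffractive type), and let $Z_r(s,y)=(x(s,y),z(s,y))$ be the reflected flow map, where $(x,z,\lambda,\eta)(s,y)$ solves $$\begin{cases}x_s=2\lambda,&x(0,y)=0,\\ z_s=\partial_\eta q,&z(0,y)=y,\\ \lambda_s=-\partial_xq,&\lambda(0,y)=-y_1,\ \text{where } y_1\le0,\\ \eta_s=-\partial_zq,&\eta(0,y)=\partial_y\phi_i(0,y).\end{cases}$$ Let $\omega$ be the closure of an open neighborhood of $(0,0)$ in $\{(s,y):s\ge0,\ y_1\le0\}$, and set $\mathring\omega:=\omega\cap\{y_1<0\}$. If $\omega$ is small enough, the map $Z_r:\mathring\omega\to Z_r(\mathring\omega)$ is a $C^\infty$ diffeomorphism, which extends to a homeomorphism $Z_r:\omega\to Z_r(\omega)$.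
   Context: Coordinates $(x,z)\in\mathbb R\times\mathbb R^n$, $z=(z_1,\dots,z_n)$, dual variables $(\lambda,\eta)\in\mathbb R\times\mathbb R^n$, near $(0,0)$; the domain is $M=\{x\ge0\}$. $q(x,z,\eta)$ is $C^\infty$ in $(x,z)$ and a quadratic form in $\eta$ of signature $(n-1,1)$. $\phi_i(x,z)$ is a real $C^\infty$ function near $(0,0)$ (the incoming phase) solving the eikonal equation $(\partial_x\phi_i)^2+q(x,z,\partial_z\phi_i)=0$, with coordinates chosen so that $\partial_x\phi_i(0,z)=z_1$. Put $\underline\eta=\partial_z\phi_i(0,0)$, $\underline\rho=(0,0,0,\underline\eta)$. The point $\underline\sigma=(z,\eta)=(0,\underline\eta)$ is assumed to belong to $G_d^2\setminus G^3$, i.e. $p(\underline\rho)=0$, $H_px(\underline\rho)=0$, $H_p^2x(\underline\rho)>0$, where $H_p$ is the Hamilton vector field of $p$. Consequently $\partial_{\eta_1}q(0,0,\underline\eta)=-\partial_xq(0,0,\underline\eta)>0$. In the bicharacteristic system the derivatives of $q$ are evaluated at $(x,z,\eta)(s,y)$; $y\in\mathbb R^n$ parametrizes initial points $(0,y)\in\partial M$. *)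

theory Defs
  imports "HOL-Analysis.Analysis"
begin

text \<open>
  \<open>C^k\<close> on an open set of a finite-dimensional space: in finite dimension, continuity of
  \<open>f\<close> and of all its iterated directional derivatives up to order \<open>k\<close>
  is the usual \<open>C^k\<close> condition.
\<close>

primrec Ck_on :: "nat \<Rightarrow> 'a::euclidean_space set \<Rightarrow> ('a \<Rightarrow> 'b::euclidean_space) \<Rightarrow> bool" where
  "Ck_on 0 U f \<longleftrightarrow> continuous_on U f"
| "Ck_on (Suc k) U f \<longleftrightarrow>
     (\<forall>x\<in>U. f differentiable (at x)) \<and>
     (\<forall>v. Ck_on k U (\<lambda>x. frechet_derivative f (at x) v))"

text \<open>
  On an arbitrary set \<open>S\<close>, smooth means: locally the restriction of a smooth function defined
  on an open set.  For open \<open>S\<close> this is ordinary smoothness; in general it is the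
  notion used for manifolds with boundary or corners.
\<close>

definition smooth_on :: "'a::euclidean_space set \<Rightarrow> ('a \<Rightarrow> 'b::euclidean_space) \<Rightarrow> bool" where
  "smooth_on S f \<longleftrightarrow>
     (\<forall>a\<in>S. \<exists>W g. open W \<and> a \<in> W \<and> (\<forall>k. Ck_on k W g) \<and> (\<forall>x\<in>S \<inter> W. g x = f x))"

definition smooth_diffeomorphism ::
  "'a::euclidean_space set \<Rightarrow> 'b::euclidean_space set \<Rightarrow> ('a \<Rightarrow> 'b) \<Rightarrow> bool" where
  "smooth_diffeomorphism S T f \<longleftrightarrow>
     bij_betw f S T \<and> smooth_on S f \<and> smooth_on T (inv_into S f)"

definition grad :: "(real^'n \<Rightarrow> real) \<Rightarrow> real^'n \<Rightarrow> real^'n" where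
  "grad f z = (\<chi> i. frechet_derivative f (at z) (axis i 1))"

definition quadratic_form :: "(real^'n \<Rightarrow> real) \<Rightarrow> bool" where
  "quadratic_form Q \<longleftrightarrow>
     (\<exists>A. transpose A = A \<and> (\<forall>\<eta>. Q \<eta> = \<eta> \<bullet> (A *v \<eta>)))"

text \<open>
  \<open>has_signature Q p m\<close>: after a linear change of variables \<open>Q\<close> is diagonal with
  \<open>p\<close> positive and \<open>m\<close> negative coefficients (well defined by Sylvester's law).
\<close>

definition has_signature :: "(real^'n \<Rightarrow> real) \<Rightarrow> nat \<Rightarrow> nat \<Rightarrow> bool" where
  "has_signature Q p m \<longleftrightarrow>
     (\<exists>(P :: real^'n^'n) (c :: 'n \<Rightarrow> real). invertible P \<and>
        (\<forall>\<xi>. Q (P *v \<xi>) = (\<Sum>i\<in>UNIV. c i * (\<xi> $ i)\<^sup>2)) \<and>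
        card {i. c i > 0} = p \<and> card {i. c i < 0} = m)"

text \<open>Functions on phase space take the arguments \<open>x, z, \<lambda>, \<eta>\<close> in this order.\<close>

type_synonym 'n phase_fun = "real \<Rightarrow> real^'n \<Rightarrow> real \<Rightarrow> real^'n \<Rightarrow> real"

definition hamilton_field :: "'n::finite phase_fun \<Rightarrow> 'n phase_fun \<Rightarrow> 'n phase_fun" where
  "hamilton_field p f = (\<lambda>x z l \<eta>.
       deriv (\<lambda>l'. p x z l' \<eta>) l * deriv (\<lambda>x'. f x' z l \<eta>) x
     - deriv (\<lambda>x'. p x' z l \<eta>) x * deriv (\<lambda>l'. f x z l' \<eta>) l
     + grad (\<lambda>\<eta>'. p x z l \<eta>') \<eta> \<bullet> grad (\<lambda>z'. f x z' l \<eta>) z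
     - grad (\<lambda>z'. p x z' l \<eta>) z \<bullet> grad (\<lambda>\<eta>'. f x z l \<eta>') \<eta>)"

definition symbol :: "(real \<Rightarrow> real^'n \<Rightarrow> real^'n \<Rightarrow> real) \<Rightarrow> 'n::finite phase_fun" where
  "symbol q = (\<lambda>x z l \<eta>. l\<^sup>2 + q x z \<eta>)"

definition coord_x :: "'n::finite phase_fun" where
  "coord_x = (\<lambda>x z l \<eta>. x)"

text \<open>The point \<open>(0, 0, 0, \<eta>)\<close> lies in \<open>G_d^2 - G^3\<close>: diffractive of exact order two.\<close>

definition diffractive_order2 ::
  "(real \<Rightarrow> real^'n \<Rightarrow> real^'n \<Rightarrow> real) \<Rightarrow> real^'n::finite \<Rightarrow> bool" where
  "diffractive_order2 q \<eta> \<longleftrightarrow>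
     symbol q 0 0 0 \<eta> = 0 \<and>
     hamilton_field (symbol q) coord_x 0 0 0 \<eta> = 0 \<and>
     hamilton_field (symbol q) (hamilton_field (symbol q) coord_x) 0 0 0 \<eta> > 0"

text \<open>
  \<open>k\<close> is the index of the distinguished first coordinate \<open>z_1\<close>.  A solution is given on the
  parameter box \<open>0 \<le> s \<le> T\<close>, \<open>y \<in> ball 0 r\<close>, \<open>y_1 \<le> 0\<close>; only its
  differentiability in \<open>s\<close> is required (one-sided at the end points).
\<close>

definition reflected_flow ::
  "'n \<Rightarrow> (real \<times> (real^'n)) set \<Rightarrow> (real \<Rightarrow> real^'n \<Rightarrow> real^'n \<Rightarrow> real) \<Rightarrow>
   (real \<Rightarrow> real^'n \<Rightarrow> real) \<Rightarrow> real \<Rightarrow> real \<Rightarrow>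
   (real \<Rightarrow> real^'n \<Rightarrow> real) \<Rightarrow> (real \<Rightarrow> real^'n \<Rightarrow> real^'n) \<Rightarrow>
   (real \<Rightarrow> real^'n \<Rightarrow> real) \<Rightarrow> (real \<Rightarrow> real^'n \<Rightarrow> real^'n::finite) \<Rightarrow> bool" where
  "reflected_flow k U q \<phi> T r X Z L E \<longleftrightarrow>
     (\<forall>y \<in> ball 0 r. y $ k \<le> 0 \<longrightarrow>
        X 0 y = 0 \<and> Z 0 y = y \<and> L 0 y = - (y $ k) \<and> E 0 y = grad (\<phi> 0) y \<and>
        (\<forall>s \<in> {0..T}.
           (X s y, Z s y) \<in> U \<and>
           ((\<lambda>t. X t y) has_real_derivative 2 * L s y) (at s within {0..T}) \<and>
           ((\<lambda>t. Z t y) has_vector_derivative grad (q (X s y) (Z s y)) (E s y))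
              (at s within {0..T}) \<and>
           ((\<lambda>t. L t y) has_real_derivative - deriv (\<lambda>x. q x (Z s y) (E s y)) (X s y))
              (at s within {0..T}) \<and>
           ((\<lambda>t. E t y) has_vector_derivative - grad (\<lambda>z. q (X s y) z (E s y)) (Z s y))
              (at s within {0..T})))"

definition param_wedge :: "'n \<Rightarrow> (real \<times> (real^'n::finite)) set" where
  "param_wedge k = {(s, y). 0 \<le> s \<and> y $ k \<le> 0}"

end

theory Submission
  imports Defs
begin

text \<open>
  Write the reflected flow as \<open>(x, z, \<lambda>, \<eta>)(s, y)\<close> and \<open>a = - \<partial>\<^sub>x q > 0\<close> at the base point.
  Differentiating the eikonal equation in \<open>x\<close> gives \<open>\<partial>q / \<partial>\<eta>\<^sub>1 = a\<close> there, so that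
  \<open>\<lambda> \<approx> - y\<^sub>1 + a s\<close>, \<open>z \<approx> y + s c\<close> with \<open>c\<^sub>1 = a\<close>, and, since \<open>x\<close> vanishes at \<open>s = 0\<close>,
  \<open>\<partial>\<^sub>y x \<approx> - 2 s dy\<^sub>1\<close>.  Along a direction \<open>(\<sigma>, v)\<close> with \<open>\<sigma> > 0\<close> that preserves \<open>z\<close>, i.e.
  \<open>v \<approx> - \<sigma> c\<close>, this yields \<open>dx \<approx> \<sigma> (- 2 y\<^sub>1 + 4 a s)\<close>, which is positive on the wedge
  \<open>s \<ge> 0, y\<^sub>1 \<le> 0\<close> away from its edge \<open>s = y\<^sub>1 = 0\<close>.  The Jacobian is therefore invertible there, and
  integrating along segments shows that \<open>Z\<^sub>r\<close> is injective on the whole wedge near the origin;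
  compactness then gives the homeomorphism.  Smoothness in the parameter \<open>y\<close> comes from the
  variational equation: it has the same form as the original one with one derivative less, hence
  induction on the order of differentiability.
\<close>

section \<open>Calculus of \<open>C^k\<close> functions\<close>

text \<open>The whole differential of \<open>x\<close> vanishes at the base point, so the inverse
  function theorem says nothing there. The substitute is a cone argument: equal values of
  \<open>z\<close> force the difference of two parameters into a narrow cone around the line of
  \<open>(1, - c)\<close>, and on the half of it with positive time component the differential of
  \<open>x\<close> is positive. A second obstacle is regularity. The given flow is only
  differentiable in \<open>s\<close>, and nothing is assumed about its dependence on
  \<open>y\<close>. A smooth flow is therefore constructed on a two-sided neighborhood and
  identified with the given one on the wedge by uniqueness; it also supplies the extensions that
  \<open>smooth_on\<close> asks for. The variational equation inherits the bound \<open>K\<close> on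
  the derivative in the unknown, so the time interval does not shrink as the order of
  differentiability grows. Finally, \<open>q\<close> is smooth in \<open>(x, z)\<close> only for
  each fixed covector; polarization of the quadratic form recovers joint smoothness.\<close>

lemma frechet_derivative_eq:
  "(f has_derivative f') (at x) \<Longrightarrow> frechet_derivative f (at x) = f'"
  by (metis frechet_derivative_at)

lemma linear_eq_sum_Basis:
  fixes f :: "'a::euclidean_space \<Rightarrow> 'b::real_vector"
  assumes "linear f"
  shows "f v = (\<Sum>b\<in>Basis. (v \<bullet> b) *\<^sub>R f b)"
proof -
  have "f v = f (\<Sum>b\<in>Basis. (v \<bullet> b) *\<^sub>R b)"
    by (simp add: euclidean_representation)
  then show ?thesis
    by (simp add: linear_sum[OF assms] linear_cmul[OF assms])
qed

lemma Ck_on_Suc_imp_has_derivative: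
  "Ck_on (Suc k) U f \<Longrightarrow> x \<in> U \<Longrightarrow> (f has_derivative frechet_derivative f (at x)) (at x)"
  by (simp add: frechet_derivative_works)

lemma Ck_on_subset: "Ck_on k U f \<Longrightarrow> V \<subseteq> U \<Longrightarrow> Ck_on k V f"
  by (induction k arbitrary: f) (auto intro: continuous_on_subset)

lemma Ck_on_Suc_imp: "Ck_on (Suc k) U f \<Longrightarrow> Ck_on k U f"
proof (induction k arbitrary: f)
  case 0
  then show ?case
    by (auto intro!: continuous_at_imp_continuous_on differentiable_imp_continuous_within)
next
  case (Suc k)
  then show ?case
    unfolding Ck_on.simps(2)[of "Suc k"] Ck_on.simps(2)[of k U f] by blast
qed

lemma Ck_on_le: "Ck_on l U f \<Longrightarrow> k \<le> l \<Longrightarrow> Ck_on k U f"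
  by (induction l) (auto simp: le_Suc_eq simp del: Ck_on.simps(2) dest: Ck_on_Suc_imp)

lemma Ck_on_imp_continuous_on: "Ck_on k U f \<Longrightarrow> continuous_on U f"
  using Ck_on_le[of k U f 0] by simp

lemma Ck_on_cong:
  assumes "open U" "\<And>x. x \<in> U \<Longrightarrow> f x = g x"
  shows "Ck_on k U f \<longleftrightarrow> Ck_on k U g"
  using assms(2)
proof (induction k arbitrary: f g)
  case 0
  then show ?case by (simp cong: continuous_on_cong)
next
  case (Suc k)
  have 1: "(f has_derivative D) (at x) \<longleftrightarrow> (g has_derivative D) (at x)" if "x \<in> U" for x D
    using has_derivative_transform_within_open[of f D x UNIV U g]
      has_derivative_transform_within_open[of g D x UNIV U f] Suc.prems assms(1) that by auto
  then have 2: "f differentiable at x \<longleftrightarrow> g differentiable at x" if "x \<in> U" for x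
    unfolding differentiable_def using that by blast
  have 3: "frechet_derivative f (at x) = frechet_derivative g (at x)" if "x \<in> U" for x
    unfolding frechet_derivative_def using 1 that by simp
  have "Ck_on k U (\<lambda>x. frechet_derivative f (at x) v) \<longleftrightarrow> Ck_on k U (\<lambda>x. frechet_derivative g (at x) v)" for v
    by (rule Suc.IH) (simp add: 3)
  with 2 show ?case by simp
qed

lemma Ck_on_local:
  assumes "\<And>x. x \<in> U \<Longrightarrow> \<exists>W. open W \<and> x \<in> W \<and> Ck_on k W f"
  shows "Ck_on k U f"
  using assms
proof (induction k arbitrary: f)
  case 0
  then show ?case
    using continuous_on_eq_continuous_at by (fastforce intro!: continuous_at_imp_continuous_on)
next
  case (Suc k)
  show ?case
    unfolding Ck_on.simps
  proof (intro conjI ballI allI)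
    show "f differentiable at x" if "x \<in> U" for x
      using Suc.prems[OF that] by auto
    show "Ck_on k U (\<lambda>x. frechet_derivative f (at x) v)" for v
      by (rule Suc.IH) (use Suc.prems in \<open>fastforce\<close>)
  qed
qed

text \<open>\<open>Ck_on\<close> is a local property, and on the open set
  \<open>U \<inter> W\<close> the local extension coincides with \<open>f\<close>, so its
  derivatives are those of \<open>f\<close>.\<close>

lemma smooth_on_openD:
  assumes "smooth_on U f" "open U"
  shows "Ck_on k U f"
proof (rule Ck_on_local)
  fix x assume "x \<in> U"
  then obtain W g where W: "open W" "x \<in> W" "\<And>k. Ck_on k W g" "\<And>x. x \<in> U \<inter> W \<Longrightarrow> g x = f x"
    using assms(1) unfolding smooth_on_def by metis
  have "Ck_on k (U \<inter> W) f"
    using Ck_on_cong[of "U \<inter> W" g f k] W(1,4) assms(2) Ck_on_subset[OF W(3), of "U \<inter> W" k] by auto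
  then show "\<exists>W. open W \<and> x \<in> W \<and> Ck_on k W f"
    using W \<open>x \<in> U\<close> assms(2) by (intro exI[of _ "U \<inter> W"]) auto
qed

text \<open>Inductions on the order go through this rule: the derivative may be given by any
  formula, which is then treated as a new function of lower order.\<close>

lemma Ck_on_SucI:
  assumes "open U"
    and "\<And>x. x \<in> U \<Longrightarrow> (f has_derivative f' x) (at x)"
    and "\<And>v. Ck_on k U (\<lambda>x. f' x v)"
  shows "Ck_on (Suc k) U f"
proof -
  have "Ck_on k U (\<lambda>x. frechet_derivative f (at x) v)" for v
    using Ck_on_cong[OF assms(1), of "\<lambda>x. frechet_derivative f (at x) v" "\<lambda>x. f' x v" k]
      assms(3) frechet_derivative_eq[OF assms(2)] by simp
  then show ?thesis
    using assms(2) by (auto simp: differentiable_def)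
qed

lemma Ck_on_const: "open U \<Longrightarrow> Ck_on k U (\<lambda>x. c)"
proof (induction k arbitrary: c)
  case (Suc k)
  then show ?case by (intro Ck_on_SucI[where f'="\<lambda>_ _. 0"]) auto
qed simp

lemma Ck_on_bounded_linear:
  assumes "bounded_linear L" "open U" "Ck_on k U f"
  shows "Ck_on k U (\<lambda>x. L (f x))"
  using assms(3)
proof (induction k arbitrary: f)
  case 0
  then show ?case
    by (simp add: bounded_linear.continuous_on[OF assms(1)])
next
  case (Suc k)
  show ?case
  proof (rule Ck_on_SucI[OF assms(2)])
    show "((\<lambda>x. L (f x)) has_derivative (\<lambda>v. L (frechet_derivative f (at x) v))) (at x)" if "x \<in> U" for x
      using bounded_linear.has_derivative[OF assms(1) Ck_on_Suc_imp_has_derivative[OF Suc.prems that]] .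
    show "Ck_on k U (\<lambda>x. L (frechet_derivative f (at x) v))" for v
      using Suc.prems by (intro Suc.IH) auto
  qed
qed

lemma Ck_on_ident: "open U \<Longrightarrow> Ck_on k U (\<lambda>x. x)"
proof (cases k)
  case (Suc l)
  assume "open U"
  then show ?thesis unfolding Suc
    by (intro Ck_on_SucI[where f'="\<lambda>_ v. v"]) (auto intro: Ck_on_const)
qed simp

lemma Ck_on_linear: "bounded_linear L \<Longrightarrow> open U \<Longrightarrow> Ck_on k U L"
  using Ck_on_bounded_linear[OF _ _ Ck_on_ident] by blast

lemma Ck_on_add:
  assumes "open U" "Ck_on k U f" "Ck_on k U g"
  shows "Ck_on k U (\<lambda>x. f x + g x)"
  using assms(2,3)
proof (induction k arbitrary: f g)
  case 0
  then show ?case by (simp add: continuous_on_add)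
next
  case (Suc k)
  show ?case
  proof (rule Ck_on_SucI[OF assms(1)])
    show "((\<lambda>x. f x + g x) has_derivative
        (\<lambda>v. frechet_derivative f (at x) v + frechet_derivative g (at x) v)) (at x)" if "x \<in> U" for x
      using Suc.prems that by (intro has_derivative_add Ck_on_Suc_imp_has_derivative)
    show "Ck_on k U (\<lambda>x. frechet_derivative f (at x) v + frechet_derivative g (at x) v)" for v
      using Suc.prems by (intro Suc.IH) auto
  qed
qed

lemma Ck_on_sum:
  assumes "open U" "\<And>i. i \<in> I \<Longrightarrow> Ck_on k U (f i)"
  shows "Ck_on k U (\<lambda>x. \<Sum>i\<in>I. f i x)"
  using assms(2)
proof (induction I rule: infinite_finite_induct)
  case (insert i I)
  then show ?case by (simp add: Ck_on_add assms(1))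
qed (auto intro: Ck_on_const assms)

lemma Ck_on_bounded_bilinear:
  assumes B: "bounded_bilinear B" and "open U" "Ck_on k U f" "Ck_on k U g"
  shows "Ck_on k U (\<lambda>x. B (f x) (g x))"
  using assms(3,4)
proof (induction k arbitrary: f g)
  case 0
  then show ?case by (simp add: bounded_bilinear.continuous_on[OF B])
next
  case (Suc k)
  have fg: "Ck_on k U f" "Ck_on k U g"
    using Suc.prems by (auto intro: Ck_on_Suc_imp)
  show ?case
  proof (rule Ck_on_SucI[OF assms(2)])
    show "((\<lambda>x. B (f x) (g x)) has_derivative
        (\<lambda>v. B (f x) (frechet_derivative g (at x) v) + B (frechet_derivative f (at x) v) (g x))) (at x)" if "x \<in> U" for x
      by (rule bounded_bilinear.FDERIV[OF B]; rule Ck_on_Suc_imp_has_derivative[OF _ that]; rule Suc.prems)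
    show "Ck_on k U (\<lambda>x. B (f x) (frechet_derivative g (at x) v) + B (frechet_derivative f (at x) v) (g x))" for v
      using Suc.prems fg by (intro Ck_on_add Suc.IH assms(2)) auto
  qed
qed

lemmas Ck_on_scaleR = Ck_on_bounded_bilinear[OF bounded_bilinear_scaleR]
  and Ck_on_mult = Ck_on_bounded_bilinear[OF bounded_bilinear_mult]

lemma Ck_on_minus: "open U \<Longrightarrow> Ck_on k U f \<Longrightarrow> Ck_on k U (\<lambda>x. - f x)"
  using Ck_on_bounded_linear[OF bounded_linear_minus[OF bounded_linear_ident]] .

lemma Ck_on_diff: "open U \<Longrightarrow> Ck_on k U f \<Longrightarrow> Ck_on k U g \<Longrightarrow> Ck_on k U (\<lambda>x. f x - g x)"
  using Ck_on_add[OF _ _ Ck_on_minus] by auto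

lemma Ck_on_inner_const: "open U \<Longrightarrow> Ck_on k U f \<Longrightarrow> Ck_on k U (\<lambda>x. f x \<bullet> b)"
  using Ck_on_bounded_linear[OF bounded_linear_inner_left] .

lemma Ck_on_Pair:
  assumes "open U" "Ck_on k U f" "Ck_on k U g"
  shows "Ck_on k U (\<lambda>x. (f x, g x))"
proof -
  have l: "bounded_linear (\<lambda>v. (v, 0))" "bounded_linear (\<lambda>v. (0, v))"
    by (auto intro!: bounded_linear_Pair bounded_linear_ident bounded_linear_zero)
  show ?thesis
    using Ck_on_add[OF assms(1) Ck_on_bounded_linear[OF l(1) assms(1,2)] Ck_on_bounded_linear[OF l(2) assms(1,3)]]
    by simp
qed

text \<open>\<open>Ck_on\<close> controls a derivative only in each fixed direction. Expanding
  \<open>w x\<close> in the basis turns evaluation in a moving direction into finitely many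
  products.\<close>

lemma Ck_on_apply_linear:
  fixes A :: "'a::euclidean_space \<Rightarrow> 'b::euclidean_space \<Rightarrow> 'c::euclidean_space"
  assumes "open U" "\<And>b. b \<in> Basis \<Longrightarrow> Ck_on k U (\<lambda>x. A x b)" "Ck_on k U w" "\<And>x. x \<in> U \<Longrightarrow> linear (A x)"
  shows "Ck_on k U (\<lambda>x. A x (w x))"
proof -
  have "Ck_on k U (\<lambda>x. \<Sum>b\<in>Basis. (w x \<bullet> b) *\<^sub>R A x b)"
    by (intro Ck_on_sum Ck_on_scaleR Ck_on_inner_const assms)
  then show ?thesis
    using Ck_on_cong[OF assms(1), of "\<lambda>x. A x (w x)" "\<lambda>x. \<Sum>b\<in>Basis. (w x \<bullet> b) *\<^sub>R A x b"]
      linear_eq_sum_Basis[OF assms(4)] by simp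
qed

text \<open>In the induction \<open>f\<close> stays fixed and only \<open>g\<close> varies: the
  chain rule puts a derivative of \<open>g\<close> after the same \<open>f\<close>, and the inner
  derivative enters merely as the vector \<open>w\<close> of
  \<open>Ck_on_apply_linear\<close>.\<close>

lemma Ck_on_compose:
  assumes "open U" "Ck_on k U f" "Ck_on k V g" "\<And>x. x \<in> U \<Longrightarrow> f x \<in> V"
  shows "Ck_on k U (\<lambda>x. g (f x))"
  using assms(2,3)
proof (induction k arbitrary: g)
  case 0
  then show ?case
    using assms(4) continuous_on_compose2[of V g U f] by auto
next
  case (Suc k)
  show ?case
  proof (rule Ck_on_SucI[OF assms(1)])
    show "((\<lambda>x. g (f x)) has_derivative
        (\<lambda>v. frechet_derivative g (at (f x)) (frechet_derivative f (at x) v))) (at x)" if "x \<in> U" for x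
      using has_derivative_compose[of f "frechet_derivative f (at x)" x UNIV g]
        Ck_on_Suc_imp_has_derivative[OF Suc.prems(1) that]
        Ck_on_Suc_imp_has_derivative[OF Suc.prems(2) assms(4)[OF that]] by blast
    show "Ck_on k U (\<lambda>x. frechet_derivative g (at (f x)) (frechet_derivative f (at x) v))" for v
    proof (rule Ck_on_apply_linear[where A="\<lambda>x. frechet_derivative g (at (f x))", OF assms(1)])
      show "Ck_on k U (\<lambda>x. frechet_derivative g (at (f x)) b)" for b
        using Suc.IH[of "\<lambda>x. frechet_derivative g (at x) b"] Ck_on_Suc_imp[OF Suc.prems(1)] Suc.prems(2) by simp
    qed (use Suc.prems assms(4) in \<open>auto intro: linear_frechet_derivative\<close>)
  qed
qed

lemma Ck_on_fst: "open U \<Longrightarrow> Ck_on k U f \<Longrightarrow> Ck_on k U (\<lambda>x. fst (f x))"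
  using Ck_on_bounded_linear[OF bounded_linear_fst] .

lemma Ck_on_snd: "open U \<Longrightarrow> Ck_on k U f \<Longrightarrow> Ck_on k U (\<lambda>x. snd (f x))"
  using Ck_on_bounded_linear[OF bounded_linear_snd] .

lemma Ck_on_vec_lambda:
  fixes f :: "'a::euclidean_space \<Rightarrow> 'n::finite \<Rightarrow> real"
  assumes "open U" "\<And>i. Ck_on k U (\<lambda>x. f x i)"
  shows "Ck_on k U (\<lambda>x. \<chi> i. f x i)"
proof -
  have "(\<chi> i. f x i) = (\<Sum>i\<in>UNIV. f x i *\<^sub>R axis i 1)" for x
    by (simp add: vec_eq_iff axis_def if_distrib cong: if_cong)
  then show ?thesis
    by (simp only:) (intro Ck_on_sum Ck_on_scaleR assms Ck_on_const)
qed

section \<open>Estimates on derivatives and symmetry of second derivatives\<close>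

lemma norm_linear_le_sum_Basis:
  fixes f :: "'a::euclidean_space \<Rightarrow> 'b::real_normed_vector"
  assumes "linear f"
  shows "norm (f v) \<le> (\<Sum>b\<in>Basis. norm (f b)) * norm v"
proof -
  have "norm (f v) \<le> (\<Sum>b\<in>Basis. norm ((v \<bullet> b) *\<^sub>R f b))"
    by (subst linear_eq_sum_Basis[OF assms]) (rule norm_sum)
  also have "\<dots> \<le> (\<Sum>b\<in>Basis. norm (f b) * norm v)"
    by (intro sum_mono) (simp add: mult.commute[of "\<bar>_\<bar>"] mult_left_mono Basis_le_norm)
  finally show ?thesis by (simp add: sum_distrib_right)
qed

text \<open>Continuity in each direction becomes continuity in operator norm, because a linear map
  is bounded by the sum of its norms on the finitely many basis vectors; hence the share
  \<open>e / DIM('a)\<close> for each.\<close>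

lemma Ck_on_1_derivative_near:
  assumes U: "open U" "Ck_on (Suc 0) U f" "x0 \<in> U" "e > 0"
  shows "\<exists>d>0. \<forall>x\<in>ball x0 d. x \<in> U \<and>
    (\<forall>v. norm (frechet_derivative f (at x) v - frechet_derivative f (at x0) v) \<le> e * norm v)"
proof -
  let ?D = "\<lambda>x. frechet_derivative f (at x)"
  have "\<forall>\<^sub>F x in nhds x0. \<forall>b\<in>Basis. norm (?D x b - ?D x0 b) < e / DIM('a)"
  proof (intro eventually_ball_finite ballI)
    fix b :: 'a
    have "continuous_on U (\<lambda>x. ?D x b)" using U(2) by simp
    then have "isCont (\<lambda>x. ?D x b) x0"
      using U by (simp add: continuous_on_eq_continuous_at)
    then have "((\<lambda>x. ?D x b) \<longlongrightarrow> ?D x0 b) (nhds x0)"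
      unfolding isCont_def by (rule tendsto_at_iff_tendsto_nhds[THEN iffD1])
    from tendstoD[OF this, of "e / DIM('a)"] show "\<forall>\<^sub>F x in nhds x0. norm (?D x b - ?D x0 b) < e / DIM('a)"
      using U by (simp add: dist_norm)
  qed simp
  moreover have "\<forall>\<^sub>F x in nhds x0. x \<in> U"
    using U by (simp add: eventually_nhds_in_open)
  ultimately have "\<forall>\<^sub>F x in nhds x0. x \<in> U \<and> (\<forall>b\<in>Basis. norm (?D x b - ?D x0 b) < e / DIM('a))"
    by eventually_elim auto
  then obtain d where d: "d > 0" "\<And>x. dist x x0 < d \<Longrightarrow> x \<in> U \<and> (\<forall>b\<in>Basis. norm (?D x b - ?D x0 b) < e / DIM('a))"
    unfolding eventually_nhds_metric by blast
  have "norm (?D x v - ?D x0 v) \<le> e * norm v" if x: "x \<in> ball x0 d" for x v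
  proof -
    have x': "x \<in> U" "\<forall>b\<in>Basis. norm (?D x b - ?D x0 b) < e / DIM('a)"
      using d(2)[of x] x by (auto simp: dist_commute)
    have "linear (\<lambda>v. ?D x v - ?D x0 v)"
      using U x' by (intro linear_compose_sub linear_frechet_derivative) auto
    from norm_linear_le_sum_Basis[OF this, of v]
    have "norm (?D x v - ?D x0 v) \<le> (\<Sum>b\<in>(Basis::'a set). norm (?D x b - ?D x0 b)) * norm v" .
    also have "\<dots> \<le> (\<Sum>b\<in>(Basis::'a set). e / DIM('a)) * norm v"
      using x' by (intro mult_right_mono sum_mono) (auto simp: less_imp_le)
    also have "\<dots> = e * norm v" by simp
    finally show ?thesis .
  qed
  with d show ?thesis
    by (intro exI[of _ d]) (auto simp: dist_commute)
qed

text \<open>Needed for the mixed derivative of \<open>x\<close> in \<open>s\<close> and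
  \<open>y\<close> in the fold argument, and for the mixed derivative of the phase in the eikonal
  equation.\<close>

lemma Ck_on_2_second_derivative_symmetric:
  fixes f :: "'a::euclidean_space \<Rightarrow> real"
  assumes U: "open U" "Ck_on (Suc (Suc 0)) U f" "x0 \<in> U"
  shows "frechet_derivative (\<lambda>x. frechet_derivative f (at x) v) (at x0) w =
         frechet_derivative (\<lambda>x. frechet_derivative f (at x) w) (at x0) v"
proof (rule ccontr)
  define D where "D v x = frechet_derivative f (at x) v" for v x
  define DD where "DD v w x = frechet_derivative (D v) (at x) w" for v w x
  assume "\<not> ?thesis"
  then have ne: "DD v w x0 \<noteq> DD w v x0" by (simp add: D_def[abs_def] DD_def)
  \<comment> \<open>Half of the gap: if both values move by less than this near \<open>x0\<close>,
    they cannot become equal.\<close>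
  define e where "e = \<bar>DD v w x0 - DD w v x0\<bar> / 2"
  have e: "e > 0" using ne by (simp add: e_def)
  have C: "continuous_on U (DD v w)" for v w
    using U by (simp add: D_def[abs_def] DD_def[abs_def])
  have near: "\<exists>d>0. \<forall>x\<in>ball x0 d. x \<in> U \<and> \<bar>DD v w x - DD v w x0\<bar> < e" for v w
  proof -
    have "isCont (DD v w) x0" using C U by (simp add: continuous_on_eq_continuous_at)
    then have "((DD v w) \<longlongrightarrow> DD v w x0) (nhds x0)"
      by (simp add: tendsto_at_iff_tendsto_nhds isCont_def)
    from tendstoD[OF this e] have "\<forall>\<^sub>F x in nhds x0. \<bar>DD v w x - DD v w x0\<bar> < e"
      by (simp add: dist_real_def)
    moreover have "\<forall>\<^sub>F x in nhds x0. x \<in> U" using U by (simp add: eventually_nhds_in_open)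
    ultimately have "\<forall>\<^sub>F x in nhds x0. x \<in> U \<and> \<bar>DD v w x - DD v w x0\<bar> < e"
      by eventually_elim auto
    then show ?thesis unfolding eventually_nhds_metric by (auto simp: dist_commute)
  qed
  obtain d1 where d1: "d1 > 0" "\<And>x. x\<in>ball x0 d1 \<Longrightarrow> x \<in> U \<and> \<bar>DD v w x - DD v w x0\<bar> < e"
    using near by blast
  obtain d2 where d2: "d2 > 0" "\<And>x. x\<in>ball x0 d2 \<Longrightarrow> x \<in> U \<and> \<bar>DD w v x - DD w v x0\<bar> < e"
    using near by blast
  define d where "d = min d1 d2"
  \<comment> \<open>Small enough that the parallelogram spanned by \<open>h *\<^sub>R v\<close> and
    \<open>h *\<^sub>R w\<close> stays in the ball; the summand 1 covers the case
    \<open>v = w = 0\<close>.\<close>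
  define h where "h = d / (2 * (1 + norm v + norm w))"
  have pos: "0 < 2 * (1 + norm v + norm w)"
    by (simp add: add_pos_nonneg)
  have h: "h > 0" using d1 d2 pos by (simp add: h_def d_def)
  have inb: "x0 + s *\<^sub>R v + t *\<^sub>R w \<in> ball x0 d" if "0 \<le> s" "s \<le> h" "0 \<le> t" "t \<le> h" for s t
  proof -
    have "norm (s *\<^sub>R v + t *\<^sub>R w) \<le> s * norm v + t * norm w"
      using norm_triangle_ineq[of "s *\<^sub>R v" "t *\<^sub>R w"] that by simp
    also have "\<dots> \<le> h * norm v + h * norm w"
      using that by (intro add_mono mult_right_mono) auto
    also have "\<dots> < h * (2 * (1 + norm v + norm w))"
      using h by (simp add: algebra_simps add_nonneg_pos)
    also have "\<dots> = d" using pos by (simp add: h_def)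
    finally have "norm (s *\<^sub>R v + t *\<^sub>R w) < d" .
    moreover have "x0 - (x0 + s *\<^sub>R v + t *\<^sub>R w) = - (s *\<^sub>R v + t *\<^sub>R w)" by simp
    ultimately show ?thesis by (simp only: mem_ball dist_norm norm_minus_cancel)
  qed
  text \<open>Both mixed derivatives are limits of the same second difference.\<close>
  have key: "\<exists>x\<in>ball x0 d. f (x0 + h *\<^sub>R v + h *\<^sub>R w) - f (x0 + h *\<^sub>R v) - f (x0 + h *\<^sub>R w) + f x0 = h * h * DD v w x"
    if inb: "\<And>s t. 0 \<le> s \<Longrightarrow> s \<le> h \<Longrightarrow> 0 \<le> t \<Longrightarrow> t \<le> h \<Longrightarrow> x0 + s *\<^sub>R v + t *\<^sub>R w \<in> ball x0 d" for v w
  proof -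
    have U': "x0 + s *\<^sub>R v + t *\<^sub>R w \<in> U" if "0 \<le> s" "s \<le> h" "0 \<le> t" "t \<le> h" for s t
      using inb[OF that] d1 by (auto simp: d_def)
    have fder: "(f has_derivative (\<lambda>v. D v x)) (at x)" if "x \<in> U" for x
      unfolding D_def using U that by (simp add: frechet_derivative_works)
    have Dder: "(D v has_derivative (\<lambda>w. DD v w x)) (at x)" if "x \<in> U" for x v
      unfolding DD_def using U that by (simp add: frechet_derivative_works D_def[abs_def])
    have lin: "D (c *\<^sub>R v) x = c * D v x" if "x \<in> U" for c v x
      using linear_cmul[OF has_derivative_linear[OF fder[OF that]]] by simp
    have linD: "DD v (c *\<^sub>R w) x = c * DD v w x" if "x \<in> U" for c v w x
      using linear_cmul[OF has_derivative_linear[OF Dder[OF that]]] by simp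
    \<comment> \<open>Mean value theorem first in the direction \<open>v\<close>, for the increment
      along \<open>h *\<^sub>R w\<close>; a second application in the direction \<open>w\<close>
      then produces \<open>DD v w\<close>.\<close>
    have "\<exists>s\<in>{0<..<h}. (f (x0 + h *\<^sub>R v + h *\<^sub>R w) - f (x0 + h *\<^sub>R v)) - (f (x0 + 0 *\<^sub>R v + h *\<^sub>R w) - f (x0 + 0 *\<^sub>R v))
       = (\<lambda>c. c * (D v (x0 + s *\<^sub>R v + h *\<^sub>R w) - D v (x0 + s *\<^sub>R v))) (h - 0)"
    proof (rule mvt_simple[OF h])
      fix s assume s: "0 \<le> s" "s \<le> h"
      have m1: "x0 + s *\<^sub>R v + h *\<^sub>R w \<in> U" using U'[of s h] s h by simp
      have m2: "x0 + s *\<^sub>R v \<in> U" using U'[of s 0] s h by simp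
      show "((\<lambda>s. f (x0 + s *\<^sub>R v + h *\<^sub>R w) - f (x0 + s *\<^sub>R v)) has_derivative
        (\<lambda>c. c * (D v (x0 + s *\<^sub>R v + h *\<^sub>R w) - D v (x0 + s *\<^sub>R v)))) (at s within {0..h})"
        by (rule derivative_eq_intros has_derivative_compose[where g="f" and x=s and f="\<lambda>s. x0 + s *\<^sub>R v + h *\<^sub>R w", OF _ fder[OF m1]] has_derivative_compose[where g="f" and x=s and f="\<lambda>s. x0 + s *\<^sub>R v", OF _ fder[OF m2]] refl)+
          (auto simp: lin m1 m2 right_diff_distrib)
    qed
    then obtain s where s: "0 < s" "s < h" and fs: "f (x0 + h *\<^sub>R v + h *\<^sub>R w) - f (x0 + h *\<^sub>R v) - f (x0 + h *\<^sub>R w) + f x0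
       = h * (D v (x0 + s *\<^sub>R v + h *\<^sub>R w) - D v (x0 + s *\<^sub>R v))"
      by auto
    have "\<exists>t\<in>{0<..<h}. D v (x0 + s *\<^sub>R v + h *\<^sub>R w) - D v (x0 + s *\<^sub>R v + 0 *\<^sub>R w) = (\<lambda>c. c * DD v w (x0 + s *\<^sub>R v + t *\<^sub>R w)) (h - 0)"
    proof (rule mvt_simple[OF h])
      fix t assume t: "0 \<le> t" "t \<le> h"
      have m: "x0 + s *\<^sub>R v + t *\<^sub>R w \<in> U" using U'[of s t] s t by simp
      show "((\<lambda>t. D v (x0 + s *\<^sub>R v + t *\<^sub>R w)) has_derivative (\<lambda>c. c * DD v w (x0 + s *\<^sub>R v + t *\<^sub>R w))) (at t within {0..h})"
        by (rule has_derivative_eq_rhs, rule has_derivative_compose[where g="D v" and x=t and f="\<lambda>t. x0 + s *\<^sub>R v + t *\<^sub>R w", OF _ Dder[OF m]],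
            (rule derivative_eq_intros refl)+)
          (auto simp: linD m)
    qed
    then obtain t where t: "0 < t" "t < h" and "D v (x0 + s *\<^sub>R v + h *\<^sub>R w) - D v (x0 + s *\<^sub>R v) = h * DD v w (x0 + s *\<^sub>R v + t *\<^sub>R w)"
      by auto
    then show ?thesis using inb[of s t] s fs by (intro bexI[of _ "x0 + s *\<^sub>R v + t *\<^sub>R w"]) auto
  qed
  obtain x where x: "x \<in> ball x0 d" "f (x0 + h *\<^sub>R v + h *\<^sub>R w) - f (x0 + h *\<^sub>R v) - f (x0 + h *\<^sub>R w) + f x0 = h * h * DD v w x"
    using key[OF inb] by blast
  have "x0 + s *\<^sub>R w + t *\<^sub>R v \<in> ball x0 d" if "0 \<le> s" "s \<le> h" "0 \<le> t" "t \<le> h" for s t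
    using inb[of t s] that by (simp add: algebra_simps)
  from key[OF this]
  obtain y where y: "y \<in> ball x0 d" "f (x0 + h *\<^sub>R w + h *\<^sub>R v) - f (x0 + h *\<^sub>R w) - f (x0 + h *\<^sub>R v) + f x0 = h * h * DD w v y"
    by blast
  have "h * h * DD v w x = h * h * DD w v y"
    using x y by (simp add: algebra_simps)
  then have "DD v w x = DD w v y" using h by simp
  moreover have "\<bar>DD v w x - DD v w x0\<bar> < e" "\<bar>DD w v y - DD w v x0\<bar> < e"
    using d1(2)[of x] d2(2)[of y] x y by (auto simp: d_def)
  ultimately show False unfolding e_def by argo
qed

section \<open>Ordinary differential equations with parameters\<close>

text \<open>A short-time substitute for Gronwall's inequality. At a maximum point \<open>m\<close>
  of \<open>norm (f t)\<close> the mean value inequality gives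
  \<open>norm (f m) \<le> norm (f 0) + (K * norm (f m) + e) * T\<close>, and
  \<open>K * T \<le> 1 / 2\<close> lets half of \<open>norm (f m)\<close> be absorbed. A general
  \<open>S\<close> covers symmetric and one-sided time intervals alike.\<close>

lemma small_time_bound:
  fixes f :: "real \<Rightarrow> 'u::real_normed_vector"
  assumes S: "convex S" "compact S" "0 \<in> S" "\<And>t. t \<in> S \<Longrightarrow> \<bar>t\<bar> \<le> T"
    and der: "\<And>t. t \<in> S \<Longrightarrow> (f has_vector_derivative f' t) (at t within S)"
    and le: "\<And>t. t \<in> S \<Longrightarrow> norm (f' t) \<le> K * norm (f t) + e"
    and K: "0 \<le> K" "K * T \<le> 1 / 2" "0 \<le> e"
    and t: "t \<in> S"
  shows "norm (f t) \<le> 2 * norm (f 0) + 2 * T * e"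
proof -
  have "continuous_on S f"
    using der by (auto simp: continuous_on_eq_continuous_within intro: has_vector_derivative_continuous)
  then have "continuous_on S (\<lambda>t. norm (f t))" by (intro continuous_on_norm)
  then obtain m where m: "m \<in> S" "\<And>t. t \<in> S \<Longrightarrow> norm (f t) \<le> norm (f m)"
    using continuous_attains_sup[OF S(2)] S(3) by blast
  have "norm (f m - f 0) \<le> (K * norm (f m) + e) * norm (m - 0)"
  proof (rule differentiable_bound[OF S(1)])
    show "(f has_derivative (\<lambda>h. h *\<^sub>R f' s)) (at s within S)" if "s \<in> S" for s
      using der[OF that] by (simp add: has_vector_derivative_def)
    show "onorm (\<lambda>h. h *\<^sub>R f' s) \<le> K * norm (f m) + e" if "s \<in> S" for s
    proof -
      have "norm (f' s) \<le> K * norm (f m) + e"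
        using le[OF that] mult_left_mono[OF m(2)[OF that] K(1)] by linarith
      then show ?thesis
        by (intro onorm_le) (simp add: mult.commute[of _ "\<bar>_\<bar>"] mult_left_mono)
    qed
  qed (use m S in auto)
  also have "\<dots> \<le> (K * norm (f m) + e) * T"
    using S(4)[OF m(1)] K by (intro mult_left_mono) auto
  also have "\<dots> \<le> norm (f m) / 2 + T * e"
    using mult_right_mono[OF K(2), of "norm (f m)"] by (simp add: algebra_simps)
  finally have "norm (f m) \<le> norm (f 0) + (norm (f m) / 2 + T * e)"
    using norm_triangle_ineq2[of "f m" "f 0"] by linarith
  then show ?thesis using m(2)[OF t] by linarith
qed

text \<open>The integral operator contracts sup distances by the factor
  \<open>K * T \<le> 1 / 2\<close>, so Banach's fixed point theorem gives the solution on the whole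
  interval at once.\<close>

lemma picard_existence:
  fixes f :: "real \<Rightarrow> 'u::euclidean_space \<Rightarrow> 'u"
  assumes T: "0 \<le> T"
    and cont: "continuous_on ({-T..T} \<times> UNIV) (\<lambda>(t, u). f t u)"
    and lip: "\<And>t u v. t \<in> {-T..T} \<Longrightarrow> norm (f t u - f t v) \<le> K * norm (u - v)"
    and K: "0 \<le> K" "K * T \<le> 1 / 2"
  shows "\<exists>u. u 0 = c \<and> (\<forall>t\<in>{-T..T}. (u has_vector_derivative f t (u t)) (at t within {-T..T}))"
proof -
  let ?S = "{-T..T}"
  have "\<exists>G. G 0 = c \<and> (\<forall>t\<in>?S. (G has_vector_derivative f t (apply_bcontfun u t)) (at t within ?S))" for u :: "real \<Rightarrow>\<^sub>C 'u"
  proof -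
    have cu: "continuous_on ?S (\<lambda>t. f t (apply_bcontfun u t))"
    proof -
      have "continuous_on ?S (\<lambda>t. (t, apply_bcontfun u t))"
        by (intro continuous_intros) simp
      from continuous_on_compose2[OF cont this] show ?thesis by auto
    qed
    \<comment> \<open>Starting at \<open>-T\<close> keeps the interval of integration nonempty for
      negative \<open>t\<close>; the constant \<open>c - I 0\<close> then restores the value at
      0.\<close>
    define I where "I = (\<lambda>t. integral {-T..t} (\<lambda>t. f t (apply_bcontfun u t)))"
    have "((\<lambda>t. I t + (c - I 0)) has_vector_derivative f t (apply_bcontfun u t)) (at t within ?S)" if "t \<in> ?S" for t
      using integral_has_vector_derivative[OF cu that] unfolding I_def
      by (auto intro!: derivative_eq_intros)
    then show ?thesis by (intro exI[of _ "\<lambda>t. I t + (c - I 0)"]) auto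
  qed
  then obtain G where G: "\<And>u. G u 0 = c"
      "\<And>u t. t \<in> ?S \<Longrightarrow> (G u has_vector_derivative f t (apply_bcontfun u t)) (at t within ?S)"
    by metis
  \<comment> \<open>The complete space consists of bounded continuous functions on all of
    \<open>real\<close>, so the iterate is extended by clamping; distances between iterates then
    only see times in \<open>?S\<close>.\<close>
  have "\<exists>g. (\<forall>t\<in>?S. apply_bcontfun g t = G u t) \<and> (\<forall>t. apply_bcontfun g t = G u (clamp (-T) T t))" for u
  proof -
    have "continuous_on (cbox (-T) T) (G u)"
      using has_vector_derivative_continuous[OF G(2)] by (simp add: continuous_on_eq_continuous_within)
    then show ?thesis by (metis continuous_on_cbox_bcontfunE cbox_interval)
  qed
  then obtain \<Phi> where \<Phi>: "\<And>u t. t \<in> ?S \<Longrightarrow> apply_bcontfun (\<Phi> u) t = G u t"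
      "\<And>u t. apply_bcontfun (\<Phi> u) t = G u (clamp (-T) T t)"
    by metis
  have "dist (\<Phi> u) (\<Phi> v) \<le> (1/2) * dist u v" for u v
  proof (rule dist_bound)
    fix t
    define s where "s = clamp (-T) T t"
    have s: "s \<in> ?S" using T clamp_in_interval[of "-T" T t] by (simp add: s_def)
    let ?g = "\<lambda>t. G u t - G v t"
    have "norm (?g s - ?g 0) \<le> (K * dist u v) * norm (s - 0)"
    proof (rule differentiable_bound[of ?S])
      show "(?g has_derivative (\<lambda>h. h *\<^sub>R (f r (apply_bcontfun u r) - f r (apply_bcontfun v r)))) (at r within ?S)" if "r \<in> ?S" for r
        using has_vector_derivative_diff[OF G(2)[OF that] G(2)[OF that]] by (simp add: has_vector_derivative_def)
      show "onorm (\<lambda>h. h *\<^sub>R (f r (apply_bcontfun u r) - f r (apply_bcontfun v r))) \<le> K * dist u v" if "r \<in> ?S" for r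
      proof -
        have "norm (f r (apply_bcontfun u r) - f r (apply_bcontfun v r)) \<le> K * norm (apply_bcontfun u r - apply_bcontfun v r)"
          using lip[OF that] .
        also have "\<dots> \<le> K * dist u v"
          using K(1) dist_bounded[of u r v] by (intro mult_left_mono) (simp_all add: dist_norm)
        finally show ?thesis
          by (intro onorm_le) (simp add: mult.commute[of _ "\<bar>_\<bar>"] mult_left_mono)
      qed
    qed (use T s in auto)
    also have "\<dots> \<le> (K * dist u v) * T"
      using s K by (intro mult_left_mono) auto
    also have "\<dots> \<le> (1/2) * dist u v"
      using mult_right_mono[OF K(2), of "dist u v"] by (simp add: algebra_simps)
    finally show "dist (apply_bcontfun (\<Phi> u) t) (apply_bcontfun (\<Phi> v) t) \<le> (1/2) * dist u v"
      unfolding \<Phi>(2) s_def[symmetric] by (simp add: G(1) dist_norm)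
  qed
  then obtain u where u: "\<Phi> u = u"
    using banach_fix_type[of "1/2" \<Phi>] by auto
  show ?thesis
  proof (intro exI conjI ballI)
    show "apply_bcontfun u 0 = c" using \<Phi>(1)[of 0 u] u G(1) T by simp
    show "(apply_bcontfun u has_vector_derivative f t (apply_bcontfun u t)) (at t within ?S)" if "t \<in> ?S" for t
      using G(2)[OF that, of u] \<Phi>(1)[of _ u] u that
      by (metis (no_types, lifting) has_vector_derivative_transform)
  qed
qed

section \<open>Differentiable dependence of solutions on parameters\<close>

lemma Ck_on_1_uniform_linearization:
  fixes f :: "'a::euclidean_space \<Rightarrow> 'b::euclidean_space"
  assumes W: "open W" "Ck_on (Suc 0) W f" and C: "compact C" "C \<subseteq> W" and e: "e > 0"
  shows "\<exists>d>0. \<forall>x\<in>C. \<forall>y\<in>ball x d. norm (f y - f x - frechet_derivative f (at x) (y - x)) \<le> e * norm (y - x)"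
proof -
  let ?D = "\<lambda>x. frechet_derivative f (at x)"
  have "\<forall>x\<in>C. \<exists>d>0. \<forall>y\<in>ball x d. y \<in> W \<and> (\<forall>v. norm (?D y v - ?D x v) \<le> (e/2) * norm v)"
    using Ck_on_1_derivative_near[OF W] C(2) e by (metis half_gt_zero subsetD)
  then obtain d where d: "\<And>x. x \<in> C \<Longrightarrow> d x > 0"
    "\<And>x y v. x \<in> C \<Longrightarrow> y \<in> ball x (d x) \<Longrightarrow> y \<in> W \<and> norm (?D y v - ?D x v) \<le> (e/2) * norm v"
    by metis
  \<comment> \<open>A Lebesgue number of this cover makes the radius independent of the point of
    \<open>C\<close>. Derivatives at two points are later compared through a common centre, which
    explains the halves \<open>e/2\<close>.\<close>
  have "C \<subseteq> \<Union> ((\<lambda>x. ball x (d x)) ` C)" using d(1) by auto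
  from Heine_Borel_lemma[OF C(1) this] obtain r where r: "r > 0"
    "\<And>x. x \<in> C \<Longrightarrow> \<exists>c\<in>C. ball x r \<subseteq> ball c (d c)"
    by auto
  show ?thesis
  proof (intro exI conjI ballI)
    fix x y assume x: "x \<in> C" and y: "y \<in> ball x r"
    obtain c where c: "c \<in> C" "ball x r \<subseteq> ball c (d c)" using r(2)[OF x] by auto
    have xr: "x \<in> ball x r" using r by simp
    let ?g = "\<lambda>z. f z - ?D x z"
    have linx: "linear (?D x)"
      using C x W by (intro linear_frechet_derivative) auto
    have "norm (?g y - ?g x) \<le> e * norm (y - x)"
    proof (rule differentiable_bound[of "ball x r"])
      fix z assume z: "z \<in> ball x r"
      have zW: "z \<in> W" using d(2)[OF c(1), of z] z c by auto
      show "(?g has_derivative (\<lambda>v. ?D z v - ?D x v)) (at z within ball x r)"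
        by (intro has_derivative_diff has_derivative_at_withinI[OF Ck_on_Suc_imp_has_derivative[OF W(2) zW]]
            linear_imp_has_derivative linx)
      show "onorm (\<lambda>v. ?D z v - ?D x v) \<le> e"
      proof (rule onorm_le)
        fix v
        have "norm (?D z v - ?D c v) \<le> (e/2) * norm v" "norm (?D x v - ?D c v) \<le> (e/2) * norm v"
          using d(2)[OF c(1) subsetD[OF c(2) z]] d(2)[OF c(1) subsetD[OF c(2) xr]] by blast+
        moreover have "norm (?D z v - ?D x v) \<le> norm (?D z v - ?D c v) + norm (?D x v - ?D c v)"
          using norm_triangle_ineq4[of "?D z v - ?D c v" "?D x v - ?D c v"] by simp
        ultimately show "norm (?D z v - ?D x v) \<le> e * norm v" by simp
      qed
    qed (use r y in auto)
    then show "norm (f y - f x - ?D x (y - x)) \<le> e * norm (y - x)"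
      by (simp add: linear_diff[OF linx] algebra_simps)
  qed (use r in auto)
qed

text \<open>The family \<open>u\<close> is given here, not constructed. \<open>H\<close> may depend
  on time and parameter because the variational equation does, even for an autonomous system. The
  value \<open>1 / 4\<close>, rather than the \<open>1 / 2\<close> of
  \<open>small_time_bound\<close>, leaves room for a linearization error. The bound concerns only
  the derivative in the unknown, along \<open>u\<close>: this is what passes unchanged to the
  variational equation.\<close>

locale ode_family =
  fixes H :: "real \<times> 'p::euclidean_space \<times> 'u::euclidean_space \<Rightarrow> 'u"
    and W :: "(real \<times> 'p \<times> 'u) set" and P :: "'p set" and \<tau> K :: real
    and u :: "real \<times> 'p \<Rightarrow> 'u"
  assumes W: "open W" and P: "open P"
    and K: "0 \<le> K" "K * \<tau> \<le> 1 / 4"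
    and H: "Ck_on (Suc 0) W H"
    and u_cont: "continuous_on ({-\<tau><..<\<tau>} \<times> P) u"
    and mem: "t \<in> {-\<tau><..<\<tau>} \<Longrightarrow> p \<in> P \<Longrightarrow> (t, p, u (t, p)) \<in> W"
    and ode: "t \<in> {-\<tau><..<\<tau>} \<Longrightarrow> p \<in> P \<Longrightarrow> ((\<lambda>t. u (t, p)) has_vector_derivative H (t, p, u (t, p))) (at t)"
    and init: "Ck_on (Suc 0) P (\<lambda>p. u (0, p))"
    and bound: "t \<in> {-\<tau><..<\<tau>} \<Longrightarrow> p \<in> P \<Longrightarrow>
      norm (frechet_derivative H (at (t, p, u (t, p))) (0, 0, w)) \<le> K * norm w"
begin

abbreviation "DH x \<equiv> frechet_derivative H (at (fst x, snd x, u x))"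

abbreviation "D0 p \<equiv> frechet_derivative (\<lambda>p. u (0, p)) (at p)"

lemma linear_DH: "t \<in> {-\<tau><..<\<tau>} \<Longrightarrow> p \<in> P \<Longrightarrow> linear (DH (t, p))"
  using H mem by (auto intro!: linear_frechet_derivative)

lemma linear_D0: "p \<in> P \<Longrightarrow> linear (D0 p)"
  using init by (auto intro!: linear_frechet_derivative)

lemma cont_DH: "continuous_on ({-\<tau><..<\<tau>} \<times> P) (\<lambda>x. DH x b)"
proof -
  have "continuous_on W (\<lambda>x. frechet_derivative H (at x) b)"
    using H by (simp del: split_paired_All)
  then show ?thesis
    by (rule continuous_on_compose2) (auto intro!: continuous_intros u_cont mem)
qed

lemma cont_DH_apply:
  fixes g :: "'c::topological_space \<Rightarrow> real \<times> 'p" and w :: "'c \<Rightarrow> real \<times> 'p \<times> 'u"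
  assumes "continuous_on A g" "continuous_on A w" "\<And>x. x \<in> A \<Longrightarrow> g x \<in> {-\<tau><..<\<tau>} \<times> P"
  shows "continuous_on A (\<lambda>x. DH (g x) (w x))"
proof -
  have "continuous_on A (\<lambda>x. \<Sum>b\<in>Basis. (w x \<bullet> b) *\<^sub>R DH (g x) b)"
    by (intro continuous_intros continuous_on_compose2[OF cont_DH assms(1)] assms(2)) (use assms(3) in blast)
  moreover have "DH (g x) (w x) = (\<Sum>b\<in>Basis. (w x \<bullet> b) *\<^sub>R DH (g x) b)" if "x \<in> A" for x
    using linear_eq_sum_Basis[OF linear_DH, of "fst (g x)" "snd (g x)" "w x"] assms(3)[OF that]
    by (simp add: mem_Times_iff)
  ultimately show ?thesis by (simp cong: continuous_on_cong)
qed

text \<open>The candidate derivative solves the linear variational equation. The remainder of the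
  first-order expansion then satisfies a linear differential inequality with a source that is small
  compared with \<open>norm h\<close>, and it starts small because the initial data are
  differentiable.\<close>

lemma parameter_derivative:
  assumes p: "p \<in> P" and t1: "0 < t1" "t1 < \<tau>"
  obtains w where
    "\<And>t. t \<in> {-t1..t1} \<Longrightarrow> ((\<lambda>p. u (t, p)) has_derivative w t) (at p)"
    "\<And>t v. t \<in> {-t1..t1} \<Longrightarrow>
       ((\<lambda>t. w t v) has_vector_derivative DH (t, p) (0, v, w t v)) (at t within {-t1..t1})"
proof -
  let ?S = "{-t1..t1}"
  have S: "t \<in> {-\<tau><..<\<tau>}" if "t \<in> ?S" for t using that t1 by auto
  have Kt1: "K * t1 \<le> 1 / 4"
    using mult_left_mono[of t1 \<tau> K] K t1 by linarith
  have ex: "\<exists>w. w 0 = D0 p v \<and>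
    (\<forall>t\<in>?S. (w has_vector_derivative DH (t, p) (0, v, w t)) (at t within ?S))" for v
  proof -
    have c1: "continuous_on (?S \<times> UNIV) (\<lambda>(t, w). DH (t, p) (0, v, w))"
      unfolding case_prod_beta
      by (intro cont_DH_apply continuous_intros) (use S p in auto)
    have c2: "\<And>t w w'. t \<in> ?S \<Longrightarrow> norm (DH (t, p) (0, v, w) - DH (t, p) (0, v, w')) \<le> K * norm (w - w')"
    proof -
      fix t and w w' :: 'u
      assume t: "t \<in> ?S"
      have "DH (t, p) (0, v, w) - DH (t, p) (0, v, w') = DH (t, p) (0, 0, w - w')"
        using linear_diff[OF linear_DH[OF S[OF t] p], of "(0,v,w)" "(0,v,w')"] by simp
      then show "norm (DH (t, p) (0, v, w) - DH (t, p) (0, v, w')) \<le> K * norm (w - w')"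
        using bound[OF S[OF t] p, of "w - w'"] by simp
    qed
    have t10: "0 \<le> t1" and Kt1': "K * t1 \<le> 1 / 2" using t1 Kt1 by auto
    show ?thesis
      by (rule picard_existence[of t1 "\<lambda>t w. DH (t, p) (0, v, w)" K "D0 p v", OF t10 c1 c2 K(1) Kt1'])
  qed
  then obtain w0 where w0: "\<And>v. w0 v 0 = D0 p v"
    "\<And>v t. t \<in> ?S \<Longrightarrow> (w0 v has_vector_derivative DH (t, p) (0, v, w0 v t)) (at t within ?S)"
    by metis
  \<comment> \<open>The solutions \<open>w0 v\<close> were chosen for each \<open>v\<close>
    separately, so their linearity in \<open>v\<close> is not known; keeping the basis directions
    and extending linearly makes it evident.\<close>
  define w where "w t v = (\<Sum>b\<in>Basis. (v \<bullet> b) *\<^sub>R w0 b t)" for t v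
  have lin: "linear (w t)" for t
    unfolding w_def
    by (intro linearI) (simp_all add: inner_add_left scaleR_add_left sum.distrib scaleR_sum_right)
  have w_0: "w 0 v = D0 p v" for v
    unfolding w_def w0 by (rule linear_eq_sum_Basis[OF linear_D0[OF p], symmetric])
  have w_der: "((\<lambda>t. w t v) has_vector_derivative DH (t, p) (0, v, w t v)) (at t within ?S)" if t: "t \<in> ?S" for t v
  proof -
    have "((\<lambda>t. w t v) has_vector_derivative (\<Sum>b\<in>Basis. (v \<bullet> b) *\<^sub>R DH (t, p) (0, b, w0 b t))) (at t within ?S)"
      unfolding w_def by (intro has_vector_derivative_sum bounded_linear.has_vector_derivative[OF bounded_linear_scaleR_right] w0 t)
    also have "(\<Sum>b\<in>Basis. (v \<bullet> b) *\<^sub>R DH (t, p) (0, b, w0 b t)) = DH (t, p) (\<Sum>b\<in>Basis. (v \<bullet> b) *\<^sub>R (0, b, w0 b t))"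
      using linear_DH[OF S[OF t] p] by (simp add: linear_sum linear_cmul del: scaleR_Pair)
    also have "(\<Sum>b\<in>Basis. (v \<bullet> b) *\<^sub>R (0::real, b, w0 b t)) = (0, v, w t v)"
      by (simp add: prod_eq_iff fst_sum snd_sum w_def euclidean_representation)
    finally show ?thesis .
  qed
  have "\<exists>C\<ge>0. \<forall>t\<in>?S. norm (w0 b t) \<le> C" for b
  proof -
    have "continuous_on ?S (w0 b)"
      using has_vector_derivative_continuous[OF w0(2)] by (simp add: continuous_on_eq_continuous_within)
    then have "bounded (w0 b ` ?S)" by (intro compact_imp_bounded compact_continuous_image) auto
    then obtain C where "C > 0" "\<forall>x\<in>w0 b ` ?S. norm x \<le> C" unfolding bounded_pos by blast
    then show ?thesis by (intro exI[of _ C]) auto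
  qed
  then obtain Cb where Cb: "\<And>b. Cb b \<ge> 0" "\<And>b t. t \<in> ?S \<Longrightarrow> norm (w0 b t) \<le> Cb b" by metis
  define C where "C = (\<Sum>b\<in>(Basis::'p set). Cb b)"
  have C0: "0 \<le> C" unfolding C_def by (intro sum_nonneg Cb)
  have wC: "norm (w t v) \<le> C * norm v" if "t \<in> ?S" for t v
  proof -
    have "norm (w t v) \<le> (\<Sum>b\<in>Basis. norm (w t b)) * norm v" by (rule norm_linear_le_sum_Basis[OF lin])
    also have "\<dots> \<le> C * norm v"
      unfolding C_def
    proof (intro mult_right_mono sum_mono)
      fix b :: 'p assume b: "b \<in> Basis"
      have "w t b = (\<Sum>c\<in>Basis. if c = b then w0 b t else 0)"
        unfolding w_def using b by (intro sum.cong) (auto simp: inner_Basis)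
      then have "w t b = w0 b t" using b by simp
      then show "norm (w t b) \<le> Cb b" using Cb(2)[OF that] by simp
    qed simp
    finally show ?thesis .
  qed
  have main: "\<exists>d>0. \<forall>h. norm h < d \<longrightarrow> (\<forall>t\<in>?S. norm (u (t, p + h) - u (t, p) - w t h) \<le> e * norm h)" if e: "e > 0" for e
  proof -
    \<comment> \<open>The first bound gives \<open>(K + e') * t1 \<le> 1 / 2\<close> for
      \<open>small_time_bound\<close>; the second brings the resulting factor
      \<open>e' * (2 + 2 * t1 * (1 + C))\<close> below \<open>e\<close>.\<close>
    define e' where "e' = min (1 / (4 * t1)) (e / (2 + 2 * t1 * (1 + C)))"
    have den: "0 < 2 + 2 * t1 * (1 + C)" using C0 t1 by (simp add: add_pos_nonneg)
    have e': "e' > 0" using t1 e den by (simp add: e'_def)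
    have e'1: "e' * t1 \<le> 1 / 4"
      using mult_right_mono[of e' "1 / (4 * t1)" t1] t1 by (simp add: e'_def)
    have e'2: "e' * (2 + 2 * t1 * (1 + C)) \<le> e"
      using mult_right_mono[of e' "e / (2 + 2 * t1 * (1 + C))" "2 + 2 * t1 * (1 + C)"] den by (simp add: e'_def)
    have cu: "continuous_on ?S (\<lambda>t. (t, p, u (t, p)))"
      by (intro continuous_intros continuous_on_compose2[OF u_cont]) (use S p in auto)
    have cW: "(\<lambda>t. (t, p, u (t, p))) ` ?S \<subseteq> W" using mem[OF S p] by blast
    obtain d1 where d1: "d1 > 0" and d1': "\<forall>x\<in>(\<lambda>t. (t, p, u (t, p))) ` ?S. \<forall>y\<in>ball x d1.
        norm (H y - H x - frechet_derivative H (at x) (y - x)) \<le> e' * norm (y - x)"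
      using Ck_on_1_uniform_linearization[OF W H compact_continuous_image[OF cu compact_Icc] cW e'] by blast
    have d1'': "norm (H y - H (t, p, u (t, p)) - DH (t, p) (y - (t, p, u (t, p)))) \<le> e' * norm (y - (t, p, u (t, p)))"
      if "t \<in> ?S" "y \<in> ball (t, p, u (t, p)) d1" for t y
      using d1' that by simp
    obtain \<rho> where \<rho>: "\<rho> > 0" "cball p \<rho> \<subseteq> P" using P p open_contains_cball by blast
    \<comment> \<open>This keeps the perturbed solution within the radius \<open>d1\<close> of
      linearization at all times in \<open>?S\<close> at once: \<open>d1 / 2\<close> is allotted to
      the parameter and \<open>d1 / 2\<close> to the solution increment.\<close>
    have "uniformly_continuous_on (?S \<times> cball p \<rho>) u"
      by (intro compact_uniformly_continuous continuous_on_subset[OF u_cont] compact_Times) (use S \<rho> in auto)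
    then obtain d2 where d2: "d2 > 0" "\<And>x y. x \<in> ?S \<times> cball p \<rho> \<Longrightarrow> y \<in> ?S \<times> cball p \<rho> \<Longrightarrow> dist y x < d2 \<Longrightarrow> dist (u y) (u x) < d1 / 2"
      unfolding uniformly_continuous_on_def using d1 by (metis half_gt_zero)
    have "((\<lambda>p. u (0, p)) has_derivative D0 p) (at p)"
      by (rule Ck_on_Suc_imp_has_derivative[OF init p])
    then obtain d3 where d3: "d3 > 0" "\<And>y. norm (y - p) < d3 \<Longrightarrow> norm (u (0, y) - u (0, p) - D0 p (y - p)) \<le> e' * norm (y - p)"
      unfolding has_derivative_at_alt using e' by blast
    show ?thesis
    proof (intro exI[of _ "Min {d1 / 2, d2, d3, \<rho>}"] conjI allI impI ballI)
      show "0 < Min {d1 / 2, d2, d3, \<rho>}" using d1 d2 d3 \<rho> by simp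
      fix h :: 'p and t assume h': "norm h < Min {d1 / 2, d2, d3, \<rho>}" and t: "t \<in> ?S"
      then have h: "norm h < d1 / 2" "norm h < d2" "norm h < d3" "norm h < \<rho>" by auto
      have ph: "p + h \<in> P" using \<rho> h by (auto simp: dist_norm)
      define r where "r t = u (t, p + h) - u (t, p) - w t h" for t
      define r' where "r' t = H (t, p + h, u (t, p + h)) - H (t, p, u (t, p)) - DH (t, p) (0, h, w t h)" for t
      have "norm (r t) \<le> 2 * norm (r 0) + 2 * t1 * (e' * (1 + C) * norm h)"
      proof (rule small_time_bound[where S = ?S and f' = r'])
        fix s assume s: "s \<in> ?S"
        show "(r has_vector_derivative r' s) (at s within ?S)"
          unfolding r_def r'_def
          by (intro has_vector_derivative_diff w_der s has_vector_derivative_at_within[OF ode] S p ph)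
        have du: "norm (u (s, p + h) - u (s, p)) < d1 / 2"
          using d2(2)[of "(s, p)" "(s, p + h)"] s h \<rho> by (simp add: dist_norm norm_Pair)
        let ?du = "u (s, p + h) - u (s, p)"
        have n: "norm (0::real, h, ?du) \<le> norm h + norm ?du"
          using sqrt_sum_squares_le_sum_abs[of "norm h" "norm ?du"] by (simp add: norm_Pair)
        then have "(s, p + h, u (s, p + h)) \<in> ball (s, p, u (s, p)) d1"
          using du h by (simp add: dist_norm norm_minus_commute[of "(_,_)"]) (simp add: norm_Pair norm_minus_commute)
        from d1''[OF s this]
        have "norm (H (s, p + h, u (s, p + h)) - H (s, p, u (s, p)) - DH (s, p) (0, h, ?du)) \<le> e' * norm (0::real, h, ?du)"
          by simp
        also have "\<dots> \<le> e' * (norm h + norm ?du)" using n e' by simp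
        also have "\<dots> \<le> e' * (norm h + (norm (r s) + C * norm h))"
        proof -
          have "norm ?du \<le> norm (r s) + norm (w s h)"
            unfolding r_def using norm_triangle_ineq[of "?du - w s h" "w s h"] by simp
          then show ?thesis using wC[OF s, of h] e' by (intro mult_left_mono add_left_mono) auto
        qed
        finally have 1: "norm (H (s, p + h, u (s, p + h)) - H (s, p, u (s, p)) - DH (s, p) (0, h, ?du))
            \<le> e' * (norm h + (norm (r s) + C * norm h))" .
        \<comment> \<open>Replacing the true increment by \<open>w s h\<close> costs a term linear
          in \<open>r s\<close>, which the bound \<open>K\<close> controls.\<close>
        have 2: "DH (s, p) (0, h, ?du) - DH (s, p) (0, h, w s h) = DH (s, p) (0, 0, r s)"
          using linear_diff[OF linear_DH[OF S[OF s] p], of "(0, h, ?du)" "(0, h, w s h)"] by (simp add: r_def)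
        have "r' s = (H (s, p + h, u (s, p + h)) - H (s, p, u (s, p)) - DH (s, p) (0, h, ?du)) + DH (s, p) (0, 0, r s)"
          unfolding r'_def 2[symmetric] by simp
        then have "norm (r' s) \<le> e' * (norm h + (norm (r s) + C * norm h)) + K * norm (r s)"
          using 1 bound[OF S[OF s] p, of "r s"] norm_triangle_mono by fastforce
        then show "norm (r' s) \<le> (K + e') * norm (r s) + e' * (1 + C) * norm h"
          by (simp add: algebra_simps)
      qed (use t1 K Kt1 e' e'1 C0 t in \<open>auto simp: algebra_simps\<close>)
      also have "norm (r 0) \<le> e' * norm h"
        using d3(2)[of "p + h"] h by (simp add: r_def w_0)
      finally have "norm (r t) \<le> e' * (2 + 2 * t1 * (1 + C)) * norm h"
        by (simp add: algebra_simps)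
      also have "\<dots> \<le> e * norm h" by (intro mult_right_mono e'2) simp
      finally show "norm (u (t, p + h) - u (t, p) - w t h) \<le> e * norm h" by (simp add: r_def)
    qed
  qed
  show thesis
  proof
    show "((\<lambda>p. u (t, p)) has_derivative w t) (at p)" if t: "t \<in> ?S" for t
      unfolding has_derivative_at_alt
    proof (intro conjI allI impI)
      show "bounded_linear (w t)" using lin linear_conv_bounded_linear by blast
      fix e :: real assume "e > 0"
      from main[OF this] obtain d where d: "d > 0"
        "\<And>h. norm h < d \<Longrightarrow> norm (u (t, p + h) - u (t, p) - w t h) \<le> e * norm h" using t by blast
      show "\<exists>d>0. \<forall>y. norm (y - p) < d \<longrightarrow> norm (u (t, y) - u (t, p) - w t (y - p)) \<le> e * norm (y - p)"
        using d(1) d(2)[of "_ - p"] by (intro exI[of _ d]) auto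
    qed
  qed (rule w_der)
qed

abbreviation "Du v x \<equiv> frechet_derivative (\<lambda>p. u (fst x, p)) (at (snd x)) v"

text \<open>\<open>parameter_derivative\<close> works on compact intervals, and its \<open>w\<close>
  depends on \<open>t1\<close>. Uniqueness of derivatives identifies every such \<open>w\<close>
  with \<open>Du\<close>, so the local statements fit together on the open interval.\<close>

lemma
  assumes t: "t \<in> {-\<tau><..<\<tau>}" and p: "p \<in> P"
  shows has_derivative_Du: "((\<lambda>p. u (t, p)) has_derivative (\<lambda>v. Du v (t, p))) (at p)"
    and Du_ode: "((\<lambda>t. Du v (t, p)) has_vector_derivative DH (t, p) (0, v, Du v (t, p))) (at t)"
proof -
  define t1 where "t1 = (\<bar>t\<bar> + \<tau>) / 2"
  have t1: "0 < t1" "t1 < \<tau>" "\<bar>t\<bar> < t1" using t by (auto simp: t1_def)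
  obtain w where w: "\<And>t. t \<in> {-t1..t1} \<Longrightarrow> ((\<lambda>p. u (t, p)) has_derivative w t) (at p)"
    "\<And>t v. t \<in> {-t1..t1} \<Longrightarrow>
       ((\<lambda>t. w t v) has_vector_derivative DH (t, p) (0, v, w t v)) (at t within {-t1..t1})"
    using parameter_derivative[OF p t1(1,2)] by metis
  have eq: "Du v (s, p) = w s v" if "s \<in> {-t1..t1}" for s v
    using frechet_derivative_eq[OF w(1)[OF that]] by simp
  have tt: "t \<in> {-t1..t1}" "t \<in> {-t1<..<t1}" using t1 by auto
  show "((\<lambda>p. u (t, p)) has_derivative (\<lambda>v. Du v (t, p))) (at p)"
    using w(1)[OF tt(1)] eq[OF tt(1)] by simp
  have "((\<lambda>t. w t v) has_vector_derivative DH (t, p) (0, v, w t v)) (at t within {-t1<..<t1})"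
    by (rule has_vector_derivative_within_subset[OF w(2)[OF tt(1)]]) auto
  then have "((\<lambda>t. w t v) has_vector_derivative DH (t, p) (0, v, w t v)) (at t)"
    by (simp only: at_within_open[OF tt(2) open_greaterThanLessThan])
  then show "((\<lambda>t. Du v (t, p)) has_vector_derivative DH (t, p) (0, v, Du v (t, p))) (at t)"
    unfolding eq[OF tt(1)]
    by (rule has_vector_derivative_transform_within_open[of _ _ _ "{-t1<..<t1}"]) (use tt eq in auto)
qed

text \<open>The difference of the solutions of the variational equation at \<open>p\<close> and at
  \<open>p0\<close> obeys a linear inequality whose source is the change of the coefficients along
  one fixed curve.\<close>

lemma Du_cont: "continuous_on ({-\<tau><..<\<tau>} \<times> P) (Du v)"
proof (intro continuous_at_imp_continuous_on ballI)
  fix x assume "x \<in> {-\<tau><..<\<tau>} \<times> P"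
  then obtain t0 p0 where x: "x = (t0, p0)" and t0: "t0 \<in> {-\<tau><..<\<tau>}" and p0: "p0 \<in> P" by auto
  define t1 where "t1 = (\<bar>t0\<bar> + \<tau>) / 2"
  have t1: "0 < t1" "t1 < \<tau>" "\<bar>t0\<bar> < t1" using t0 by (auto simp: t1_def)
  let ?S = "{-t1..t1}"
  have S: "t \<in> {-\<tau><..<\<tau>}" if "t \<in> ?S" for t using that t1 by auto
  have Kt1: "K * t1 \<le> 1 / 2"
    using mult_left_mono[of t1 \<tau> K] K t1 by linarith
  obtain \<rho> where \<rho>: "\<rho> > 0" "cball p0 \<rho> \<subseteq> P" using P p0 open_contains_cball by blast
  have cw: "continuous_on {-\<tau><..<\<tau>} (\<lambda>t. Du v (t, p0))"
    using has_vector_derivative_continuous[OF Du_ode[OF _ p0]] by (intro continuous_at_imp_continuous_on) blast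
  \<comment> \<open>The coefficients vary with \<open>y\<close> while the solution is frozen at
    \<open>p0\<close>. Its continuity in time is already known, so this function is jointly
    continuous.\<close>
  let ?g = "\<lambda>y. DH y (0, v, Du v (fst y, p0))"
  have "continuous_on (?S \<times> cball p0 \<rho>) ?g"
    by (intro cont_DH_apply continuous_intros continuous_on_compose2[OF cw]) (use S \<rho> in auto)
  then have uc: "uniformly_continuous_on (?S \<times> cball p0 \<rho>) ?g"
    by (intro compact_uniformly_continuous compact_Times) auto
  show "isCont (Du v) x"
    unfolding continuous_at_eps_delta
  proof (intro allI impI)
    fix e :: real assume e: "e > 0"
    \<comment> \<open>The source contributes at most \<open>e / 4\<close>, twice the initial error
      less than \<open>e / 4\<close>, and the change of time less than \<open>e / 4\<close>.\<close>
    define e' where "e' = e / (8 * (1 + t1))"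
    have e': "e' > 0" "2 * t1 * e' \<le> e / 4" using e t1 by (auto simp: e'_def field_simps)
    obtain d1 where d1: "d1 > 0" "\<And>y y'. y \<in> ?S \<times> cball p0 \<rho> \<Longrightarrow> y' \<in> ?S \<times> cball p0 \<rho> \<Longrightarrow>
        dist y' y < d1 \<Longrightarrow> dist (?g y') (?g y) < e'"
      using uc e'(1) unfolding uniformly_continuous_on_def by metis
    have "continuous_on P (\<lambda>p. Du v (0, p))" using init by simp
    then have "isCont (\<lambda>p. Du v (0, p)) p0" using P p0 continuous_on_eq_continuous_at by blast
    then obtain d2 where d2: "d2 > 0" "\<And>p. dist p p0 < d2 \<Longrightarrow> dist (Du v (0, p)) (Du v (0, p0)) < e / 8"
      unfolding continuous_at_eps_delta using e by (metis zero_less_divide_iff zero_less_numeral)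
    have "isCont (\<lambda>t. Du v (t, p0)) t0" using has_vector_derivative_continuous[OF Du_ode[OF t0 p0]] .
    then obtain d3 where d3: "d3 > 0" "\<And>t. dist t t0 < d3 \<Longrightarrow> dist (Du v (t, p0)) (Du v (t0, p0)) < e / 4"
      unfolding continuous_at_eps_delta using e by (metis zero_less_divide_iff zero_less_numeral)
    show "\<exists>d>0. \<forall>y. dist y x < d \<longrightarrow> dist (Du v y) (Du v x) < e"
    proof (intro exI[of _ "Min {d1, d2, d3, \<rho>, t1 - \<bar>t0\<bar>}"] conjI allI impI)
      show "0 < Min {d1, d2, d3, \<rho>, t1 - \<bar>t0\<bar>}" using d1 d2 d3 \<rho> t1 by simp
      fix y assume y: "dist y x < Min {d1, d2, d3, \<rho>, t1 - \<bar>t0\<bar>}"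
      obtain t p where tp: "y = (t, p)" by (cases y)
      have "dist t t0 \<le> dist y x" "dist p p0 \<le> dist y x"
        using dist_fst_le[of y x] dist_snd_le[of y x] by (auto simp: tp x)
      with y have dt: "dist t t0 < d3" "dist t t0 < t1 - \<bar>t0\<bar>"
        and dp: "dist p p0 < d1" "dist p p0 < d2" "dist p p0 < \<rho>" by auto
      have t: "t \<in> ?S" using dt by (auto simp: dist_real_def)
      have p: "p \<in> P" using dp \<rho> by (auto simp: dist_commute)
      define q where "q s = Du v (s, p) - Du v (s, p0)" for s
      have "norm (q t) \<le> 2 * norm (q 0) + 2 * t1 * e'"
      proof (rule small_time_bound[where S = ?S and
            f' = "\<lambda>s. DH (s, p) (0, v, Du v (s, p)) - DH (s, p0) (0, v, Du v (s, p0))"])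
        fix s assume s: "s \<in> ?S"
        show "(q has_vector_derivative DH (s, p) (0, v, Du v (s, p)) - DH (s, p0) (0, v, Du v (s, p0))) (at s within ?S)"
          unfolding q_def
          by (intro has_vector_derivative_diff has_vector_derivative_at_within[OF Du_ode] S s p p0)
        have "dist (?g (s, p)) (?g (s, p0)) < e'"
          using s dp \<rho> by (intro d1(2)) (auto simp: dist_commute dist_Pair_Pair)
        then have 1: "norm (?g (s, p) - ?g (s, p0)) \<le> e'" by (simp add: dist_norm)
        have "DH (s, p) (0, v, Du v (s, p)) - ?g (s, p) = DH (s, p) (0, 0, q s)"
          using linear_diff[OF linear_DH[OF S[OF s] p], of "(0, v, Du v (s, p))" "(0, v, Du v (s, p0))"]
          by (simp add: q_def)
        then have 2: "DH (s, p) (0, v, Du v (s, p)) - DH (s, p0) (0, v, Du v (s, p0))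
          = DH (s, p) (0, 0, q s) + (?g (s, p) - ?g (s, p0))"
          by (simp add: algebra_simps)
        show "norm (DH (s, p) (0, v, Du v (s, p)) - DH (s, p0) (0, v, Du v (s, p0))) \<le> K * norm (q s) + e'"
          unfolding 2 using norm_triangle_mono[OF bound[OF S[OF s] p, of "q s"] 1] by simp
      qed (use t1 K(1) Kt1 e'(1) t in auto)
      moreover have "norm (q 0) < e / 8" using d2(2)[OF dp(2)] by (simp add: q_def dist_norm)
      ultimately have "norm (q t) < e / 2" using e'(2) by linarith
      moreover have "dist (Du v (t, p)) (Du v (t0, p0)) \<le> norm (q t) + dist (Du v (t, p0)) (Du v (t0, p0))"
        unfolding q_def dist_norm[symmetric] by (rule dist_triangle)
      ultimately show "dist (Du v y) (Du v x) < e"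
        using d3(2)[OF dt(1)] e unfolding tp x by linarith
    qed
  qed
qed

text \<open>The partial derivative in time exists at the point and the one in the parameter is
  jointly continuous by \<open>Du_cont\<close>; together they give a total derivative.\<close>

lemma has_derivative_flow:
  assumes x: "x \<in> {-\<tau><..<\<tau>} \<times> P"
  shows "(u has_derivative (\<lambda>h. fst h *\<^sub>R H (fst x, snd x, u x) + Du (snd h) x)) (at x)"
proof -
  obtain t p where tp: "x = (t, p)" "t \<in> {-\<tau><..<\<tau>}" "p \<in> P" using x by auto
  \<comment> \<open>\<open>has_derivative_partialsI\<close> asks for a convex set in the second
    variable, hence a ball in place of \<open>P\<close>.\<close>
  obtain \<rho> where \<rho>: "\<rho> > 0" "ball p \<rho> \<subseteq> P" using P tp open_contains_ball by blast
  let ?J = "{-\<tau><..<\<tau>}"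
  have bl: "blinfun_apply (Blinfun (\<lambda>v. Du v (s, r))) = (\<lambda>v. Du v (s, r))" if "s \<in> ?J" "r \<in> P" for s r
    using has_derivative_bounded_linear[OF has_derivative_Du[OF that]] by (simp add: bounded_linear_Blinfun_apply)
  have open': "open (?J \<times> ball p \<rho>)" and mem': "(t, p) \<in> ?J \<times> ball p \<rho>"
    using \<rho> tp by (auto intro: open_Times)
  have "((\<lambda>(t, p). u (t, p)) has_derivative (\<lambda>(tx, ty). tx *\<^sub>R H (t, p, u (t, p)) + blinfun_apply (Blinfun (\<lambda>v. Du v (t, p))) ty))
    (at (t, p) within ?J \<times> ball p \<rho>)"
  proof (rule has_derivative_partialsI)
    show "((\<lambda>s. u (s, p)) has_derivative (\<lambda>tx. tx *\<^sub>R H (t, p, u (t, p)))) (at t within ?J)"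
      using has_vector_derivative_at_within[OF ode[OF tp(2,3)]] by (simp add: has_vector_derivative_def)
    show "((\<lambda>p. u (s, p)) has_derivative blinfun_apply (Blinfun (\<lambda>v. Du v (s, r)))) (at r within ball p \<rho>)"
      if "s \<in> ?J" "r \<in> ball p \<rho>" for s r
      using has_derivative_at_withinI[OF has_derivative_Du[OF that(1)]] bl[OF that(1)] that \<rho> by auto
    have "continuous_on (?J \<times> ball p \<rho>) (\<lambda>y. Blinfun (\<lambda>v. Du v y))"
    proof (rule continuous_on_blinfun_componentwise)
      fix i :: 'p
      have "continuous_on (?J \<times> ball p \<rho>) (Du i)"
        by (rule continuous_on_subset[OF Du_cont]) (use \<rho> in auto)
      moreover have "blinfun_apply (Blinfun (\<lambda>v. Du v y)) i = Du i y" if "y \<in> ?J \<times> ball p \<rho>" for y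
        using bl[of "fst y" "snd y"] that \<rho> by auto
      ultimately show "continuous_on (?J \<times> ball p \<rho>) (\<lambda>y. blinfun_apply (Blinfun (\<lambda>v. Du v y)) i)"
        by (simp cong: continuous_on_cong)
    qed
    then show "continuous (at (t, p) within ?J \<times> ball p \<rho>) (\<lambda>(s, r). Blinfun (\<lambda>v. Du v (s, r)))"
      using mem' unfolding continuous_on_eq_continuous_within case_prod_beta prod.collapse by blast
  qed (use \<rho> in auto)
  then show ?thesis
    using at_within_open[OF mem' open'] bl[OF tp(2,3)] tp(1) by (simp add: case_prod_unfold)
qed

end

text \<open>The right-hand side \<open>H'\<close> of the variational equation is affine in its
  unknown, with linear part \<open>DH (t, p) (0, 0, w)\<close>. Hence \<open>K\<close>, and with it
  \<open>\<tau>\<close> and \<open>P\<close>, carry over to \<open>Du v\<close>.\<close>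

lemma ode_family_Ck:
  assumes "ode_family H W P \<tau> K u" "Ck_on (Suc k) W H" "Ck_on (Suc k) P (\<lambda>p. u (0, p))"
  shows "Ck_on (Suc k) ({-\<tau><..<\<tau>} \<times> P) u"
  using assms
proof (induction k arbitrary: H W u)
  case 0
  interpret ode_family H W P \<tau> K u by fact
  have op: "open ({-\<tau><..<\<tau>} \<times> P)" by (intro open_Times P) simp
  show ?case
  proof (rule Ck_on_SucI[OF op has_derivative_flow])
    fix h :: "real \<times> 'a"
    have "continuous_on ({-\<tau><..<\<tau>} \<times> P) (\<lambda>x. H (fst x, snd x, u x))"
      by (rule continuous_on_compose2[OF Ck_on_imp_continuous_on[OF H]])
        (auto intro!: continuous_intros u_cont mem)
    then show "Ck_on 0 ({-\<tau><..<\<tau>} \<times> P) (\<lambda>x. fst h *\<^sub>R H (fst x, snd x, u x) + Du (snd h) x)"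
      by (auto intro!: continuous_intros Du_cont)
  qed
next
  case (Suc k)
  interpret ode_family H W P \<tau> K u by fact
  let ?JP = "{-\<tau><..<\<tau>} \<times> P"
  have op: "open ?JP" by (intro open_Times P) simp
  \<comment> \<open>The lower order comes first: \<open>H'\<close> contains \<open>u\<close> in its
    coefficients, so its own smoothness relies on that of \<open>u\<close>.\<close>
  have Cu: "Ck_on (Suc k) ?JP u"
    by (rule Suc.IH[OF Suc.prems(1) Ck_on_Suc_imp[OF Suc.prems(2)] Ck_on_Suc_imp[OF Suc.prems(3)]])
  have CDu: "Ck_on (Suc k) ?JP (Du v)" for v
  proof -
    define W' :: "(real \<times> 'a \<times> 'b) set" where "W' = {-\<tau><..<\<tau>} \<times> P \<times> UNIV"
    define H' where "H' x = DH (fst x, fst (snd x)) (0, v, snd (snd x))" for x :: "real \<times> 'a \<times> 'b"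
    have oW': "open W'" unfolding W'_def by (intro open_Times P) auto
    have CH': "Ck_on (Suc k) W' H'"
      unfolding H'_def
    proof (rule Ck_on_apply_linear[where A="\<lambda>x. DH (fst x, fst (snd x))", OF oW'])
      fix b :: "real \<times> 'a \<times> 'b"
      have "Ck_on (Suc k) W (\<lambda>x. frechet_derivative H (at x) b)"
        using Suc.prems(2) by (simp only: Ck_on.simps(2)[of "Suc k"])
      moreover have "Ck_on (Suc k) W' (\<lambda>x. (fst x, fst (snd x)))"
        by (intro Ck_on_Pair Ck_on_fst Ck_on_snd Ck_on_ident oW')
      then have "Ck_on (Suc k) W' (\<lambda>x. (fst x, fst (snd x), u (fst x, fst (snd x))))"
        by (intro Ck_on_Pair Ck_on_fst Ck_on_snd Ck_on_ident oW' Ck_on_compose[OF oW' _ Cu])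
          (auto simp: W'_def)
      ultimately show "Ck_on (Suc k) W' (\<lambda>x. DH (fst x, fst (snd x)) b)"
        using Ck_on_compose[OF oW', of "Suc k" "\<lambda>x. (fst x, fst (snd x), u (fst x, fst (snd x)))" W
           "\<lambda>x. frechet_derivative H (at x) b"] mem by (auto simp: W'_def)
    next
      show "Ck_on (Suc k) W' (\<lambda>x. (0, v, snd (snd x)))"
        by (intro Ck_on_Pair Ck_on_snd Ck_on_ident Ck_on_const oW')
      show "linear (DH (fst x, fst (snd x)))" if "x \<in> W'" for x
        using that linear_DH by (auto simp: W'_def)
    qed
    have init': "Ck_on (Suc k) P (\<lambda>p. Du v (0, p))"
      using Suc.prems(3) by (simp only: Ck_on.simps(2)[of "Suc k"] fst_conv snd_conv)
    have "ode_family H' W' P \<tau> K (Du v)"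
    proof
      show "Ck_on (Suc 0) W' H'" by (rule Ck_on_le[OF CH']) simp
      show "Ck_on (Suc 0) P (\<lambda>p. Du v (0, p))" by (rule Ck_on_le[OF init']) simp
      fix t p assume tp: "t \<in> {-\<tau><..<\<tau>}" "p \<in> P"
      show "(t, p, Du v (t, p)) \<in> W'" using tp by (simp add: W'_def)
      show "((\<lambda>t. Du v (t, p)) has_vector_derivative H' (t, p, Du v (t, p))) (at t)"
        using Du_ode[OF tp] by (simp add: H'_def)
      fix w :: 'b
      let ?y = "(t, p, Du v (t, p))"
      \<comment> \<open>As \<open>H'\<close> is affine in the unknown, its derivative in the
        direction \<open>(0, 0, w)\<close> can be read off along a line, without a formula for the
        full derivative.\<close>
      have "((\<lambda>c. H' (?y + c *\<^sub>R (0, 0, w))) has_vector_derivative frechet_derivative H' (at ?y) (0, 0, w)) (at 0)"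
      proof -
        have "(H' has_derivative frechet_derivative H' (at ?y)) (at (?y + 0 *\<^sub>R (0, 0, w)))"
          using Ck_on_Suc_imp_has_derivative[OF CH', of ?y] tp by (simp add: W'_def)
        then have "((\<lambda>c. H' (?y + c *\<^sub>R (0, 0, w))) has_derivative (\<lambda>c. frechet_derivative H' (at ?y) (c *\<^sub>R (0, 0, w)))) (at 0)"
          by (rule has_derivative_compose[where g = H' and f = "\<lambda>c. ?y + c *\<^sub>R (0, 0, w)" and x = 0, rotated])
            (auto intro!: derivative_eq_intros simp del: scaleR_Pair)
        moreover have "linear (frechet_derivative H' (at ?y))"
          using CH' tp by (intro linear_frechet_derivative) (auto simp: W'_def)
        ultimately show ?thesis
          unfolding has_vector_derivative_def by (simp add: linear_cmul del: scaleR_Pair)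
      qed
      moreover have "H' (?y + c *\<^sub>R (0, 0, w)) = H' ?y + c *\<^sub>R DH (t, p) (0, 0, w)" for c
        using linear_add[OF linear_DH[OF tp], of "(0, v, Du v (t, p))" "c *\<^sub>R (0, 0, w)"]
          linear_cmul[OF linear_DH[OF tp], of c "(0, 0, w)"]
        by (simp add: H'_def)
      then have "((\<lambda>c. H' (?y + c *\<^sub>R (0, 0, w))) has_vector_derivative DH (t, p) (0, 0, w)) (at 0)"
        by (simp only:) (auto intro!: derivative_eq_intros)
      ultimately have "frechet_derivative H' (at ?y) (0, 0, w) = DH (t, p) (0, 0, w)"
        by (rule vector_derivative_unique_at)
      then show "norm (frechet_derivative H' (at ?y) (0, 0, w)) \<le> K * norm w"
        using bound[OF tp] by simp
    qed (rule oW' P K Du_cont)+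
    from Suc.IH[OF this CH' init'] show ?thesis .
  qed
  show ?case
  proof (rule Ck_on_SucI[OF op has_derivative_flow])
    fix h :: "real \<times> 'a"
    have "Ck_on (Suc k) ?JP (\<lambda>x. H (fst x, snd x, u x))"
      by (rule Ck_on_compose[OF op _ Ck_on_Suc_imp[OF Suc.prems(2)]],
          intro Ck_on_Pair Ck_on_fst Ck_on_snd Ck_on_ident op Cu) (use mem in auto)
    then show "Ck_on (Suc k) ?JP (\<lambda>x. fst h *\<^sub>R H (fst x, snd x, u x) + Du (snd h) x)"
      by (intro Ck_on_add Ck_on_scaleR Ck_on_const op CDu)
  qed
qed

text \<open>The last conclusion lets a solution on \<open>{0..T}\<close>, with one-sided derivatives
  and no known regularity in the parameter, be replaced by the smooth \<open>u\<close>. For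
  existence, \<open>F\<close> is composed with the projection onto a closed ball. This makes it
  globally Lipschitz, as \<open>picard_existence\<close> requires, and bounded, so that for short
  times the solutions stay in the ball and do not feel the truncation.\<close>

lemma smooth_local_flow:
  fixes F :: "'u::euclidean_space \<Rightarrow> 'u" and u0 :: "'p::euclidean_space \<Rightarrow> 'u"
  assumes W: "open W" and F: "\<And>k. Ck_on k W F"
    and P: "open P" "p0 \<in> P" and u0: "\<And>k. Ck_on k P u0" "u0 p0 \<in> W"
  obtains \<tau> \<delta> u where "\<tau> > 0" "\<delta> > 0" "ball p0 \<delta> \<subseteq> P"
    "\<And>k. Ck_on k ({-\<tau><..<\<tau>} \<times> ball p0 \<delta>) u"
    "\<And>p. p \<in> ball p0 \<delta> \<Longrightarrow> u (0, p) = u0 p"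
    "\<And>t p. t \<in> {-\<tau><..<\<tau>} \<Longrightarrow> p \<in> ball p0 \<delta> \<Longrightarrow>
       u (t, p) \<in> W \<and> ((\<lambda>t. u (t, p)) has_vector_derivative F (u (t, p))) (at t)"
    "\<And>y T t p. p \<in> ball p0 \<delta> \<Longrightarrow> T < \<tau> \<Longrightarrow> y 0 = u0 p \<Longrightarrow>
       (\<And>t. t \<in> {0..T} \<Longrightarrow> y t \<in> W \<and> (y has_vector_derivative F (y t)) (at t within {0..T})) \<Longrightarrow>
       t \<in> {0..T} \<Longrightarrow> y t = u (t, p)"
proof -
  let ?c = "u0 p0"
  obtain R where R: "R > 0" "cball ?c R \<subseteq> W" using W u0(2) open_contains_cball by blast
  let ?B = "cball ?c R"
  have contF: "continuous_on W F" using F[of 0] by simp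
  have "bounded (F ` ?B)"
    by (intro compact_imp_bounded compact_continuous_image continuous_on_subset[OF contF] R) simp
  then obtain M where M: "M > 0" "\<And>x. x \<in> ?B \<Longrightarrow> norm (F x) \<le> M"
    unfolding bounded_pos by auto
  let ?D = "\<lambda>x. frechet_derivative F (at x)"
  have contD: "continuous_on W (\<lambda>x. ?D x b)" for b using F[of "Suc 0"] by simp
  have linD: "linear (?D x)" if "x \<in> W" for x
    using F[of "Suc 0"] that by (intro linear_frechet_derivative) auto
  have "bounded ((\<lambda>x. \<Sum>b\<in>Basis. norm (?D x b)) ` ?B)"
    by (intro compact_imp_bounded compact_continuous_image continuous_intros continuous_on_subset[OF contD] R) simp
  then obtain K where "K > 0" "\<forall>y\<in>(\<lambda>x. \<Sum>b\<in>Basis. norm (?D x b)) ` ?B. norm y \<le> K"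
    unfolding bounded_pos by blast
  then have K: "K > 0" "\<And>x. x \<in> ?B \<Longrightarrow> (\<Sum>b\<in>Basis. norm (?D x b)) \<le> K"
    by (auto simp: abs_le_iff)
  have KD: "norm (?D x v) \<le> K * norm v" if "x \<in> ?B" for x v
    by (rule order_trans[OF norm_linear_le_sum_Basis[OF linD] mult_right_mono[OF K(2)[OF that] norm_ge_zero]])
      (use R(2) that in blast)
  have DF: "(F has_derivative ?D z) (at z)" if "z \<in> W" for z
    by (rule Ck_on_Suc_imp_has_derivative[OF F[of "Suc 0"] that])
  have lip: "norm (F x - F y) \<le> K * norm (x - y)" if "x \<in> ?B" "y \<in> ?B" for x y
    by (rule differentiable_bound[of ?B F ?D K x y, OF convex_cball has_derivative_at_withinI[OF DF] onorm_le[OF KD] that])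
      (use R(2) in blast)
  define G where "G x = F (closest_point ?B x)" for x
  have cpB: "closest_point ?B x \<in> ?B" for x using R by (intro closest_point_in_set) auto
  have GF: "G x = F x" if "x \<in> ?B" for x using that by (simp add: G_def closest_point_self)
  have GM: "norm (G x) \<le> M" for x unfolding G_def by (intro M cpB)
  have Glip: "norm (G x - G y) \<le> K * norm (x - y)" for x y
  proof -
    have "dist (closest_point ?B x) (closest_point ?B y) \<le> dist x y"
      using R by (intro closest_point_lipschitz) auto
    from order_trans[OF lip[OF cpB[of x] cpB[of y]] mult_left_mono[OF this[unfolded dist_norm], of K]]
    show ?thesis using K(1) by (simp add: G_def)
  qed
  \<comment> \<open>\<open>1 / (4 * K)\<close> is the time scale of \<open>ode_family\<close>;
    \<open>R / (2 * M)\<close> keeps a curve of speed at most \<open>M\<close>, starting within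
    \<open>R / 2\<close> of the centre, inside the ball of radius \<open>R\<close>.\<close>
  define \<tau> where "\<tau> = min (1 / (4 * K)) (R / (2 * M))"
  have \<tau>: "\<tau> > 0" using K M R by (simp add: \<tau>_def)
  have K\<tau>: "K * \<tau> \<le> 1 / 4"
    using mult_left_mono[of \<tau> "1 / (4 * K)" K] K by (simp add: \<tau>_def)
  have M\<tau>: "M * \<tau> \<le> R / 2"
    using mult_left_mono[of \<tau> "R / (2 * M)" M] M by (simp add: \<tau>_def)
  have "isCont u0 p0" using u0(1)[of 0] P by (simp add: continuous_on_eq_continuous_at)
  then obtain d where d: "d > 0" "\<And>p. dist p p0 < d \<Longrightarrow> dist (u0 p) ?c < R / 2"
    unfolding continuous_at_eps_delta using R by (metis half_gt_zero)
  obtain d' where d': "d' > 0" "ball p0 d' \<subseteq> P" using P open_contains_ball by blast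
  define \<delta> where "\<delta> = min d d'"
  have \<delta>: "\<delta> > 0" "ball p0 \<delta> \<subseteq> P" using d d' by (auto simp: \<delta>_def)
  have u0R: "norm (u0 p - ?c) < R / 2" if "p \<in> ball p0 \<delta>" for p
    using d(2)[of p] that by (simp add: \<delta>_def dist_commute[of p0] dist_norm[symmetric])
  have "\<exists>v. v 0 = u0 p \<and> (\<forall>t\<in>{-\<tau>..\<tau>}. (v has_vector_derivative G (v t)) (at t within {-\<tau>..\<tau>}))" for p
  proof (rule picard_existence[of \<tau> "\<lambda>t. G" K "u0 p"])
    have "continuous_on UNIV G"
      unfolding G_def
      by (intro continuous_on_compose2[OF contF] continuous_on_closest_point) (use R cpB in auto)
    from continuous_on_compose2[OF this, of _ snd]
    show "continuous_on ({-\<tau>..\<tau>} \<times> UNIV) (\<lambda>(t, y). G y)"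
      by (simp add: case_prod_unfold continuous_on_snd)
  qed (use \<tau> K K\<tau> Glip in auto)
  then obtain v where v: "\<And>p. v p 0 = u0 p"
    "\<And>p t. t \<in> {-\<tau>..\<tau>} \<Longrightarrow> (v p has_vector_derivative G (v p t)) (at t within {-\<tau>..\<tau>})"
    by metis
  define u where "u x = v (snd x) (fst x)" for x
  have vt: "norm (v p t - v p s) \<le> M * norm (t - s)" if "t \<in> {-\<tau>..\<tau>}" "s \<in> {-\<tau>..\<tau>}" for t s p
  proof (rule differentiable_bound[of "{-\<tau>..\<tau>}" "v p" "\<lambda>r h. h *\<^sub>R G (v p r)"])
    show "(v p has_derivative (\<lambda>h. h *\<^sub>R G (v p r))) (at r within {-\<tau>..\<tau>})" if "r \<in> {-\<tau>..\<tau>}" for r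
      using v(2)[OF that] by (simp add: has_vector_derivative_def)
    show "onorm (\<lambda>h. h *\<^sub>R G (v p r)) \<le> M" for r
      using GM[of "v p r"] by (intro onorm_le) (simp add: mult.commute[of _ "\<bar>_\<bar>"] mult_left_mono)
  qed (use that in auto)
  have vB: "v p t \<in> ball ?c R" if "t \<in> {-\<tau>..\<tau>}" "p \<in> ball p0 \<delta>" for t p
  proof -
    have "norm (v p t - u0 p) \<le> M * \<bar>t\<bar>" using vt[OF that(1), of 0] \<tau> v(1) by simp
    also have "\<dots> \<le> M * \<tau>" using M that by (intro mult_left_mono) auto
    finally have "norm (v p t - u0 p) \<le> R / 2" using M\<tau> by simp
    then have "norm ((v p t - u0 p) + (u0 p - ?c)) < R / 2 + R / 2"
      using u0R[OF that(2)] norm_triangle_ineq[of "v p t - u0 p" "u0 p - ?c"] by linarith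
    then show ?thesis by (simp add: dist_norm norm_minus_commute)
  qed
  have vF: "(v p has_vector_derivative F (v p t)) (at t within {-\<tau>..\<tau>})" if "t \<in> {-\<tau>..\<tau>}" "p \<in> ball p0 \<delta>" for t p
    using v(2)[OF that(1), of p] GF[of "v p t"] vB[OF that] by (simp add: less_imp_le)
  have uF: "u (t, p) \<in> W \<and> ((\<lambda>t. u (t, p)) has_vector_derivative F (u (t, p))) (at t)"
    if "t \<in> {-\<tau><..<\<tau>}" "p \<in> ball p0 \<delta>" for t p
  proof
    show "u (t, p) \<in> W" using vB[of t p] that R(2) by (auto simp: u_def less_imp_le)
    have "(v p has_vector_derivative F (v p t)) (at t within {-\<tau><..<\<tau>})"
      using that by (intro has_vector_derivative_within_subset[OF vF]) auto
    then show "((\<lambda>t. u (t, p)) has_vector_derivative F (u (t, p))) (at t)"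
      by (simp only: u_def at_within_open[OF that(1) open_greaterThanLessThan] fst_conv snd_conv)
  qed
  have vp: "norm (v p t - v p' t) \<le> 2 * norm (u0 p - u0 p')" if "t \<in> {-\<tau>..\<tau>}" for t p p'
  proof -
    have "norm (v p t - v p' t) \<le> 2 * norm (v p 0 - v p' 0) + 2 * \<tau> * 0"
      by (rule small_time_bound[where S = "{-\<tau>..\<tau>}" and f = "\<lambda>t. v p t - v p' t" and K = K
            and f' = "\<lambda>t. G (v p t) - G (v p' t)"])
        (use that \<tau> K K\<tau> Glip in \<open>auto intro!: has_vector_derivative_diff v\<close>)
    then show ?thesis by (simp add: v)
  qed
  have u_cont: "continuous_on ({-\<tau><..<\<tau>} \<times> ball p0 \<delta>) u"
    unfolding continuous_on_def
  proof
    fix x assume x: "x \<in> {-\<tau><..<\<tau>} \<times> ball p0 \<delta>"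
    let ?S = "{-\<tau><..<\<tau>} \<times> ball p0 \<delta>"
    let ?g = "\<lambda>y. 2 * norm (u0 (snd y) - u0 (snd x)) + M * norm (fst y - fst x)"
    have "continuous_on ?S (\<lambda>y. u0 (snd y))"
      by (rule continuous_on_compose2[OF Ck_on_imp_continuous_on[OF u0(1)[of 0]] continuous_on_snd[OF continuous_on_id]])
        (use \<delta>(2) in auto)
    then have "continuous_on ?S ?g"
      by (intro continuous_on_add continuous_on_mult continuous_on_norm continuous_on_diff
          continuous_on_const continuous_on_fst continuous_on_id)
    then have "(?g \<longlongrightarrow> ?g x) (at x within ?S)"
      using x by (simp only: continuous_on_def)
    then have lim: "(?g \<longlongrightarrow> 0) (at x within ?S)" by simp
    have "norm (u y - u x) \<le> ?g y" if y: "y \<in> ?S" for y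
    proof -
      have "fst y \<in> {-\<tau>..\<tau>}" "fst x \<in> {-\<tau>..\<tau>}" using x y by auto
      from norm_triangle_mono[OF vp[OF this(1), of "snd y" "snd x"] vt[OF this, of "snd x"]]
      show ?thesis by (simp add: u_def)
    qed
    then have "\<forall>\<^sub>F y in at x within ?S. norm (u y - u x) \<le> ?g y"
      by (simp add: eventually_at_filter)
    from Lim_null_comparison[OF this lim]
    show "(u \<longlongrightarrow> u x) (at x within ?S)" by (simp add: LIM_zero_iff)
  qed
  have H: "Ck_on k (UNIV \<times> UNIV \<times> W) (\<lambda>x::real \<times> 'p \<times> 'u. F (snd (snd x)))" for k
    by (rule Ck_on_compose[OF _ _ F]) (auto intro!: Ck_on_snd Ck_on_ident open_Times W)
  have init: "Ck_on k (ball p0 \<delta>) (\<lambda>p. u (0, p))" for k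
    using Ck_on_subset[OF u0(1) \<delta>(2), of k] by (simp add: u_def v)
  have fam: "ode_family (\<lambda>x::real \<times> 'p \<times> 'u. F (snd (snd x))) (UNIV \<times> UNIV \<times> W) (ball p0 \<delta>) \<tau> K u"
  proof
    fix t :: real and p :: 'p and w :: 'u assume tp: "t \<in> {-\<tau><..<\<tau>}" "p \<in> ball p0 \<delta>"
    show "(t, p, u (t, p)) \<in> UNIV \<times> UNIV \<times> W" using uF[OF tp] by simp
    show "((\<lambda>t. u (t, p)) has_vector_derivative F (snd (snd (t, p, u (t, p))))) (at t)" using uF[OF tp] by simp
    have uB: "u (t, p) \<in> ?B" using vB[of t p] tp by (simp add: u_def)
    have "(F has_derivative ?D (u (t, p))) (at (u (t, p)))" using DF uF[OF tp] by blast
    then have "((\<lambda>x::real \<times> 'p \<times> 'u. F (snd (snd x))) has_derivative (\<lambda>h. ?D (u (t, p)) (snd (snd h)))) (at (t, p, u (t, p)))"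
      by (intro has_derivative_compose[of "\<lambda>x. snd (snd x)" "\<lambda>h. snd (snd h)" _ UNIV F] has_derivative_snd has_derivative_ident) simp
    from frechet_derivative_eq[OF this]
    show "norm (frechet_derivative (\<lambda>x. F (snd (snd x))) (at (t, p, u (t, p))) (0, 0, w)) \<le> K * norm w"
      using KD[OF uB, of w] by simp
  qed (rule H init u_cont K\<tau> less_imp_le[OF K(1)] open_ball | intro open_Times open_UNIV W)+
  show thesis
  proof (rule that[OF \<tau> \<delta>])
    show "Ck_on k ({-\<tau><..<\<tau>} \<times> ball p0 \<delta>) u" for k
      using Ck_on_Suc_imp[OF ode_family_Ck[OF fam H init]] .
    show "u (0, p) = u0 p" for p by (simp add: u_def v)
  next
    fix y T t p
    assume p: "p \<in> ball p0 \<delta>" and T: "T < \<tau>" and y0: "y 0 = u0 p" and t: "t \<in> {0..T}"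
      and y: "\<And>t. t \<in> {0..T} \<Longrightarrow> y t \<in> W \<and> (y has_vector_derivative F (y t)) (at t within {0..T})"
    have ycont: "continuous_on {0..T} y"
      using has_vector_derivative_continuous y unfolding continuous_on_eq_continuous_within by blast
    text \<open>At its first exit time from the ball of radius \<open>R\<close>, the solution would have moved by
      \<open>R / 2\<close> with speed at most \<open>M\<close>.\<close>
    have yB: "y s \<in> ball ?c R" if s: "s \<in> {0..T}" for s
    proof (rule ccontr)
      assume "y s \<notin> ball ?c R"
      let ?E = "{s \<in> {0..T}. R \<le> dist (y s) ?c}"
      have "closed ?E"
        by (intro continuous_on_closed_Collect_le continuous_intros ycont closed_atLeastAtMost)
      then have "compact ({0..T} \<inter> ?E)" by (intro compact_Int_closed compact_Icc)
      then have "compact ?E" by (rule back_subst[of compact]) auto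
      moreover have "?E \<noteq> {}" using s \<open>y s \<notin> ball ?c R\<close> by (auto simp: dist_commute)
      ultimately obtain e where e: "e \<in> ?E" "\<And>s. s \<in> ?E \<Longrightarrow> e \<le> s"
        by (meson compact_attains_inf)
      have e0: "0 < e"
        using e(1) u0R[OF p] R y0 by (cases "e = 0") (auto simp: dist_norm)
      have "\<exists>r\<in>{0<..<e}. norm (y e - y 0) \<le> norm ((\<lambda>h. h *\<^sub>R F (y r)) (e - 0))"
      proof (rule mvt_general[OF e0])
        show "continuous_on {0..e} y" by (rule continuous_on_subset[OF ycont]) (use e in auto)
        fix r assume r: "0 < r" "r < e"
        have "(y has_vector_derivative F (y r)) (at r within {0<..<T})"
        proof (rule has_vector_derivative_within_subset)
          show "(y has_vector_derivative F (y r)) (at r within {0..T})" using y[of r] r e(1) by simp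
        qed auto
        moreover have "r \<in> {0<..<T}" using r e(1) by simp
        ultimately show "(y has_derivative (\<lambda>h. h *\<^sub>R F (y r))) (at r)"
          unfolding has_vector_derivative_def by (simp only: at_within_open[OF _ open_greaterThanLessThan])
      qed
      then obtain r where r: "r \<in> {0<..<e}" "norm (y e - y 0) \<le> e * norm (F (y r))" using e0 by auto
      have "norm (F (y r)) \<le> M"
        using e(2)[of r] r e(1) by (intro M) (force simp: dist_commute)
      then have "norm (y e - y 0) \<le> e * M" using r(2) e0 by (meson less_imp_le mult_left_mono order_trans)
      also have "\<dots> \<le> \<tau> * M" using e(1) T M by (intro mult_right_mono) auto
      also have "\<dots> \<le> R / 2" using M\<tau> by (simp add: mult.commute)
      finally have "norm ((y e - y 0) + (u0 p - ?c)) < R / 2 + R / 2"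
        using u0R[OF p] norm_triangle_ineq[of "y e - y 0" "u0 p - ?c"] by linarith
      then show False using e(1) by (simp add: y0 dist_norm)
    qed
    \<comment> \<open>Both curves lie in the ball, where \<open>F\<close> is Lipschitz with constant
      \<open>K\<close>, and they have the same initial value, so the bound is zero.\<close>
    have "norm (y t - v p t) \<le> 2 * norm (y 0 - v p 0) + 2 * \<tau> * 0"
    proof (rule small_time_bound[where S = "{0..T}" and K = K and f' = "\<lambda>t. F (y t) - F (v p t)"])
      fix s assume s: "s \<in> {0..T}"
      then have s': "s \<in> {-\<tau>..\<tau>}" using T by auto
      show "((\<lambda>t. y t - v p t) has_vector_derivative F (y s) - F (v p s)) (at s within {0..T})"
        using y[OF s] T by (intro has_vector_derivative_diff has_vector_derivative_within_subset[OF vF[OF s' p]]) auto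
      show "norm (F (y s) - F (v p s)) \<le> K * norm (y s - v p s) + 0"
        using lip[of "y s" "v p s"] yB[OF s] vB[OF s' p] by simp
    qed (use t T K K\<tau> in auto)
    then show "y t = u (t, p)" by (simp add: y0 v u_def)
  qed (use uF in blast)+
qed

section \<open>Smooth local inverses\<close>

text \<open>The error splits into \<open>c y\<close> times the remainder of \<open>f\<close>, and
  \<open>c y - c x\<close> times a value of \<open>f'\<close>; both are small for a merely
  continuous \<open>c\<close>. The term that would need a derivative of \<open>c\<close> is
  multiplied by \<open>f x = 0\<close>.\<close>

lemma has_derivative_scaleR_zero:
  fixes c :: "'a::real_normed_vector \<Rightarrow> real"
  assumes f: "(f has_derivative f') (at x)" "f x = 0" and c: "isCont c x"
  shows "((\<lambda>y. c y *\<^sub>R f y) has_derivative (\<lambda>h. c x *\<^sub>R f' h)) (at x)"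
  unfolding has_derivative_iff_norm
proof
  have bl: "bounded_linear f'" using f(1) by (rule has_derivative_bounded_linear)
  then show "bounded_linear (\<lambda>h. c x *\<^sub>R f' h)" by (rule bounded_linear_const_scaleR)
  obtain B where B: "\<And>h. norm (f' h) \<le> norm h * B" "B > 0"
    using bounded_linear.pos_bounded[OF bl] by blast
  let ?q = "\<lambda>y. norm (f y - f x - f' (y - x)) / norm (y - x)"
  have q: "(?q \<longlongrightarrow> 0) (at x)" using f(1) unfolding has_derivative_iff_norm by blast
  have "((\<lambda>y. \<bar>c y - c x\<bar>) \<longlongrightarrow> 0) (at x)" and "((\<lambda>y. \<bar>c y\<bar>) \<longlongrightarrow> \<bar>c x\<bar>) (at x)"
    using c unfolding isCont_def by (simp_all only: tendsto_rabs_zero_iff LIM_zero tendsto_rabs)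
  from tendsto_add[OF tendsto_mult[OF this(2) q] tendsto_mult[OF this(1) tendsto_const]]
  have "((\<lambda>y. \<bar>c y\<bar> * ?q y + \<bar>c y - c x\<bar> * B) \<longlongrightarrow> \<bar>c x\<bar> * 0 + 0 * B) (at x)" .
  then have lim: "((\<lambda>y. \<bar>c y\<bar> * ?q y + \<bar>c y - c x\<bar> * B) \<longlongrightarrow> 0) (at x)" by simp
  show "((\<lambda>y. norm (c y *\<^sub>R f y - c x *\<^sub>R f x - c x *\<^sub>R f' (y - x)) / norm (y - x)) \<longlongrightarrow> 0) (at x)"
  proof (rule Lim_null_comparison[OF eventually_mono[OF eventually_True] lim])
    fix y
    have "c y *\<^sub>R f y - c x *\<^sub>R f x - c x *\<^sub>R f' (y - x) = c y *\<^sub>R (f y - f x - f' (y - x)) + (c y - c x) *\<^sub>R f' (y - x)"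
      by (simp add: f(2) algebra_simps)
    then have "norm (c y *\<^sub>R f y - c x *\<^sub>R f x - c x *\<^sub>R f' (y - x))
      \<le> \<bar>c y\<bar> * norm (f y - f x - f' (y - x)) + \<bar>c y - c x\<bar> * norm (f' (y - x))"
      by (metis norm_scaleR norm_triangle_ineq real_norm_def)
    also have "\<dots> \<le> \<bar>c y\<bar> * norm (f y - f x - f' (y - x)) + \<bar>c y - c x\<bar> * (norm (y - x) * B)"
      by (intro add_left_mono mult_left_mono B) simp
    finally show "norm (norm (c y *\<^sub>R f y - c x *\<^sub>R f x - c x *\<^sub>R f' (y - x)) / norm (y - x))
      \<le> \<bar>c y\<bar> * ?q y + \<bar>c y - c x\<bar> * B"
      by (cases "y = x") (simp_all add: field_simps B(2) less_imp_le)
  qed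
qed

text \<open>Differentiating \<open>A y (w y) = v y\<close> gives an equation of the same kind for
  the derivative of \<open>w\<close>, with the derivative of \<open>v\<close> minus that of
  \<open>A\<close> applied to \<open>w\<close> on the right. Hence an induction with
  \<open>v\<close> and \<open>w\<close> arbitrary, and no formula for an inverse matrix.\<close>

lemma Ck_on_solve_linear:
  fixes A :: "'a::euclidean_space \<Rightarrow> 'b::euclidean_space \<Rightarrow> 'b"
  assumes V: "open V"
    and "\<And>b. Ck_on k V (\<lambda>y. A y b)"
    and A: "\<And>y. y \<in> V \<Longrightarrow> linear (A y)" "\<And>y. y \<in> V \<Longrightarrow> inj (A y)"
    and "Ck_on k V v" "\<And>y. y \<in> V \<Longrightarrow> A y (w y) = v y"
  shows "Ck_on k V w"
  using assms(2,5,6)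
proof (induction k arbitrary: v w)
  case 0
  have "isCont w y0" if y0: "y0 \<in> V" for y0
  proof -
    obtain L where L: "linear L" "L \<circ> A y0 = id"
      using linear_injective_left_inverse[OF A[OF y0]] by blast
    obtain B where B: "B > 0" "\<And>x. norm (L x) \<le> B * norm x"
      using linear_bounded_pos[OF L(1)] by (metis mult.commute)
    define \<epsilon> where "\<epsilon> y = (\<Sum>b\<in>Basis. norm (A y b - A y0 b))" for y
    \<comment> \<open>Near \<open>y0\<close>, \<open>B * \<epsilon> y \<le> 1 / 2\<close> absorbs
      the unknown increment of \<open>w\<close>; what is left is this continuous majorant, which
      vanishes at \<open>y0\<close>.\<close>
    define g where "g y = 2 * (B * (norm (v y - v y0) + \<epsilon> y * norm (w y0)))" for y
    have cA: "isCont (\<lambda>y. A y b) y0" for b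
      using 0(1)[of b] V y0 by (simp add: continuous_on_eq_continuous_at)
    have cv: "isCont v y0" using 0(2) V y0 by (simp add: continuous_on_eq_continuous_at)
    have c\<epsilon>: "isCont \<epsilon> y0" unfolding \<epsilon>_def by (intro continuous_intros cA)
    have cg: "isCont g y0" unfolding g_def by (intro continuous_intros cv c\<epsilon>)
    have "(g \<longlongrightarrow> 0) (at y0)" using cg unfolding isCont_def by (simp add: g_def \<epsilon>_def)
    moreover have "\<forall>\<^sub>F y in at y0. norm (w y - w y0) \<le> g y"
    proof -
      have "(\<epsilon> \<longlongrightarrow> 0) (at y0)" using c\<epsilon> unfolding isCont_def by (simp add: \<epsilon>_def)
      then have "\<forall>\<^sub>F y in at y0. \<epsilon> y < 1 / (2 * B)" using B by (intro order_tendstoD) auto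
      moreover have "\<forall>\<^sub>F y in at y0. y \<in> V" using V y0 by (intro eventually_at_in_open')
      ultimately show ?thesis
      proof eventually_elim
        case (elim y)
        let ?d = "w y - w y0"
        have lin: "linear (\<lambda>x. A y x - A y0 x)" using A elim y0 by (intro linear_compose_sub)
        have \<epsilon>b: "norm (A y x - A y0 x) \<le> \<epsilon> y * norm x" for x
          using norm_linear_le_sum_Basis[OF lin, of x] by (simp add: \<epsilon>_def)
        have e: "A y0 ?d = (v y - v y0) - (A y ?d - A y0 ?d) - (A y (w y0) - A y0 (w y0))"
          using 0(3)[OF y0] 0(3)[of y] elim y0 A(1) by (simp add: linear_diff)
        have "norm (A y0 ?d) \<le> norm (v y - v y0) + \<epsilon> y * norm ?d + \<epsilon> y * norm (w y0)"
          using norm_triangle_ineq4[of "(v y - v y0) - (A y ?d - A y0 ?d)" "A y (w y0) - A y0 (w y0)"]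
            norm_triangle_ineq4[of "v y - v y0" "A y ?d - A y0 ?d"] \<epsilon>b[of ?d] \<epsilon>b[of "w y0"]
            arg_cong[OF e, of norm] by linarith
        moreover have "?d = L (A y0 ?d)" using L(2) by (metis comp_apply id_apply)
        ultimately have "norm ?d \<le> B * (norm (v y - v y0) + \<epsilon> y * norm ?d + \<epsilon> y * norm (w y0))"
          using B by (metis less_imp_le mult_left_mono order_trans)
        moreover have "B * (\<epsilon> y * norm ?d) \<le> norm ?d / 2"
        proof -
          have "B * \<epsilon> y \<le> 1 / 2" using elim(1) B by (simp add: field_simps)
          from mult_right_mono[OF this, of "norm ?d"] show ?thesis by (simp add: mult.assoc)
        qed
        ultimately show "norm ?d \<le> g y" by (simp add: g_def distrib_left)
      qed
    qed
    ultimately have "((\<lambda>y. w y - w y0) \<longlongrightarrow> 0) (at y0)" by (rule Lim_null_comparison[rotated])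
    then show ?thesis unfolding isCont_def by (simp add: LIM_zero_iff)
  qed
  then show ?case by (simp add: continuous_at_imp_continuous_on)
next
  case (Suc k)
  have Cw: "Ck_on k V w"
    by (rule Suc.IH[OF Ck_on_Suc_imp[OF Suc.prems(1)] Ck_on_Suc_imp[OF Suc.prems(2)] Suc.prems(3)])
  let ?A' = "\<lambda>y b h. frechet_derivative (\<lambda>y. A y b) (at y) h"
  let ?r = "\<lambda>h y. frechet_derivative v (at y) h - (\<Sum>b\<in>Basis. (w y \<bullet> b) *\<^sub>R ?A' y b h)"
  have der: "\<exists>w'. (w has_derivative w') (at y) \<and> (\<forall>h. A y (w' h) = ?r h y)" if y: "y \<in> V" for y
  proof -
    obtain L where L: "linear L" "L \<circ> A y = id"
      using linear_injective_left_inverse[OF A[OF y]] by blast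
    then have AL: "A y (L x) = x" for x
      using linear_injective_imp_surjective[OF A[OF y]] by (metis comp_apply id_apply surjD)
    have cw: "isCont w y" using Ck_on_imp_continuous_on[OF Cw] V y by (simp add: continuous_on_eq_continuous_at)
    text \<open>The factor \<open>A x b - A y b\<close> vanishes at \<open>y\<close>, so continuity of \<open>w\<close> suffices.\<close>
    have prod: "((\<lambda>x. (w x \<bullet> b) *\<^sub>R (A x b - A y b)) has_derivative (\<lambda>h. (w y \<bullet> b) *\<^sub>R ?A' y b h)) (at y)" for b
    proof -
      have "((\<lambda>x. A x b - A y b) has_derivative ?A' y b) (at y)"
        using has_derivative_diff[OF Ck_on_Suc_imp_has_derivative[OF Suc.prems(1) y] has_derivative_const] by simp
      then show ?thesis by (rule has_derivative_scaleR_zero) (auto intro!: continuous_intros cw)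
    qed
    \<comment> \<open>The equation is rewritten with the operator frozen at \<open>y\<close>:
      \<open>A y (w x) = v x - (A x (w x) - A y (w x))\<close>. Applying \<open>L\<close> expresses
      \<open>w\<close> through terms whose derivative at \<open>y\<close> is known.\<close>
    have "((\<lambda>x. L (v x - (\<Sum>b\<in>Basis. (w x \<bullet> b) *\<^sub>R (A x b - A y b)))) has_derivative (\<lambda>h. L (?r h y))) (at y)"
      by (intro bounded_linear.has_derivative[OF L(1)[unfolded linear_conv_bounded_linear]] has_derivative_diff has_derivative_sum prod
          Ck_on_Suc_imp_has_derivative[OF Suc.prems(2) y]) 
    moreover have "L (v x - (\<Sum>b\<in>Basis. (w x \<bullet> b) *\<^sub>R (A x b - A y b))) = w x" if x: "x \<in> V" for x
    proof -
      have "(\<Sum>b\<in>Basis. (w x \<bullet> b) *\<^sub>R (A x b - A y b)) = A x (w x) - A y (w x)"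
        using linear_eq_sum_Basis[OF A(1)[OF x], of "w x"] linear_eq_sum_Basis[OF A(1)[OF y], of "w x"]
        by (simp add: scaleR_diff_right sum_subtractf)
      then have "v x - (\<Sum>b\<in>Basis. (w x \<bullet> b) *\<^sub>R (A x b - A y b)) = A y (w x)"
        using Suc.prems(3)[OF x] by simp
      then show ?thesis using L(2) by (metis comp_apply id_apply)
    qed
    ultimately have "(w has_derivative (\<lambda>h. L (?r h y))) (at y)"
      by (rule has_derivative_transform_within_open[OF _ V y])
    then show ?thesis using AL by blast
  qed
  then have "\<forall>y\<in>V. \<exists>w'. (w has_derivative w') (at y) \<and> (\<forall>h. A y (w' h) = ?r h y)" by blast
  from bchoice[OF this] obtain w' where w': "\<And>y. y \<in> V \<Longrightarrow> (w has_derivative w' y) (at y)"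
    "\<And>y h. y \<in> V \<Longrightarrow> A y (w' y h) = ?r h y" by blast
  show ?case
  proof (rule Ck_on_SucI[OF V w'(1)])
    fix h
    have "Ck_on k V (?r h)"
      using Suc.prems(1,2) by (intro Ck_on_diff Ck_on_sum Ck_on_scaleR Ck_on_inner_const V Cw) auto
    then show "Ck_on k V (\<lambda>y. w' y h)"
      using Suc.IH[OF Ck_on_Suc_imp[OF Suc.prems(1)], of "?r h" "\<lambda>y. w' y h"] w'(2) by blast
  qed
qed

text \<open>The inverse function theorem supplies a differentiable inverse. Its derivative solves a
  linear system whose coefficients are as smooth as the inverse is already known to be, so each pass
  gains one order.\<close>

lemma smooth_local_inverse:
  fixes f :: "'a::euclidean_space \<Rightarrow> 'a"
  assumes U: "open U" "x0 \<in> U" and f: "\<And>k. Ck_on k U f"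
    and inj: "inj (frechet_derivative f (at x0))"
  obtains U' V g where "open U'" "U' \<subseteq> U" "x0 \<in> U'" "open V" "f x0 \<in> V" "homeomorphism U' V f g"
    "\<And>k. Ck_on k V g"
proof -
  let ?D = "\<lambda>x. frechet_derivative f (at x)"
  define f' where "f' x = Blinfun (?D x)" for x
  have der: "(f has_derivative ?D x) (at x)" if "x \<in> U" for x
    using Ck_on_Suc_imp_has_derivative[OF f that] .
  have f'[simp]: "blinfun_apply (f' x) = ?D x" if "x \<in> U" for x
    unfolding f'_def using has_derivative_bounded_linear[OF der[OF that]] by (rule bounded_linear_Blinfun_apply)
  have cont: "continuous_on U f'"
  proof (rule continuous_on_blinfun_componentwise)
    fix i :: 'a
    have "continuous_on U (\<lambda>x. ?D x i)" using f[of "Suc 0"] by simp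
    then show "continuous_on U (\<lambda>x. blinfun_apply (f' x) i)" by (simp cong: continuous_on_cong)
  qed
  have lin: "linear (?D x)" if "x \<in> U" for x using has_derivative_linear[OF der[OF that]] .
  obtain L where L: "linear L" "L \<circ> ?D x0 = id"
    using linear_injective_left_inverse[OF lin[OF U(2)] inj] by blast
  have "Blinfun L o\<^sub>L f' x0 = id_blinfun"
    using L U(2) by (intro blinfun_eqI) (simp add: bounded_linear_Blinfun_apply linear_linear[symmetric] o_def fun_eq_iff)
  from inverse_function_theorem[OF U(1) _ cont U(2) this]
  obtain U' V g g' where inv: "open U'" "U' \<subseteq> U" "x0 \<in> U'" "open V" "f x0 \<in> V" "homeomorphism U' V f g"
    and g': "\<And>y. y \<in> V \<Longrightarrow> (g has_derivative (g' y)) (at y)"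
     "\<And>y. y \<in> V \<Longrightarrow> g' y = inv (blinfun_apply (f'(g y)))"
     "\<And>y. y \<in> V \<Longrightarrow> bij (blinfun_apply (f'(g y)))"
    using der by (metis f')
  have gU: "g y \<in> U" if "y \<in> V" for y
    using inv(2,6) that unfolding homeomorphism_def by blast
  have "Ck_on k V g" for k
  proof (induction k)
    case 0
    show ?case using inv(6) unfolding homeomorphism_def by simp
  next
    case (Suc k)
    show ?case
    proof (rule Ck_on_SucI[OF inv(4) g'(1)])
      fix h
      show "Ck_on k V (\<lambda>y. g' y h)"
      proof (rule Ck_on_solve_linear[OF inv(4), where A = "\<lambda>y. ?D (g y)" and v = "\<lambda>y. h"])
        show "Ck_on k V (\<lambda>y. ?D (g y) b)" for b
          by (rule Ck_on_compose[OF inv(4) Suc, where V = U]) (use f[of "Suc k"] gU in auto)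
        show "?D (g y) (g' y h) = h" if "y \<in> V" for y
          using g'(2,3)[OF that] gU[OF that] by (simp add: bij_is_surj surj_f_inv_f)
        show "inj (?D (g y))" if "y \<in> V" for y
          using g'(3)[OF that] gU[OF that] by (simp add: bij_is_inj)
      qed (use lin gU inv(4) in \<open>auto intro: Ck_on_const\<close>)
    qed
  qed
  then show thesis using that inv by blast
qed

lemma smooth_on_openI:
  assumes "open U" "\<And>k. Ck_on k U f" "S \<subseteq> U" "\<And>x. x \<in> S \<Longrightarrow> g x = f x"
  shows "smooth_on S g"
  unfolding smooth_on_def using assms by (intro ballI exI[of _ U] exI[of _ f]) auto

text \<open>A local inverse of \<open>G\<close> is defined on a full neighborhood and thus serves as
  a smooth extension, even if \<open>S\<close> is not open. It could pick another preimage than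
  \<open>inv_into S f\<close> does; continuity of the global inverse \<open>Y\<close> on the image
  of the compact set \<open>\<omega>\<close> excludes this close to \<open>b\<close>.\<close>

lemma restriction_smooth_diffeomorphism:
  fixes G f :: "'a::euclidean_space \<Rightarrow> 'a"
  assumes U: "open U" and G: "\<And>k. Ck_on k U G"
    and \<omega>: "compact \<omega>" "\<omega> \<subseteq> U" "inj_on G \<omega>" and S: "S \<subseteq> \<omega>"
    and inj: "\<And>p. p \<in> S \<Longrightarrow> inj (frechet_derivative G (at p))"
    and f: "\<And>p. p \<in> \<omega> \<Longrightarrow> f p = G p"
  shows "smooth_diffeomorphism S (f ` S) f \<and> (\<exists>Y. homeomorphism \<omega> (f ` \<omega>) f Y)"
proof -
  have injf: "inj_on f \<omega>" using \<omega>(3) f by (simp add: inj_on_def)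
  have "continuous_on \<omega> G" using continuous_on_subset[OF _ \<omega>(2)] G[of 0] by simp
  then have "continuous_on \<omega> f" using f by (simp cong: continuous_on_cong)
  then obtain Y where Y: "homeomorphism \<omega> (f ` \<omega>) f Y"
    using homeomorphism_compact[OF \<omega>(1) _ refl injf] by blast
  have Yf: "Y (f a) = a" if "a \<in> \<omega>" for a using Y that by (simp add: homeomorphism_apply1)
  have "smooth_on (f ` S) (inv_into S f)"
    unfolding smooth_on_def
  proof
    fix b assume "b \<in> f ` S"
    then obtain a where a: "a \<in> S" "b = f a" by auto
    have aU: "a \<in> U" using a S \<omega> by auto
    obtain U' V g where inv: "open U'" "U' \<subseteq> U" "a \<in> U'" "open V" "G a \<in> V" "homeomorphism U' V G g"
        "\<And>k. Ck_on k V g"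
      using smooth_local_inverse[OF U aU G inj[OF a(1)]] by blast
    have "openin (top_of_set (f ` \<omega>)) (f ` \<omega> \<inter> Y -` U')"
      using Y inv(1) by (intro continuous_openin_preimage_gen) (auto simp: homeomorphism_def)
    then obtain W0 where W0: "open W0" "f ` \<omega> \<inter> Y -` U' = f ` \<omega> \<inter> W0"
      unfolding openin_open by auto
    have "b \<in> f ` \<omega> \<inter> Y -` U'" using a S inv(3) Yf by auto
    then have "b \<in> V \<inter> W0" using W0 inv(5) a S f by auto
    moreover have "g x = inv_into S f x" if "x \<in> f ` S \<inter> (V \<inter> W0)" for x
    proof -
      obtain a' where a': "a' \<in> S" "x = f a'" using \<open>x \<in> _\<close> by auto
      have "x \<in> f ` \<omega> \<inter> Y -` U'" using that a' S W0(2) by auto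
      then have "Y x \<in> U'" by blast
      then have "a' \<in> U'" using a' S Yf by auto
      then have "g x = a'" using inv(6) a' f S by (auto simp: homeomorphism_apply1)
      then show ?thesis using a' inj_on_subset[OF injf S] by simp
    qed
    ultimately show "\<exists>W g. open W \<and> b \<in> W \<and> (\<forall>k. Ck_on k W g) \<and> (\<forall>x\<in>f ` S \<inter> W. g x = inv_into S f x)"
      using inv(4,7) W0(1) Ck_on_subset[OF inv(7), of "V \<inter> W0"]
      by (intro exI[of _ "V \<inter> W0"] exI[of _ g]) auto
  qed
  moreover have "smooth_on S f"
    by (rule smooth_on_openI[OF U G]) (use S \<omega>(2) f in auto)
  moreover have "bij_betw f S (f ` S)"
    using inj_on_subset[OF injf S] by (simp add: bij_betw_def)
  ultimately show ?thesis using Y unfolding smooth_diffeomorphism_def by blast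
qed

section \<open>Maps of fold type on the wedge\<close>

text \<open>Isolates what the argument needs of the flow: values at \<open>s = 0\<close>, the
  relation between \<open>x\<close> and \<open>l\<close>, and first-order data at the origin. Second
  order is asked of \<open>x\<close> because its derivative in \<open>y\<close>, zero at
  \<open>s = 0\<close>, is recovered from its own derivative in \<open>s\<close>.\<close>

lemma fold_local_injectivity:
  fixes x l :: "real \<times> (real^'n::finite) \<Rightarrow> real" and z :: "real \<times> (real^'n) \<Rightarrow> real^'n"
  assumes U: "open U" "(0, 0) \<in> U"
    and smooth: "Ck_on 2 U x" "Ck_on 1 U z" "Ck_on 1 U l"
    and start: "\<And>y. (0, y) \<in> U \<Longrightarrow> x (0, y) = 0" "\<And>y. (0, y) \<in> U \<Longrightarrow> z (0, y) = y"
      "\<And>y. (0, y) \<in> U \<Longrightarrow> l (0, y) = - (y $ k)"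
    and dx: "\<And>p. p \<in> U \<Longrightarrow> frechet_derivative x (at p) (1, 0) = 2 * l p"
    and dl: "frechet_derivative l (at (0, 0)) (1, 0) = a" "a > 0"
    and dz: "frechet_derivative z (at (0, 0)) (1, 0) = c" "c $ k = a"
  obtains \<epsilon> where "\<epsilon> > 0" "ball (0, 0) \<epsilon> \<subseteq> U" "inj_on (\<lambda>p. (x p, z p)) (ball (0, 0) \<epsilon> \<inter> param_wedge k)"
    "\<And>p. p \<in> ball (0, 0) \<epsilon> \<inter> param_wedge k \<Longrightarrow> snd p $ k < 0 \<Longrightarrow>
       inj (frechet_derivative (\<lambda>p. (x p, z p)) (at p))"
proof -
  let ?Dx = "\<lambda>p. frechet_derivative x (at p)"
  let ?Dz = "\<lambda>p. frechet_derivative z (at p)"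
  let ?Dl = "\<lambda>p. frechet_derivative l (at p)"
  have hdx: "(x has_derivative ?Dx p) (at p)" if "p \<in> U" for p
    by (rule Ck_on_Suc_imp_has_derivative[OF smooth(1)[unfolded numeral_2_eq_2] that])
  have hdz: "(z has_derivative ?Dz p) (at p)" if "p \<in> U" for p
    by (rule Ck_on_Suc_imp_has_derivative[OF smooth(2)[unfolded One_nat_def] that])
  have hdl: "(l has_derivative ?Dl p) (at p)" if "p \<in> U" for p
    by (rule Ck_on_Suc_imp_has_derivative[OF smooth(3)[unfolded One_nat_def] that])
  have lin: "linear (?Dx p)" "linear (?Dz p)" "linear (?Dl p)" if "p \<in> U" for p
    using hdx[OF that] hdz[OF that] hdl[OF that] has_derivative_linear by blast+
  \<comment> \<open>At \<open>s = 0\<close> the derivatives in \<open>y\<close> are those of the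
    prescribed initial values.\<close>
  have slice: "frechet_derivative f (at (0, y)) (0, v) = g' v"
    if y: "(0, y) \<in> U" and f: "(f has_derivative frechet_derivative f (at (0, y))) (at (0, y))"
      and eq: "\<And>y. (0, y) \<in> U \<Longrightarrow> f (0, y) = g y" and g: "(g has_derivative g') (at y)"
    for f :: "real \<times> (real^'n) \<Rightarrow> 'b::euclidean_space" and g g' y v
  proof -
    have "((\<lambda>y. f (0, y)) has_derivative (\<lambda>v. frechet_derivative f (at (0, y)) (0, v))) (at y)"
      by (rule has_derivative_compose[where f = "\<lambda>y. (0, y)" and g = f, OF _ f]) (auto intro!: derivative_eq_intros)
    moreover have "open ((\<lambda>y. (0, y)) -` U)"
      by (intro open_vimage U continuous_intros)
    ultimately have "(g has_derivative (\<lambda>v. frechet_derivative f (at (0, y)) (0, v))) (at y)"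
      by (rule has_derivative_transform_within_open) (use y eq in auto)
    then show ?thesis using has_derivative_unique[OF _ g] by metis
  qed
  have Dx0: "?Dx (0, y) (0, v) = 0" if "(0, y) \<in> U" for y v
    by (rule slice[OF that hdx[OF that] start(1)]) auto
  have Dz0: "?Dz (0, 0) (0, v) = v" for v
    by (rule slice[OF U(2) hdz[OF U(2)] start(2)]) auto
  have Dl0: "?Dl (0, 0) (0, v) = - (v $ k)" for v
    by (rule slice[OF U(2) hdl[OF U(2)] start(3)])
      (auto intro!: bounded_linear_imp_has_derivative bounded_linear_minus bounded_linear_vec_nth)
  \<comment> \<open>On the cone
    \<open>norm (\<sigma> *\<^sub>R c + v) \<le> \<delta> * \<sigma>\<close> one has
    \<open>norm v \<le> N * \<sigma>\<close>. With these values the quantity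
    \<open>2 * a - \<delta> - \<eta> * (1 + N)\<close> in \<open>pos\<close> is at least
    \<open>a\<close>. The two parts of \<open>\<kappa>\<close> serve the absorption in
    \<open>cone\<close> and the opening \<open>\<delta>\<close>.\<close>
  define N where "N = 2 + norm c"
  define \<delta> where "\<delta> = min 1 (a / 2)"
  define \<eta> where "\<eta> = a / (2 * (1 + N))"
  define \<kappa> where "\<kappa> = min (1 / 2) (\<delta> / (2 * (1 + norm c)))"
  have N: "N \<ge> 2" by (simp add: N_def)
  have \<delta>: "\<delta> > 0" "\<delta> \<le> 1" "\<delta> \<le> a / 2" using dl by (auto simp: \<delta>_def)
  have \<eta>: "\<eta> > 0" "\<eta> * (1 + N) = a / 2" using dl N by (auto simp: \<eta>_def field_simps)
  have c1: "0 < 1 + norm c" by (simp add: add_pos_nonneg)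
  have \<kappa>: "\<kappa> > 0" "\<kappa> \<le> 1 / 2" "\<kappa> * (2 * (1 + norm c)) \<le> \<delta>"
  proof -
    have "\<kappa> \<le> \<delta> / (2 * (1 + norm c))" unfolding \<kappa>_def by (rule min.cobounded2)
    then show "\<kappa> * (2 * (1 + norm c)) \<le> \<delta>" using c1 by (simp only: pos_le_divide_eq mult_pos_pos zero_less_numeral)
    show "\<kappa> \<le> 1 / 2" unfolding \<kappa>_def by (rule min.cobounded1)
    show "\<kappa> > 0" using \<delta>(1) c1 unfolding \<kappa>_def by simp
  qed
  obtain e1 where e1: "e1 > 0" "\<And>p. p \<in> ball (0, 0) e1 \<Longrightarrow> p \<in> U \<and> (\<forall>v. norm (?Dl p v - ?Dl (0, 0) v) \<le> \<eta> * norm v)"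
    using Ck_on_1_derivative_near[OF U(1) smooth(3)[unfolded One_nat_def] U(2) \<eta>(1)] by blast
  obtain e2 where e2: "e2 > 0" "\<And>p. p \<in> ball (0, 0) e2 \<Longrightarrow> p \<in> U \<and> (\<forall>v. norm (?Dz p v - ?Dz (0, 0) v) \<le> \<kappa> * norm v)"
    using Ck_on_1_derivative_near[OF U(1) smooth(2)[unfolded One_nat_def] U(2) \<kappa>(1)] by blast
  define \<epsilon> where "\<epsilon> = min e1 e2"
  let ?B = "ball (0::real, 0::real^'n) \<epsilon>"
  have \<epsilon>: "\<epsilon> > 0" using e1 e2 by (simp add: \<epsilon>_def)
  have BU: "p \<in> U" and near_l: "norm (?Dl p v - ?Dl (0, 0) v) \<le> \<eta> * norm v"
    and near_z: "norm (?Dz p v - ?Dz (0, 0) v) \<le> \<kappa> * norm v" if "p \<in> ?B" for p v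
    using e1(2)[of p] e2(2)[of p] that unfolding \<epsilon>_def by (simp_all del: split_paired_All)
  have seg: "(t, y) \<in> ?B" if "(s, y) \<in> ?B" "0 \<le> t" "t \<le> s" for s t y
  proof -
    have "norm (t, y) \<le> norm (s, y)"
      using that unfolding norm_Pair by (intro real_sqrt_le_mono add_right_mono power_mono) auto
    then show ?thesis using that(1) unfolding zero_prod_def[symmetric] mem_ball_0 by linarith
  qed
  have Dz00: "?Dz (0, 0) h = fst h *\<^sub>R c + snd h" for h
    using linear_add[OF lin(2)[OF U(2)], of "fst h *\<^sub>R (1, 0)" "(0, snd h)"]
      linear_cmul[OF lin(2)[OF U(2)], of "fst h" "(1, 0)"] Dz0 dz by simp
  have pair: "((\<lambda>t::real. (t, y::real^'n)) has_derivative (\<lambda>c. (c, 0))) (at t)" for y t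
    by (intro has_derivative_Pair has_derivative_ident has_derivative_const)
  \<comment> \<open>The derivative of \<open>x\<close> in \<open>y\<close> vanishes at
    \<open>s = 0\<close>, and by symmetry its derivative in \<open>s\<close> is the derivative of
    \<open>2 * l\<close> in \<open>y\<close>; the mean value theorem in \<open>s\<close> then
    exhibits the factor \<open>s\<close>.\<close>
  have mixed: "\<exists>t. 0 < t \<and> t < s \<and> ?Dx (s, y) (0, v) = 2 * s * ?Dl (t, y) (0, v)"
    if sy: "(s, y) \<in> ?B" and s: "0 < s" for s y v
  proof -
    have tU: "(t, y) \<in> U" if "0 \<le> t" "t \<le> s" for t using seg[OF sy that] BU by blast
    have der: "((\<lambda>t. ?Dx (t, y) (0, v)) has_derivative (\<lambda>c. c * (2 * ?Dl (t, y) (0, v)))) (at t)"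
      if "0 \<le> t" "t \<le> s" for t
    proof -
      let ?g = "\<lambda>p. ?Dx p (0, v)"
      have "(?g has_derivative frechet_derivative ?g (at (t, y))) (at (t, y))"
        using smooth(1)[unfolded numeral_2_eq_2] tU[OF that]
        by (intro Ck_on_Suc_imp_has_derivative[of 0 U]) (auto simp del: split_paired_All)
      from has_derivative_compose[OF pair this]
      have hd: "((\<lambda>t. ?Dx (t, y) (0, v)) has_derivative (\<lambda>c. frechet_derivative ?g (at (t, y)) (c, 0))) (at t)" .
      have 1: "frechet_derivative ?g (at (t, y)) (1, 0) = 2 * ?Dl (t, y) (0, v)"
      proof -
        have "frechet_derivative ?g (at (t, y)) (1, 0) = frechet_derivative (\<lambda>p. ?Dx p (1, 0)) (at (t, y)) (0, v)"
          by (rule Ck_on_2_second_derivative_symmetric[OF U(1) smooth(1)[unfolded numeral_2_eq_2] tU[OF that]])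
        moreover have "((\<lambda>p. ?Dx p (1, 0)) has_derivative (\<lambda>h. 2 * ?Dl (t, y) h)) (at (t, y))"
        proof (rule has_derivative_transform_within_open[OF _ U(1) tU[OF that]])
          show "((\<lambda>p. 2 * l p) has_derivative (\<lambda>h. 2 * ?Dl (t, y) h)) (at (t, y))"
            by (intro has_derivative_mult_right hdl tU that)
        qed (simp add: dx)
        ultimately show ?thesis using frechet_derivative_eq by metis
      qed
      have "frechet_derivative ?g (at (t, y)) (c, 0) = c * (2 * ?Dl (t, y) (0, v))" for c
      proof -
        have "linear (frechet_derivative ?g (at (t, y)))"
          using \<open>(?g has_derivative _) _\<close> by (rule has_derivative_linear)
        from linear_cmul[OF this, of c "(1, 0)"] show ?thesis unfolding 1 by simp
      qed
      with hd show ?thesis by (simp only:)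
    qed
    have "\<exists>t\<in>{0<..<s}. ?Dx (s, y) (0, v) - ?Dx (0, y) (0, v) = (\<lambda>c. c * (2 * ?Dl (t, y) (0, v))) (s - 0)"
      by (rule mvt_simple[OF s, of "\<lambda>t. ?Dx (t, y) (0, v)" "\<lambda>t c. c * (2 * ?Dl (t, y) (0, v))"])
        (rule has_derivative_at_withinI[OF der])
    then obtain t where "0 < t" "t < s" "?Dx (s, y) (0, v) = s * (2 * ?Dl (t, y) (0, v))"
      using Dx0[of y v] tU[of 0] s by auto
    then show ?thesis by (intro exI[of _ t]) simp
  qed
  have lexp: "\<exists>t. 0 < t \<and> t < s \<and> l (s, y) = - (y $ k) + s * ?Dl (t, y) (1, 0)"
    if sy: "(s, y) \<in> ?B" and s: "0 < s" for s y
  proof -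
    have tU: "(t, y) \<in> U" if "0 \<le> t" "t \<le> s" for t using seg[OF sy that] BU by blast
    have der: "((\<lambda>t. l (t, y)) has_derivative (\<lambda>c. c * ?Dl (t, y) (1, 0))) (at t)"
      if "0 \<le> t" "t \<le> s" for t
    proof -
      from has_derivative_compose[OF pair hdl[OF tU[OF that]]]
      have "((\<lambda>t. l (t, y)) has_derivative (\<lambda>c. ?Dl (t, y) (c, 0))) (at t)" .
      moreover have "(\<lambda>c. ?Dl (t, y) (c, 0)) = (\<lambda>c. c * ?Dl (t, y) (1, 0))"
      proof
        show "?Dl (t, y) (c, 0) = c * ?Dl (t, y) (1, 0)" for c
          using linear_cmul[OF lin(3)[OF tU[OF that]], of c "(1, 0)"] by simp
      qed
      ultimately show ?thesis by (simp only:)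
    qed
    have "\<exists>t\<in>{0<..<s}. l (s, y) - l (0, y) = (\<lambda>c. c * ?Dl (t, y) (1, 0)) (s - 0)"
      by (rule mvt_simple[OF s, of "\<lambda>t. l (t, y)" "\<lambda>t c. c * ?Dl (t, y) (1, 0)"])
        (rule has_derivative_at_withinI[OF der])
    then obtain t where "0 < t" "t < s" "l (s, y) = - (y $ k) + s * ?Dl (t, y) (1, 0)"
      using start(3)[of y] tU[of 0] s by auto
    then show ?thesis by blast
  qed
  \<comment> \<open>Covers all base points of the wedge off its edge within the ball, so that it
    serves both the mean value argument for injectivity and the invertibility of the
    differential.\<close>
  have pos: "?Dx p h > 0"
    if p: "p \<in> ?B" "0 \<le> fst p" "snd p $ k \<le> 0" "0 < fst p \<or> snd p $ k < 0"
      and h: "0 < fst h" "norm (fst h *\<^sub>R c + snd h) \<le> \<delta> * fst h" for p h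
  proof -
    obtain s y where sy: "p = (s, y)" by (cases p)
    obtain \<sigma> v where \<sigma>v: "h = (\<sigma>, v)" by (cases h)
    have s: "0 \<le> s" "y $ k \<le> 0" "0 < s \<or> y $ k < 0" and B: "(s, y) \<in> ?B" using p sy by auto
    have \<sigma>: "0 < \<sigma>" and near: "norm (\<sigma> *\<^sub>R c + v) \<le> \<delta> * \<sigma>" using h \<sigma>v by auto
    have split: "?Dx p h = 2 * \<sigma> * l (s, y) + ?Dx (s, y) (0, v)"
      using linear_add[OF lin(1)[OF BU[OF B]], of "\<sigma> *\<^sub>R (1, 0)" "(0, v)"]
        linear_cmul[OF lin(1)[OF BU[OF B]], of \<sigma> "(1, 0)"] dx[OF BU[OF B]] by (simp add: sy \<sigma>v)
    show ?thesis
    \<comment> \<open>At \<open>s = 0\<close> only the term \<open>2 * \<sigma> * l (s, y)\<close>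
      is left, which is positive because \<open>y $ k < 0\<close> off the edge.\<close>
    proof (cases "s = 0")
      case True
      then show ?thesis
        using split start(3)[of y] Dx0[of y v] BU[OF B] s \<sigma> by (simp add: mult_pos_neg)
    next
      case False
      then have s0: "0 < s" using s by simp
      obtain t where t: "0 < t" "t < s" "?Dx (s, y) (0, v) = 2 * s * ?Dl (t, y) (0, v)"
        using mixed[OF B s0] by blast
      obtain t' where t': "0 < t'" "t' < s" "l (s, y) = - (y $ k) + s * ?Dl (t', y) (1, 0)"
        using lexp[OF B s0] by blast
      have "\<bar>?Dl (t, y) (0, v) - ?Dl (0, 0) (0, v)\<bar> \<le> \<eta> * norm (0::real, v)"
        using near_l[OF seg[OF B, of t], of "(0, v)"] t by simp
      then have 1: "?Dl (t, y) (0, v) \<ge> - (v $ k) - \<eta> * norm v"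
        using Dl0[of v] by (simp add: norm_Pair)
      have "\<bar>?Dl (t', y) (1, 0) - ?Dl (0, 0) (1, 0)\<bar> \<le> \<eta> * norm (1::real, 0::real^'n)"
        using near_l[OF seg[OF B, of t'], of "(1, 0)"] t' by simp
      then have 2: "?Dl (t', y) (1, 0) \<ge> a - \<eta>" using dl by (simp add: norm_Pair)
      have "norm v \<le> norm (\<sigma> *\<^sub>R c + v) + norm (\<sigma> *\<^sub>R c)"
        using norm_triangle_ineq4[of "\<sigma> *\<^sub>R c + v" "\<sigma> *\<^sub>R c"] by simp
      also have "\<dots> \<le> \<delta> * \<sigma> + \<sigma> * norm c" using near \<sigma> by simp
      also have "\<dots> \<le> N * \<sigma>" using \<delta>(2) \<sigma> by (simp add: N_def algebra_simps)
      finally have 3: "\<eta> * norm v \<le> \<eta> * (N * \<sigma>)" using \<eta> by simp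
      have "(\<sigma> *\<^sub>R c + v) $ k \<le> \<delta> * \<sigma>"
        using near component_le_norm_cart[of "\<sigma> *\<^sub>R c + v" k] by linarith
      then have 4: "v $ k \<le> \<delta> * \<sigma> - a * \<sigma>" using dz(2) by (simp add: algebra_simps)
      have "\<sigma> * ?Dl (t', y) (1, 0) + ?Dl (t, y) (0, v) \<ge> \<sigma> * (a - \<eta>) + (a * \<sigma> - \<delta> * \<sigma> - \<eta> * (N * \<sigma>))"
        using 1 3 4 mult_left_mono[OF 2, of \<sigma>] \<sigma> by linarith
      also have "\<sigma> * (a - \<eta>) + (a * \<sigma> - \<delta> * \<sigma> - \<eta> * (N * \<sigma>)) = \<sigma> * (2 * a - \<delta> - \<eta> * (1 + N))"
        by (simp add: algebra_simps)
      finally have "\<sigma> * (2 * a - \<delta> - \<eta> * (1 + N)) \<le> \<sigma> * ?Dl (t', y) (1, 0) + ?Dl (t, y) (0, v)" .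
      moreover have "\<sigma> * (2 * a - \<delta> - \<eta> * (1 + N)) > 0"
        unfolding \<eta>(2) using \<sigma> \<delta>(3) dl(2) by simp
      ultimately have "0 < s * (\<sigma> * ?Dl (t', y) (1, 0) + ?Dl (t, y) (0, v))" using s0 by simp
      moreover have "0 \<le> \<sigma> * (- (y $ k))" using \<sigma> s by (intro mult_nonneg_nonneg) auto
      ultimately show ?thesis
        unfolding split t(3) t'(3) by (simp add: algebra_simps)
    qed
  qed
  \<comment> \<open>A direction that nearly preserves \<open>z\<close> has \<open>snd h\<close>
    close to \<open>- fst h *\<^sub>R c\<close>, so its whole length is controlled by the time
    component.\<close>
  have cone: "norm (fst h *\<^sub>R c + snd h) \<le> \<delta> * \<bar>fst h\<bar> \<and> (fst h = 0 \<longrightarrow> h = 0)"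
    if "norm (fst h *\<^sub>R c + snd h) \<le> \<kappa> * norm h" for h :: "real \<times> (real^'n)"
  proof -
    have "norm h \<le> \<bar>fst h\<bar> + norm (snd h)"
      using sqrt_sum_squares_le_sum_abs[of "norm (fst h)" "norm (snd h)"] by (simp add: norm_prod_def)
    moreover have "norm (snd h) \<le> norm (fst h *\<^sub>R c + snd h) + \<bar>fst h\<bar> * norm c"
      using norm_triangle_ineq4[of "fst h *\<^sub>R c + snd h" "fst h *\<^sub>R c"] by simp
    moreover have "norm (fst h *\<^sub>R c + snd h) \<le> 1 / 2 * norm h"
      using that mult_right_mono[OF \<kappa>(2) norm_ge_zero, of h] by linarith
    ultimately have 1: "norm h \<le> 2 * (1 + norm c) * \<bar>fst h\<bar>" by (simp add: algebra_simps)
    have "\<kappa> * norm h \<le> \<kappa> * (2 * (1 + norm c)) * \<bar>fst h\<bar>"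
      using mult_left_mono[OF 1, of \<kappa>] \<kappa>(1) by (simp add: mult.assoc)
    also have "\<dots> \<le> \<delta> * \<bar>fst h\<bar>" by (intro mult_right_mono \<kappa>) simp
    finally show ?thesis using that 1 by auto
  qed
  \<comment> \<open>Finite differences of \<open>z\<close> are compared with its derivative at the
    origin, so that \<open>z p = z p'\<close> puts \<open>p' - p\<close> into the cone.\<close>
  have zdiff: "norm (z p' - z p - (fst (p' - p) *\<^sub>R c + snd (p' - p))) \<le> \<kappa> * norm (p' - p)"
    if "p \<in> ?B" "p' \<in> ?B" for p p'
  proof -
    let ?g = "\<lambda>p. z p - ?Dz (0, 0) p"
    have "norm (?g p' - ?g p) \<le> \<kappa> * norm (p' - p)"
    proof (rule differentiable_bound[of ?B ?g "\<lambda>p v. ?Dz p v - ?Dz (0, 0) v"])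
      show "(?g has_derivative (\<lambda>v. ?Dz q v - ?Dz (0, 0) v)) (at q within ?B)" if "q \<in> ?B" for q
        by (intro has_derivative_diff has_derivative_at_withinI[OF hdz[OF BU[OF that]]]
            linear_imp_has_derivative lin U)
      show "onorm (\<lambda>v. ?Dz q v - ?Dz (0, 0) v) \<le> \<kappa>" if "q \<in> ?B" for q
        by (intro onorm_le near_z that)
    qed (use that in auto)
    moreover have "?g p' - ?g p = z p' - z p - ?Dz (0, 0) (p' - p)"
      using linear_diff[OF lin(2)[OF U(2)], of p' p] by simp
    ultimately show ?thesis unfolding Dz00 by simp
  qed
  have no_later: False
    if p: "p \<in> ?B \<inter> param_wedge k" and p': "p' \<in> ?B \<inter> param_wedge k"
      and eq: "x p = x p'" "z p = z p'" and less: "fst p < fst p'" for p p'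
  proof -
    define h where "h = p' - p"
    have "norm (fst h *\<^sub>R c + snd h) \<le> \<kappa> * norm h"
      using zdiff[of p p'] p p' unfolding h_def eq(2) diff_self diff_0 norm_minus_cancel by blast
    from cone[OF this] have h: "0 < fst h" "norm (fst h *\<^sub>R c + snd h) \<le> \<delta> * fst h"
      using less by (auto simp: h_def)
    have inB: "p + t *\<^sub>R h \<in> ?B" if "0 \<le> t" "t \<le> 1" for t
    proof -
      have "(1 - t) *\<^sub>R p + t *\<^sub>R p' \<in> ?B"
        using convexD[OF convex_ball, of p _ \<epsilon> p' "1 - t" t] p p' that by auto
      then show ?thesis by (simp add: h_def algebra_simps)
    qed
    have "\<exists>t\<in>{0<..<1}. x (p + 1 *\<^sub>R h) - x (p + 0 *\<^sub>R h) = (\<lambda>c. c * ?Dx (p + t *\<^sub>R h) h) (1 - 0)"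
    proof (rule mvt_simple)
      fix t :: real assume t: "0 \<le> t" "t \<le> 1"
      have "((\<lambda>t. x (p + t *\<^sub>R h)) has_derivative (\<lambda>c. ?Dx (p + t *\<^sub>R h) (c *\<^sub>R h))) (at t within {0..1})"
        by (rule has_derivative_compose[where f = "\<lambda>t. p + t *\<^sub>R h" and g = x and x = t, OF _ hdx[OF BU[OF inB[OF t]]]])
          (auto intro!: derivative_eq_intros)
      then show "((\<lambda>t. x (p + t *\<^sub>R h)) has_derivative (\<lambda>c. c * ?Dx (p + t *\<^sub>R h) h)) (at t within {0..1})"
        using linear_cmul[OF lin(1)[OF BU[OF inB[OF t]]]] by simp
    qed simp
    then obtain t where t: "0 < t" "t < 1" "?Dx (p + t *\<^sub>R h) h = 0"
      using eq by (auto simp: h_def)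
    \<comment> \<open>For \<open>t > 0\<close> the point has positive time even when
      \<open>p\<close> lies on the edge, and by convexity the segment stays in the wedge.\<close>
    have "?Dx (p + t *\<^sub>R h) h > 0"
    proof (rule pos[OF inB _ _ _ h])
      have w: "0 \<le> fst p" "snd p $ k \<le> 0" "snd p' $ k \<le> 0" using p p' by (auto simp: param_wedge_def)
      then show "0 \<le> fst (p + t *\<^sub>R h)" "0 < fst (p + t *\<^sub>R h) \<or> snd (p + t *\<^sub>R h) $ k < 0"
        using mult_pos_pos[OF t(1) h(1)] by auto
      have "snd (p + t *\<^sub>R h) $ k = (1 - t) * (snd p $ k) + t * (snd p' $ k)"
        by (simp add: h_def algebra_simps)
      also have "\<dots> \<le> 0" using w t by (intro add_nonpos_nonpos mult_nonneg_nonpos) auto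
      finally show "snd (p + t *\<^sub>R h) $ k \<le> 0" .
    qed (use t in auto)
    then show False using t by simp
  qed
  show thesis
  proof (rule that[OF \<epsilon>])
    show "?B \<subseteq> U" using BU by blast
    show "inj_on (\<lambda>p. (x p, z p)) (?B \<inter> param_wedge k)"
    proof (rule inj_onI)
      fix p p' assume p: "p \<in> ?B \<inter> param_wedge k" "p' \<in> ?B \<inter> param_wedge k" and "(x p, z p) = (x p', z p')"
      then have eq: "x p = x p'" "z p = z p'" by auto
      \<comment> \<open>\<open>no_later\<close> in both orders leaves equal times, and then the cone
        contains only 0.\<close>
      have "fst p = fst p'" using no_later[OF p eq] no_later[OF p(2,1) eq[symmetric]] by (cases "fst p" "fst p'" rule: linorder_cases) auto
      moreover have "norm (fst (p' - p) *\<^sub>R c + snd (p' - p)) \<le> \<kappa> * norm (p' - p)"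
        using zdiff[of p p'] p unfolding eq(2) diff_self diff_0 norm_minus_cancel by blast
      ultimately have "p' - p = 0" using cone[of "p' - p"] by simp
      then show "p = p'" by simp
    qed
    fix p assume p: "p \<in> ?B \<inter> param_wedge k" "snd p $ k < 0"
    then have pB: "p \<in> ?B" by simp
    have D: "frechet_derivative (\<lambda>p. (x p, z p)) (at p) = (\<lambda>h. (?Dx p h, ?Dz p h))"
      by (intro frechet_derivative_eq has_derivative_Pair hdx hdz BU pB)
    have "h = 0" if h: "?Dx p h = 0" "?Dz p h = 0" for h
    proof -
      have "norm (fst h *\<^sub>R c + snd h) \<le> \<kappa> * norm h"
        using near_z[OF pB, of h] unfolding Dz00 h(2) diff_0 norm_minus_cancel .
      from cone[OF this] have c: "norm (fst h *\<^sub>R c + snd h) \<le> \<delta> * \<bar>fst h\<bar>" "fst h = 0 \<longrightarrow> h = 0" by auto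
      have w: "0 \<le> fst p" "snd p $ k \<le> 0" using p by (auto simp: param_wedge_def)
      have "\<not> fst h > 0" using pos[OF pB w, of h] p(2) c(1) h(1) by auto
      \<comment> \<open>The cone is symmetric but positivity is not, so a negative time component is
        treated through \<open>- h\<close>.\<close>
      moreover have "\<not> fst h < 0"
      proof
        assume "fst h < 0"
        moreover have "norm (fst (- h) *\<^sub>R c + snd (- h)) = norm (fst h *\<^sub>R c + snd h)"
          using norm_minus_cancel[of "fst h *\<^sub>R c + snd h"] by simp
        ultimately have "?Dx p (- h) > 0" using pos[OF pB w, of "- h"] p(2) c(1) by auto
        then show False using linear_neg[OF lin(1)[OF BU[OF pB]], of h] h(1) by simp
      qed
      ultimately show ?thesis using c(2) by linarith
    qed
    moreover have "linear (\<lambda>h. (?Dx p h, ?Dz p h))"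
      using lin[OF BU[OF pB]] by (intro linearI) (simp_all add: linear_add linear_cmul)
    ultimately show "inj (frechet_derivative (\<lambda>p. (x p, z p)) (at p))"
      unfolding D by (subst linear_injective_0) (auto simp: zero_prod_def)
  qed
qed

section \<open>The bicharacteristic system\<close>

text \<open>Smoothness of \<open>q\<close> is given for each fixed covector. Here the form becomes a
  polynomial in \<open>v\<close> whose coefficients are values at fixed vectors, which yields joint
  smoothness in \<open>Ck_on_lifted\<close>.\<close>

lemma quadratic_form_polarization:
  assumes "quadratic_form Q"
  shows "Q v = (\<Sum>i\<in>UNIV. \<Sum>j\<in>UNIV. (v $ i * v $ j) *
    ((Q (axis i 1 + axis j 1) - Q (axis i 1) - Q (axis j 1)) / 2))"
proof -
  obtain A where A: "transpose A = A" "\<And>v. Q v = v \<bullet> (A *v v)"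
    using assms unfolding quadratic_form_def by blast
  have sym: "A $ j $ i = A $ i $ j" for i j
    using A(1) by (metis transpose_def vec_lambda_beta)
  have e: "axis i 1 \<bullet> (A *v axis j 1) = A $ i $ j" for i j
    by (simp add: inner_axis' matrix_vector_mult_basis column_def)
  have "(Q (axis i 1 + axis j 1) - Q (axis i 1) - Q (axis j 1)) / 2 = A $ i $ j" for i j
    by (simp add: A(2) matrix_vector_right_distrib inner_add_left inner_add_right e sym[of j i])
  moreover have "Q v = (\<Sum>i\<in>UNIV. \<Sum>j\<in>UNIV. (v $ i * v $ j) * A $ i $ j)"
    by (simp add: A(2) inner_vec_def matrix_vector_mult_def sum_distrib_left algebra_simps)
  ultimately show ?thesis by simp
qed

text \<open>Viewing \<open>q\<close> on the whole phase space makes all its partial derivatives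
  values of a single derivative, to which the calculus of \<open>Ck_on\<close> applies.\<close>

definition lifted :: "(real \<Rightarrow> real^'n \<Rightarrow> real^'n \<Rightarrow> real) \<Rightarrow> real \<times> (real^'n) \<times> real \<times> (real^'n::finite) \<Rightarrow> real" where
  "lifted q p = q (fst p) (fst (snd p)) (snd (snd (snd p)))"

definition phase_domain :: "(real \<times> (real^'n)) set \<Rightarrow> (real \<times> (real^'n) \<times> real \<times> (real^'n::finite)) set" where
  "phase_domain U = {p. (fst p, fst (snd p)) \<in> U}"

text \<open>The Hamilton vector field of \<open>symbol q\<close> in the order x, z, \<lambda>,
  \<eta>.\<close>

definition bicharacteristic_field ::
  "(real \<Rightarrow> real^'n \<Rightarrow> real^'n \<Rightarrow> real) \<Rightarrow> real \<times> (real^'n) \<times> real \<times> (real^'n::finite) \<Rightarrow> real \<times> (real^'n) \<times> real \<times> (real^'n)" where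
  "bicharacteristic_field q p =
    (2 * fst (snd (snd p)), \<chi> i. frechet_derivative (lifted q) (at p) (0, 0, 0, axis i 1),
     - frechet_derivative (lifted q) (at p) (1, 0, 0, 0),
     - (\<chi> i. frechet_derivative (lifted q) (at p) (0, axis i 1, 0, 0)))"

lemma open_phase_domain: "open U \<Longrightarrow> open (phase_domain U)"
proof -
  assume "open U"
  moreover have "phase_domain U = (\<lambda>p. (fst p, fst (snd p))) -` U" by (auto simp: phase_domain_def)
  ultimately show ?thesis by (simp add: open_vimage continuous_on_Pair continuous_on_fst continuous_on_snd)
qed

lemma Ck_on_lifted:
  assumes U: "open U" and q: "\<And>\<eta>. smooth_on U (\<lambda>(x, z). q x z \<eta>)"
    and form: "\<And>x z. (x, z) \<in> U \<Longrightarrow> quadratic_form (q x z)"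
  shows "Ck_on m (phase_domain U) (lifted q)"
proof -
  let ?W = "phase_domain U"
  have W: "open ?W" using U by (rule open_phase_domain)
  have c: "Ck_on m ?W (\<lambda>p. q (fst p) (fst (snd p)) \<eta>)" for \<eta>
  proof -
    have "Ck_on m ?W (\<lambda>p. (\<lambda>(x, z). q x z \<eta>) (fst p, fst (snd p)))"
      by (rule Ck_on_compose[OF W _ smooth_on_openD[OF q U]], intro Ck_on_Pair Ck_on_fst Ck_on_snd Ck_on_ident W)
        (simp add: phase_domain_def)
    then show ?thesis by simp
  qed
  have v: "Ck_on m ?W (\<lambda>p. snd (snd (snd p)) $ i)" for i
    by (intro Ck_on_bounded_linear[OF bounded_linear_vec_nth W] Ck_on_snd Ck_on_ident W)
  let ?q = "\<lambda>p v. q (fst p) (fst (snd p)) v"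
  have d: "Ck_on m ?W (\<lambda>p. (?q p (axis i 1 + axis j 1) - ?q p (axis i 1) - ?q p (axis j 1)) / 2)" for i j
    by (rule Ck_on_bounded_linear[OF bounded_linear_divide W]) (intro Ck_on_diff c W)
  have C: "Ck_on m ?W (\<lambda>p. \<Sum>i\<in>UNIV. \<Sum>j\<in>UNIV. (snd (snd (snd p)) $ i * snd (snd (snd p)) $ j) *
     ((?q p (axis i 1 + axis j 1) - ?q p (axis i 1) - ?q p (axis j 1)) / 2))"
    by (rule Ck_on_sum[OF W], rule Ck_on_sum[OF W], rule Ck_on_mult[OF W Ck_on_mult[OF W v v] d])
  have eq: "lifted q p = (\<Sum>i\<in>UNIV. \<Sum>j\<in>UNIV. (snd (snd (snd p)) $ i * snd (snd (snd p)) $ j) *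
     ((?q p (axis i 1 + axis j 1) - ?q p (axis i 1) - ?q p (axis j 1)) / 2))" if "p \<in> ?W" for p
    unfolding lifted_def using that
    by (intro quadratic_form_polarization form) (simp add: phase_domain_def)
  show ?thesis by (rule iffD2[OF Ck_on_cong[OF W eq] C])
qed

lemma Ck_on_bicharacteristic_field:
  assumes W: "open W" and q: "\<And>m. Ck_on m W (lifted q)"
  shows "Ck_on m W (bicharacteristic_field q)"
proof -
  have D: "Ck_on m W (\<lambda>p. frechet_derivative (lifted q) (at p) v)" for v
    using q[of "Suc m"] by (simp only: Ck_on.simps(2))
  have "Ck_on m W (\<lambda>p. 2 * fst (snd (snd p)))"
    by (intro Ck_on_bounded_linear[OF bounded_linear_mult_right W] Ck_on_fst Ck_on_snd Ck_on_ident W)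
  then show ?thesis
    unfolding bicharacteristic_field_def[abs_def]
    by (intro Ck_on_Pair Ck_on_minus Ck_on_vec_lambda D W)
qed

lemma
  assumes q: "(lifted q has_derivative D) (at (x, z, l, e))"
  shows deriv_lifted_x: "((\<lambda>x. q x z e) has_real_derivative D (1, 0, 0, 0)) (at x)"
    and grad_lifted_z: "grad (\<lambda>z. q x z e) z = (\<chi> i. D (0, axis i 1, 0, 0))"
    and grad_lifted_e: "grad (q x z) e = (\<chi> i. D (0, 0, 0, axis i 1))"
proof -
  have "((\<lambda>x. (x, z, l, e)) has_derivative (\<lambda>c. (c, 0, 0, 0))) (at x)"
    by (intro has_derivative_Pair has_derivative_ident has_derivative_const)
  from has_derivative_compose[OF this q]
  have "((\<lambda>x. q x z e) has_derivative (\<lambda>c. D (c, 0, 0, 0))) (at x)" by (simp add: lifted_def)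
  moreover have "(\<lambda>c. D (c, 0, 0, 0)) = (\<lambda>c. D (1, 0, 0, 0) * c)"
  proof
    show "D (c, 0, 0, 0) = D (1, 0, 0, 0) * c" for c
      using linear_cmul[OF has_derivative_linear[OF q], of c "(1, 0, 0, 0)"] by simp
  qed
  ultimately show "((\<lambda>x. q x z e) has_real_derivative D (1, 0, 0, 0)) (at x)"
    unfolding has_field_derivative_def by (simp only:)
  have "((\<lambda>z. (x, z, l, e)) has_derivative (\<lambda>v. (0, v, 0, 0))) (at z)"
    by (intro has_derivative_Pair has_derivative_ident has_derivative_const)
  from has_derivative_compose[OF this q]
  have "((\<lambda>z. q x z e) has_derivative (\<lambda>v. D (0, v, 0, 0))) (at z)" by (simp add: lifted_def)
  then show "grad (\<lambda>z. q x z e) z = (\<chi> i. D (0, axis i 1, 0, 0))"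
    unfolding grad_def by (simp only: frechet_derivative_eq)
  have "((\<lambda>e. (x, z, l, e)) has_derivative (\<lambda>v. (0, 0, 0, v))) (at e)"
    by (intro has_derivative_Pair has_derivative_ident has_derivative_const)
  from has_derivative_compose[OF this q]
  have "(q x z has_derivative (\<lambda>v. D (0, 0, 0, v))) (at e)" by (simp add: lifted_def)
  then show "grad (q x z) e = (\<chi> i. D (0, 0, 0, axis i 1))"
    unfolding grad_def by (simp only: frechet_derivative_eq)
qed

lemma
  fixes \<phi> :: "real \<Rightarrow> real^'n::finite \<Rightarrow> real"
  assumes "((\<lambda>(x, z). \<phi> x z) has_derivative D) (at (x, z))"
  shows deriv_uncurry_fst: "deriv (\<lambda>x. \<phi> x z) x = D (1, 0)"
    and grad_uncurry_snd: "grad (\<phi> x) z = (\<chi> i. D (0, axis i 1))"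
proof -
  have "((\<lambda>x. (x, z)) has_derivative (\<lambda>c. (c, 0))) (at x)"
    by (intro has_derivative_Pair has_derivative_ident has_derivative_const)
  from has_derivative_compose[OF this assms]
  have "((\<lambda>x. \<phi> x z) has_derivative (\<lambda>c. D (c, 0))) (at x)" by simp
  moreover have "(\<lambda>c. D (c, 0)) = (\<lambda>c. D (1, 0) * c)"
  proof
    show "D (c, 0) = D (1, 0) * c" for c
      using linear_cmul[OF has_derivative_linear[OF assms], of c "(1, 0)"] by simp
  qed
  ultimately have "((\<lambda>x. \<phi> x z) has_real_derivative D (1, 0)) (at x)"
    unfolding has_field_derivative_def by (simp only:)
  then show "deriv (\<lambda>x. \<phi> x z) x = D (1, 0)" by (rule DERIV_imp_deriv)
  have "((\<lambda>z. (x, z)) has_derivative (\<lambda>v. (0, v))) (at z)"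
    by (intro has_derivative_Pair has_derivative_ident has_derivative_const)
  from has_derivative_compose[OF this assms]
  have "(\<phi> x has_derivative (\<lambda>v. D (0, v))) (at z)" by simp
  then show "grad (\<phi> x) z = (\<chi> i. D (0, axis i 1))"
    unfolding grad_def by (simp only: frechet_derivative_eq)
qed

section \<open>Glancing condition and eikonal equation at the base point\<close>

lemma grad_const: "grad (\<lambda>z. c) z = 0"
  by (simp add: grad_def vec_eq_iff)

lemma hamilton_field_coord_x:
  fixes q :: "real \<Rightarrow> real^'n \<Rightarrow> real^'n::finite \<Rightarrow> real"
  shows "hamilton_field (symbol q) coord_x = (\<lambda>x z l \<eta>. 2 * l)"
proof (intro ext)
  fix x l :: real and z \<eta> :: "real^'n"
  have "((\<lambda>l. l\<^sup>2 + q x z \<eta>) has_real_derivative 2 * l) (at l)"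
    by (auto intro!: derivative_eq_intros)
  from DERIV_imp_deriv[OF this] show "hamilton_field (symbol q) coord_x x z l \<eta> = 2 * l"
    by (simp add: hamilton_field_def symbol_def coord_x_def grad_const)
qed

text \<open>Since H_p x = 2 \<lambda> depends on \<lambda> alone, H_p^2 x is -2 times the derivative
  of \<open>q\<close> in \<open>x\<close>.\<close>

lemma diffractive_order2_imp_deriv_x:
  assumes "diffractive_order2 q \<eta>"
  shows "deriv (\<lambda>x. q x 0 \<eta>) 0 < 0"
proof -
  have "((\<lambda>l. 2 * l) has_real_derivative 2) (at 0)"
    by (auto intro!: derivative_eq_intros)
  from DERIV_imp_deriv[OF this]
  have "hamilton_field (symbol q) (\<lambda>x z l \<eta>. 2 * l) 0 0 0 \<eta> = - (deriv (\<lambda>x. q x 0 \<eta>) 0 * 2)"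
    by (simp add: hamilton_field_def symbol_def grad_const)
  then show ?thesis
    using assms unfolding diffractive_order2_def hamilton_field_coord_x by simp
qed

text \<open>The equation is differentiated along \<open>z = 0\<close>. The square contributes
  nothing, since the normal derivative of the phase vanishes at the origin; the covector moves with
  velocity \<open>axis k 1\<close>, by symmetry of second derivatives and the normalization of the
  phase at \<open>x = 0\<close>.\<close>

lemma eikonal_transversality:
  fixes \<phi> :: "real \<Rightarrow> real^'n::finite \<Rightarrow> real"
  assumes U: "open U" "(0, 0) \<in> U"
    and q: "\<And>m. Ck_on m (phase_domain U) (lifted q)"
    and \<phi>: "\<And>m. Ck_on m U (\<lambda>(x, z). \<phi> x z)"
    and eikonal: "\<And>x z. (x, z) \<in> U \<Longrightarrow> 0 \<le> x \<Longrightarrow>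
        (deriv (\<lambda>x'. \<phi> x' z) x)\<^sup>2 + q x z (grad (\<phi> x) z) = 0"
    and normal: "\<And>z. (0, z) \<in> U \<Longrightarrow> deriv (\<lambda>x. \<phi> x z) 0 = z $ k"
  shows "frechet_derivative (lifted q) (at (0, 0, 0, grad (\<phi> 0) 0)) (0, 0, 0, axis k 1) =
       - frechet_derivative (lifted q) (at (0, 0, 0, grad (\<phi> 0) 0)) (1, 0, 0, 0)"
proof -
  let ?\<Phi> = "\<lambda>(x, z). \<phi> x z"
  let ?D = "\<lambda>v p. frechet_derivative ?\<Phi> (at p) v"
  let ?DQ = "frechet_derivative (lifted q) (at (0, 0, 0, grad (\<phi> 0) 0))"
  have D\<Phi>: "(?\<Phi> has_derivative (\<lambda>v. ?D v p)) (at p)" if "p \<in> U" for p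
    by (rule Ck_on_Suc_imp_has_derivative[OF \<phi> that])
  have DD: "(?D v has_derivative frechet_derivative (?D v) (at p)) (at p)" if "p \<in> U" for p v
  proof (rule Ck_on_Suc_imp_has_derivative[OF _ that])
    show "Ck_on (Suc 0) U (?D v)" using \<phi>[of "Suc (Suc 0)"] by (simp only: Ck_on.simps(2)[of "Suc 0"])
  qed
  have mixed: "frechet_derivative (?D (0, v)) (at (0, 0)) (1, 0) = v $ k" for v
  proof -
    have "frechet_derivative (?D (0, v)) (at (0, 0)) (1, 0) = frechet_derivative (?D (1, 0)) (at (0, 0)) (0, v)"
      by (rule Ck_on_2_second_derivative_symmetric[OF U(1) \<phi> U(2)])
    moreover have "((\<lambda>z. (0::real, z)) has_derivative (\<lambda>v. (0, v))) (at (0::real^'n))"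
      by (intro has_derivative_Pair has_derivative_ident has_derivative_const)
    from has_derivative_compose[OF this DD[OF U(2)], of "(1, 0)"]
    have "((\<lambda>z. ?D (1, 0) (0, z)) has_derivative (\<lambda>v. frechet_derivative (?D (1, 0)) (at (0, 0)) (0, v))) (at 0)" .
    then have "((\<lambda>z. z $ k) has_derivative (\<lambda>v. frechet_derivative (?D (1, 0)) (at (0, 0)) (0, v))) (at 0)"
    proof (rule has_derivative_transform_within_open)
      show "open ((\<lambda>z. (0::real, z)) -` U)" by (intro open_vimage U continuous_intros)
      show "?D (1, 0) (0, z) = z $ k" if "z \<in> (\<lambda>z. (0::real, z)) -` U" for z
        using deriv_uncurry_fst[OF D\<Phi>, of 0 z] normal[of z] that by simp
    qed (use U in simp)
    then have "(\<lambda>v. frechet_derivative (?D (1, 0)) (at (0, 0)) (0, v)) = (\<lambda>v. v $ k)"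
      by (rule has_derivative_unique) (intro bounded_linear_imp_has_derivative bounded_linear_vec_nth)
    ultimately show ?thesis by metis
  qed
  define g where "g x = (\<chi> i. ?D (0, axis i 1) (x, 0))" for x
  have along: "((\<lambda>x. ?D v (x, 0)) has_vector_derivative frechet_derivative (?D v) (at (0, 0)) (1, 0)) (at 0)" for v
  proof -
    have "((\<lambda>x::real. (x, 0::real^'n)) has_derivative (\<lambda>c. (c, 0))) (at 0)"
      by (intro has_derivative_Pair has_derivative_ident has_derivative_const)
    from has_derivative_compose[OF this DD[OF U(2)], of v]
    have "((\<lambda>x. ?D v (x, 0)) has_derivative (\<lambda>c. frechet_derivative (?D v) (at (0, 0)) (c, 0))) (at 0)" .
    moreover have "(\<lambda>c. frechet_derivative (?D v) (at (0, 0)) (c, 0)) = (\<lambda>c. c *\<^sub>R frechet_derivative (?D v) (at (0, 0)) (1, 0))"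
    proof
      show "frechet_derivative (?D v) (at (0, 0)) (c, 0) = c *\<^sub>R frechet_derivative (?D v) (at (0, 0)) (1, 0)" for c
        using linear_cmul[OF has_derivative_linear[OF DD[OF U(2)]], of v c "(1, 0)"] by simp
    qed
    ultimately show ?thesis unfolding has_vector_derivative_def by (simp only:)
  qed
  have gsum: "g x = (\<Sum>i\<in>UNIV. ?D (0, axis i 1) (x, 0) *\<^sub>R axis i 1)" for x
    by (simp add: g_def vec_eq_iff axis_def if_distrib cong: if_cong)
  have g': "(g has_vector_derivative axis k 1) (at 0)"
  proof -
    have "(g has_vector_derivative (\<Sum>i\<in>UNIV. frechet_derivative (?D (0, axis i 1)) (at (0, 0)) (1, 0) *\<^sub>R axis i 1)) (at 0)"
      unfolding gsum[abs_def]
      by (intro has_vector_derivative_sum bounded_linear.has_vector_derivative[OF bounded_linear_scaleR_left] along)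
    also have "(\<Sum>i\<in>UNIV. frechet_derivative (?D (0, axis i 1)) (at (0, 0)) (1, 0) *\<^sub>R axis i 1) = (axis k 1 :: real^'n)"
    proof -
      have "frechet_derivative (?D (0, axis i 1)) (at (0, 0)) (1, 0) *\<^sub>R axis i 1 = (if i = k then axis k 1 else (0::real^'n))" for i
        unfolding mixed by (simp add: axis_def)
      then show ?thesis by simp
    qed
    finally show ?thesis .
  qed
  have g0: "g 0 = grad (\<phi> 0) 0" using grad_uncurry_snd[OF D\<Phi>[OF U(2)]] by (simp add: g_def)
  have QD: "(lifted q has_derivative ?DQ) (at (0, 0, 0, g 0))"
    unfolding g0 by (rule Ck_on_Suc_imp_has_derivative[OF q]) (use U in \<open>simp add: phase_domain_def\<close>)
  have d1: "((\<lambda>x. (x, 0, 0, g x)) has_derivative (\<lambda>c. (c, 0, 0, c *\<^sub>R axis k 1))) (at 0)"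
    using g' unfolding has_vector_derivative_def
    by (intro has_derivative_Pair has_derivative_ident has_derivative_const)
  have Q': "((\<lambda>x. lifted q (x, 0, 0, g x)) has_vector_derivative ?DQ (1, 0, 0, axis k 1)) (at 0)"
  proof -
    have "((\<lambda>x. lifted q (x, 0, 0, g x)) has_derivative (\<lambda>c. ?DQ (c, 0, 0, c *\<^sub>R axis k 1))) (at 0)"
      by (rule has_derivative_compose[OF d1 QD])
    moreover have "(\<lambda>c. ?DQ (c, 0, 0, c *\<^sub>R axis k 1)) = (\<lambda>c. c *\<^sub>R ?DQ (1, 0, 0, axis k 1))"
    proof
      show "?DQ (c, 0, 0, c *\<^sub>R axis k 1) = c *\<^sub>R ?DQ (1, 0, 0, axis k 1)" for c
        using linear_cmul[OF has_derivative_linear[OF QD], of c "(1, 0, 0, axis k 1)"] by simp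
    qed
    ultimately show ?thesis unfolding has_vector_derivative_def by (simp only:)
  qed
  have D10: "?D (1, 0) (0, 0) = 0"
    using deriv_uncurry_fst[OF D\<Phi>[OF U(2)]] normal[OF U(2)] by simp
  let ?E = "\<lambda>x. ?D (1, 0) (x, 0) * ?D (1, 0) (x, 0) + lifted q (x, 0, 0, g x)"
  have "(?E has_vector_derivative ?DQ (1, 0, 0, axis k 1)) (at 0)"
    using has_vector_derivative_add[OF has_vector_derivative_mult[OF along along] Q', of "(1, 0)" "(1, 0)"] D10 by simp
  \<comment> \<open>The eikonal equation is available for \<open>x \<ge> 0\<close> only; a
    derivative from the right is still unique.\<close>
  then have E': "(?E has_vector_derivative ?DQ (1, 0, 0, axis k 1)) (at 0 within {0..})"
    by (rule has_vector_derivative_at_within)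
  obtain d where d: "d > 0" "ball (0, 0) d \<subseteq> U" using U open_contains_ball by blast
  have "?E x = 0" if "0 \<le> x" "x < d" for x
  proof -
    have xU: "(x, 0) \<in> U" using d that by (intro subsetD[OF d(2)]) (simp add: dist_Pair_Pair)
    show ?thesis
      using eikonal[OF xU that(1)] deriv_uncurry_fst[OF D\<Phi>[OF xU]] grad_uncurry_snd[OF D\<Phi>[OF xU]]
      by (simp add: lifted_def g_def power2_eq_square)
  qed
  then have "((\<lambda>x. 0) has_vector_derivative ?DQ (1, 0, 0, axis k 1)) (at 0 within {0..})"
    using d(1) by (intro has_vector_derivative_transform_within[OF E', of d]) (auto simp: dist_real_def)
  moreover have "at (0::real) within {0..} \<noteq> bot"
    by (simp add: trivial_limit_at_right_real at_within_Ici_at_right)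
  ultimately have "?DQ (1, 0, 0, axis k 1) = 0"
    using vector_derivative_unique_within[OF _ _ has_vector_derivative_const] by metis
  moreover have "?DQ (1, 0, 0, axis k 1) = ?DQ (1, 0, 0, 0) + ?DQ (0, 0, 0, axis k 1)"
    using linear_add[OF has_derivative_linear[OF QD], of "(1, 0, 0, 0)" "(0, 0, 0, axis k 1)"] by simp
  ultimately show ?thesis by simp
qed

text \<open>Collects the component equations into one autonomous system, the form to which the
  uniqueness part of \<open>smooth_local_flow\<close> applies.\<close>

lemma reflected_flow_bicharacteristic:
  assumes flow: "reflected_flow k U q \<phi> T r X Z L E"
    and q: "\<And>m. Ck_on m (phase_domain U) (lifted q)"
    and y: "y \<in> ball 0 r" "y $ k \<le> 0" and s: "s \<in> {0..T}"
  shows "(X s y, Z s y, L s y, E s y) \<in> phase_domain U"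
    and "((\<lambda>s. (X s y, Z s y, L s y, E s y)) has_vector_derivative
          bicharacteristic_field q (X s y, Z s y, L s y, E s y)) (at s within {0..T})"
proof -
  have U: "(X s y, Z s y) \<in> U"
    and d: "((\<lambda>t. X t y) has_real_derivative 2 * L s y) (at s within {0..T})"
      "((\<lambda>t. Z t y) has_vector_derivative grad (q (X s y) (Z s y)) (E s y)) (at s within {0..T})"
      "((\<lambda>t. L t y) has_real_derivative - deriv (\<lambda>x. q x (Z s y) (E s y)) (X s y)) (at s within {0..T})"
      "((\<lambda>t. E t y) has_vector_derivative - grad (\<lambda>z. q (X s y) z (E s y)) (Z s y)) (at s within {0..T})"
    using flow y s unfolding reflected_flow_def by blast+
  show W: "(X s y, Z s y, L s y, E s y) \<in> phase_domain U"
    using U by (simp add: phase_domain_def)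
  note D = Ck_on_Suc_imp_has_derivative[OF q W]
  show "((\<lambda>s. (X s y, Z s y, L s y, E s y)) has_vector_derivative
          bicharacteristic_field q (X s y, Z s y, L s y, E s y)) (at s within {0..T})"
    using d unfolding bicharacteristic_field_def fst_conv snd_conv has_real_derivative_iff_has_vector_derivative
      DERIV_imp_deriv[OF deriv_lifted_x[OF D]] grad_lifted_z[OF D] grad_lifted_e[OF D]
    by (intro has_vector_derivative_Pair)
qed

section \<open>The reflected flow near the glancing point\<close>

theorem propositionA1:
  fixes k :: "'n::finite"
    and U :: "(real \<times> (real^'n)) set"
    and q :: "real \<Rightarrow> real^'n \<Rightarrow> real^'n \<Rightarrow> real"
    and \<phi> :: "real \<Rightarrow> real^'n \<Rightarrow> real"
    and \<eta>0 :: "real^'n"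
    and T r :: real
    and X L :: "real \<Rightarrow> real^'n \<Rightarrow> real"
    and Z E :: "real \<Rightarrow> real^'n \<Rightarrow> real^'n"
  assumes U: "open U" "(0, 0) \<in> U"
    and q_smooth: "\<And>\<eta>. smooth_on U (\<lambda>(x, z). q x z \<eta>)"
    and q_form: "\<And>x z. (x, z) \<in> U \<Longrightarrow> quadratic_form (q x z)"
    and q_signature: "\<And>x z. (x, z) \<in> U \<Longrightarrow> has_signature (q x z) (CARD('n) - 1) 1"
    and phase_smooth: "smooth_on U (\<lambda>(x, z). \<phi> x z)"
    and eikonal: "\<And>x z. (x, z) \<in> U \<Longrightarrow> 0 \<le> x \<Longrightarrow>
        (deriv (\<lambda>x'. \<phi> x' z) x)\<^sup>2 + q x z (grad (\<phi> x) z) = 0"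
    and phase_normal: "\<And>z. (0, z) \<in> U \<Longrightarrow> deriv (\<lambda>x. \<phi> x z) 0 = z $ k"
    and base: "\<eta>0 = grad (\<phi> 0) 0"
    and glancing: "diffractive_order2 q \<eta>0"
    and box: "0 < T" "0 < r"
    and flow: "reflected_flow k U q \<phi> T r X Z L E"
  shows "\<exists>\<epsilon>>0. \<forall>V \<omega>.
      openin (top_of_set (param_wedge k)) V \<and> (0, 0) \<in> V \<and> \<omega> = closure V \<and> \<omega> \<subseteq> ball (0, 0) \<epsilon> \<longrightarrow>
      (let Zr = (\<lambda>(s, y). (X s y, Z s y));
           \<omega>' = \<omega> \<inter> {(s, y). y $ k < 0}
       in smooth_diffeomorphism \<omega>' (Zr ` \<omega>') Zr \<and>
          (\<exists>Y. homeomorphism \<omega> (Zr ` \<omega>) Zr Y))"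
proof -
  let ?W = "phase_domain U"
  let ?F = "bicharacteristic_field q"
  have W: "open ?W" using U(1) by (rule open_phase_domain)
  have qC: "Ck_on m ?W (lifted q)" for m by (rule Ck_on_lifted[OF U(1) q_smooth q_form])
  have FC: "Ck_on m ?W ?F" for m by (rule Ck_on_bicharacteristic_field[OF W qC])
  have \<phi>C: "Ck_on m U (\<lambda>(x, z). \<phi> x z)" for m by (rule smooth_on_openD[OF phase_smooth U(1)])
  define P where "P = (\<lambda>y. (0::real, y)) -` U"
  have P: "open P" "0 \<in> P" unfolding P_def using U by (auto intro!: open_vimage continuous_intros)
  define u0 where "u0 y = (0::real, y, - (y $ k), grad (\<phi> 0) y)" for y
  have "Ck_on m P (grad (\<phi> 0))" for m
  proof -
    have D: "Ck_on m U (\<lambda>p. frechet_derivative (\<lambda>(x, z). \<phi> x z) (at p) v)" for v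
      using \<phi>C[of "Suc m"] by (simp only: Ck_on.simps(2))
    have C: "Ck_on m P (\<lambda>y. \<chi> i. frechet_derivative (\<lambda>(x, z). \<phi> x z) (at (0, y)) (0, axis i 1))"
      by (intro Ck_on_vec_lambda P, rule Ck_on_compose[OF P(1) _ D])
        (intro Ck_on_Pair Ck_on_const Ck_on_ident P, simp add: P_def)
    have eq: "grad (\<phi> 0) y = (\<chi> i. frechet_derivative (\<lambda>(x, z). \<phi> x z) (at (0, y)) (0, axis i 1))" if "y \<in> P" for y
      using that by (intro grad_uncurry_snd Ck_on_Suc_imp_has_derivative[OF \<phi>C]) (simp add: P_def)
    show ?thesis by (rule iffD2[OF Ck_on_cong[OF P(1) eq] C])
  qed
  then have u0C: "Ck_on m P u0" for m
    unfolding u0_def[abs_def]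
    by (intro Ck_on_Pair Ck_on_const Ck_on_ident Ck_on_minus Ck_on_linear[OF bounded_linear_vec_nth] P)
  have u0W: "u0 0 \<in> ?W" using U by (simp add: u0_def phase_domain_def)
  obtain \<tau> \<delta> u where \<tau>: "\<tau> > 0" "\<delta> > 0" and \<delta>P: "ball 0 \<delta> \<subseteq> P"
    and uC: "\<And>m. Ck_on m ({-\<tau><..<\<tau>} \<times> ball 0 \<delta>) u"
    and u_init: "\<And>y. y \<in> ball 0 \<delta> \<Longrightarrow> u (0, y) = u0 y"
    and u_ode: "\<And>t y. t \<in> {-\<tau><..<\<tau>} \<Longrightarrow> y \<in> ball 0 \<delta> \<Longrightarrow>
       u (t, y) \<in> ?W \<and> ((\<lambda>t. u (t, y)) has_vector_derivative ?F (u (t, y))) (at t)"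
    and u_unique: "\<And>w T t y. y \<in> ball 0 \<delta> \<Longrightarrow> T < \<tau> \<Longrightarrow> w 0 = u0 y \<Longrightarrow>
       (\<And>t. t \<in> {0..T} \<Longrightarrow> w t \<in> ?W \<and> (w has_vector_derivative ?F (w t)) (at t within {0..T})) \<Longrightarrow>
       t \<in> {0..T} \<Longrightarrow> w t = u (t, y)"
    by (rule smooth_local_flow[OF W FC P u0C u0W]) blast
  \<comment> \<open>Two-sided in \<open>s\<close> and without a sign condition on \<open>y\<close>:
    a full neighborhood on which the flow extends smoothly past the wedge.\<close>
  let ?O = "{-\<tau><..<\<tau>} \<times> ball (0::real^'n) \<delta>"
  have O: "open ?O" "(0, 0) \<in> ?O" using \<tau> by (auto intro: open_Times)
  have Du: "(u has_derivative frechet_derivative u (at p)) (at p)" if "p \<in> ?O" for p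
    by (rule Ck_on_Suc_imp_has_derivative[OF uC that])
  have Du1: "frechet_derivative u (at p) (1, 0) = ?F (u p)" if p: "p \<in> ?O" for p
  proof -
    obtain t y where ty: "p = (t, y)" "t \<in> {-\<tau><..<\<tau>}" "y \<in> ball 0 \<delta>" using p by auto
    have "((\<lambda>t. (t, y)) has_vector_derivative (1, 0)) (at t)"
      by (intro has_vector_derivative_Pair has_vector_derivative_id has_vector_derivative_const)
    then have "((\<lambda>t. u (t, y)) has_vector_derivative frechet_derivative u (at (t, y)) (1, 0)) (at t)"
      using vector_derivative_diff_chain_within[of "\<lambda>t. (t, y)" "(1, 0)" t UNIV u "frechet_derivative u (at (t, y))"]
        has_derivative_at_withinI[OF Du[OF p]] by (simp add: ty o_def)
    then show ?thesis using vector_derivative_unique_at u_ode[OF ty(2,3)] ty(1) by blast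
  qed
  define x where "x p = fst (u p)" for p
  define z where "z p = fst (snd (u p))" for p
  define l where "l p = fst (snd (snd (u p)))" for p
  have C: "Ck_on m ?O x" "Ck_on m ?O z" "Ck_on m ?O l" for m
    unfolding x_def[abs_def] z_def[abs_def] l_def[abs_def] by (intro Ck_on_fst Ck_on_snd O uC)+
  have D: "frechet_derivative x (at p) h = fst (frechet_derivative u (at p) h)"
    "frechet_derivative z (at p) h = fst (snd (frechet_derivative u (at p) h))"
    "frechet_derivative l (at p) h = fst (snd (snd (frechet_derivative u (at p) h)))" if "p \<in> ?O" for p h
    unfolding x_def[abs_def] z_def[abs_def] l_def[abs_def]
    by (simp_all add: frechet_derivative_eq[OF has_derivative_fst[OF Du[OF that]]]
        frechet_derivative_eq[OF has_derivative_fst[OF has_derivative_snd[OF Du[OF that]]]]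
        frechet_derivative_eq[OF has_derivative_fst[OF has_derivative_snd[OF has_derivative_snd[OF Du[OF that]]]]])
  let ?DQ = "frechet_derivative (lifted q) (at (0, 0, 0, \<eta>0))"
  have u00: "u (0, 0) = (0, 0, 0, \<eta>0)" using u_init[of 0] \<tau> by (simp add: u0_def base)
  have \<eta>W: "(0, 0, 0, \<eta>0) \<in> ?W" using U by (simp add: phase_domain_def)
  define a where "a = - ?DQ (1, 0, 0, 0)"
  have a: "a > 0"
    using diffractive_order2_imp_deriv_x[OF glancing]
      DERIV_imp_deriv[OF deriv_lifted_x[OF Ck_on_Suc_imp_has_derivative[OF qC \<eta>W]]] by (simp add: a_def)
  have transversal: "?DQ (0, 0, 0, axis k 1) = a"
    unfolding a_def base by (rule eikonal_transversality[OF U qC \<phi>C eikonal phase_normal])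
  have dx: "frechet_derivative x (at p) (1, 0) = 2 * l p" if "p \<in> ?O" for p
    unfolding D[OF that] Du1[OF that] by (simp add: bicharacteristic_field_def l_def)
  have dl: "frechet_derivative l (at (0, 0)) (1, 0) = a"
    unfolding D[OF O(2)] Du1[OF O(2)] u00 by (simp add: bicharacteristic_field_def a_def)
  have dz: "frechet_derivative z (at (0, 0)) (1, 0) $ k = a"
    unfolding D[OF O(2)] Du1[OF O(2)] u00 by (simp add: bicharacteristic_field_def transversal)
  have start: "x (0, y) = 0" "z (0, y) = y" "l (0, y) = - (y $ k)" if "(0, y) \<in> ?O" for y
    using u_init[of y] that by (auto simp: x_def z_def l_def u0_def)
  let ?G = "\<lambda>p. (x p, z p)"
  obtain \<epsilon>' where \<epsilon>': "\<epsilon>' > 0" "ball (0, 0) \<epsilon>' \<subseteq> ?O" "inj_on ?G (ball (0, 0) \<epsilon>' \<inter> param_wedge k)"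
    "\<And>p. p \<in> ball (0, 0) \<epsilon>' \<inter> param_wedge k \<Longrightarrow> snd p $ k < 0 \<Longrightarrow> inj (frechet_derivative ?G (at p))"
    by (rule fold_local_injectivity[OF O C start dx dl a refl dz]) blast+
  \<comment> \<open>\<open>T\<close> and \<open>r\<close> keep the parameters inside the box on
    which the given flow is a solution.\<close>
  define \<epsilon> where "\<epsilon> = Min {\<epsilon>', T, r}"
  have \<epsilon>: "\<epsilon> > 0" "\<epsilon> \<le> \<epsilon>'" "\<epsilon> \<le> T" "\<epsilon> \<le> r" using \<epsilon>' box by (auto simp: \<epsilon>_def)
  have agree: "(X s y, Z s y) = ?G (s, y)" if p: "(s, y) \<in> ball (0, 0) \<epsilon>" "(s, y) \<in> param_wedge k" for s y
  proof -
    have "norm (s, y) < \<epsilon>" using p(1) unfolding zero_prod_def[symmetric] mem_ball_0 .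
    then have n: "\<bar>s\<bar> < \<epsilon>" "norm y < \<epsilon>"
      using norm_fst_le[of s y] norm_snd_le[of y s] by auto
    have w: "0 \<le> s" "y $ k \<le> 0" using p(2) by (auto simp: param_wedge_def)
    have sT: "{0..s} \<subseteq> {0..T}" using n \<epsilon> by auto
    have yr: "y \<in> ball 0 r" using n \<epsilon> by simp
    have sy: "(s, y) \<in> ?O" using p(1) \<epsilon>(2) by (intro subsetD[OF \<epsilon>'(2)]) simp
    let ?w = "\<lambda>t. (X t y, Z t y, L t y, E t y)"
    \<comment> \<open>Uniqueness is used on \<open>{0..s}\<close>, which lies both in
      \<open>{0..T}\<close> and in the time interval of \<open>u\<close>.\<close>
    have "?w s = u (s, y)"
    proof (rule u_unique[where w = ?w and T = s])
      show "?w 0 = u0 y" using flow yr w unfolding reflected_flow_def u0_def by simp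
      fix t assume t: "t \<in> {0..s}"
      then have tT: "t \<in> {0..T}" using sT by blast
      show "?w t \<in> ?W \<and> (?w has_vector_derivative ?F (?w t)) (at t within {0..s})"
        using reflected_flow_bicharacteristic[OF flow qC yr w(2) tT] has_vector_derivative_within_subset[OF _ sT] by blast
    qed (use sy w in auto)
    then show ?thesis unfolding x_def z_def by (metis fst_conv snd_conv)
  qed
  have closed_wedge: "closed (param_wedge k)"
  proof -
    have "param_wedge k = {p. 0 \<le> fst p} \<inter> {p. snd p $ k \<le> 0}" by (auto simp: param_wedge_def)
    then show ?thesis by (simp add: closed_Int closed_Collect_le continuous_on_fst continuous_on_snd continuous_on_component)
  qed
  show ?thesis
  proof (intro exI[of _ \<epsilon>] conjI[OF \<epsilon>(1)] allI impI)
    fix V \<omega> :: "(real \<times> (real^'n)) set"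
    assume "openin (top_of_set (param_wedge k)) V \<and> (0, 0) \<in> V \<and> \<omega> = closure V \<and> \<omega> \<subseteq> ball (0, 0) \<epsilon>"
    then have V: "V \<subseteq> param_wedge k" and \<omega>: "\<omega> = closure V" "\<omega> \<subseteq> ball (0, 0) \<epsilon>"
      by (auto dest: openin_imp_subset)
    have wedge: "\<omega> \<subseteq> param_wedge k" using V \<omega>(1) closed_wedge closure_minimal by blast
    have \<omega>': "\<omega> \<subseteq> ball (0, 0) \<epsilon>' \<inter> param_wedge k" using \<omega>(2) wedge \<epsilon>(2) by auto
    \<comment> \<open>A closure inside a ball is closed and bounded; compactness is what turns the
      continuous injection into a homeomorphism.\<close>
    have "compact \<omega>"
      unfolding compact_eq_bounded_closed using \<omega> bounded_subset[OF bounded_ball] by auto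
    moreover have "\<omega> \<subseteq> ?O" using \<omega>' \<epsilon>'(2) by blast
    moreover have "inj_on ?G \<omega>" by (rule inj_on_subset[OF \<epsilon>'(3) \<omega>'])
    moreover have "inj (frechet_derivative ?G (at p))" if "p \<in> \<omega> \<inter> {(s, y). y $ k < 0}" for p
      by (rule \<epsilon>'(4)) (use \<omega>' that in blast, use that in auto)
    moreover have "(\<lambda>(s, y). (X s y, Z s y)) p = ?G p" if "p \<in> \<omega>" for p
      using agree[of "fst p" "snd p"] subsetD[OF \<omega>(2) that] subsetD[OF wedge that] by (simp add: case_prod_beta)
    moreover have "Ck_on m ?O ?G" for m by (intro Ck_on_Pair C O)
    ultimately have "smooth_diffeomorphism (\<omega> \<inter> {(s, y). y $ k < 0})
          ((\<lambda>(s, y). (X s y, Z s y)) ` (\<omega> \<inter> {(s, y). y $ k < 0})) (\<lambda>(s, y). (X s y, Z s y)) \<and>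
        (\<exists>Y. homeomorphism \<omega> ((\<lambda>(s, y). (X s y, Z s y)) ` \<omega>) (\<lambda>(s, y). (X s y, Z s y)) Y)"
      by (intro restriction_smooth_diffeomorphism[OF O(1), of ?G]) auto
    then show "let Zr = (\<lambda>(s, y). (X s y, Z s y)); \<omega>' = \<omega> \<inter> {(s, y). y $ k < 0}
       in smooth_diffeomorphism \<omega>' (Zr ` \<omega>') Zr \<and> (\<exists>Y. homeomorphism \<omega> (Zr ` \<omega>) Zr Y)"
      unfolding Let_def .
  qed
qed

end
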